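(* Let $m\ge 0$ be an integer, let $X$ be a space such that $X\times\mathbb{I}^m$ is a paracompact $cw$-space, let $K$ be a $CW$-complex, and let $f\colon X\to Y$ be a continuous closed surjection with $\dim Y\le m$. If $\operatorname{e-dim} f^{-1}(y)\le K$ for every $y\in Y$, then $\operatorname{e-dim} X\le \Sigma^m K$.
   Context: All spaces are completely regular and all single-valued maps are continuous. $\mathbb{I}=[0,1]$, $\dim$ is covering dimension, and $\Sigma^m K$ is the $m$-fold iterated suspension of $K$. For spaces $L$ and $X$: $L\in AE(X)$ means that every continuous map $A\to L$ defined on a closed subset $A\subset X$ extends continuously to a map $X\to L$. The notation $\operatorname{e-dim} X\le L$ means $L\in AE(X)$. A $cw$-space is a $k$-space $Z$ such that every contractible $CW$-complex is an $AE(Z)$. *)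

theory Defs
  imports "HOL-Analysis.Analysis"
begin

section \<open>Absolute extensors\<close>

text \<open>\<open>abs_extensor L X\<close> is \<open>L \<in> AE(X)\<close>, that is, \<open>e-dim X \<le> L\<close>.\<close>

definition abs_extensor :: "'a topology \<Rightarrow> 'b topology \<Rightarrow> bool" where
  "abs_extensor L X \<longleftrightarrow>
     (\<forall>A g. closedin X A \<and> continuous_map (subtopology X A) L g \<longrightarrow>
        (\<exists>h. continuous_map X L h \<and> (\<forall>x\<in>A. h x = g x)))"

abbreviation edim_le :: "'b topology \<Rightarrow> 'a topology \<Rightarrow> bool" where
  "edim_le X L \<equiv> abs_extensor L X"

section \<open>Paracompactness and covering dimension\<close>

definition refines :: "'a set set \<Rightarrow> 'a set set \<Rightarrow> bool" where
  "refines \<V> \<U> \<longleftrightarrow> (\<forall>V\<in>\<V>. \<exists>U\<in>\<U>. V \<subseteq> U)"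

definition open_cover :: "'a topology \<Rightarrow> 'a set set \<Rightarrow> bool" where
  "open_cover X \<U> \<longleftrightarrow> (\<forall>U\<in>\<U>. openin X U) \<and> \<Union>\<U> = topspace X"

definition paracompact_space :: "'a topology \<Rightarrow> bool" where
  "paracompact_space X \<longleftrightarrow> Hausdorff_space X \<and>
     (\<forall>\<U>. open_cover X \<U> \<longrightarrow>
        (\<exists>\<V>. open_cover X \<V> \<and> refines \<V> \<U> \<and> locally_finite_in X \<V>))"

text \<open>Lebesgue's definition: no point lies in more than \<open>m + 1\<close> members of the refinement.  On
  normal spaces it agrees with the definition by functionally open covers that is customary for
  arbitrary completely regular spaces.\<close>

definition covering_dim_le :: "'a topology \<Rightarrow> nat \<Rightarrow> bool" where
  "covering_dim_le X m \<longleftrightarrow>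
     (\<forall>\<U>. finite \<U> \<and> open_cover X \<U> \<longrightarrow>
        (\<exists>\<V>. finite \<V> \<and> open_cover X \<V> \<and> refines \<V> \<U> \<and>
             (\<forall>x\<in>topspace X. card {V\<in>\<V>. x \<in> V} \<le> m + 1)))"

section \<open>The cube\<close>

definition cube :: "nat \<Rightarrow> (nat \<Rightarrow> real) topology" where
  "cube m = product_topology (\<lambda>_. top_of_set {0..1}) {..<m}"

section \<open>CW-complexes\<close>

definition ndisk :: "nat \<Rightarrow> (nat \<Rightarrow> real) topology" where
  "ndisk n = subtopology (Euclidean_space n) {x. (\<Sum>i<n. (x i)\<^sup>2) \<le> 1}"

definition ndisk_interior :: "nat \<Rightarrow> (nat \<Rightarrow> real) set" where
  "ndisk_interior n = {x \<in> topspace (ndisk n). (\<Sum>i<n. (x i)\<^sup>2) < 1}"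

definition ndisk_boundary :: "nat \<Rightarrow> (nat \<Rightarrow> real) set" where
  "ndisk_boundary n = {x \<in> topspace (ndisk n). (\<Sum>i<n. (x i)\<^sup>2) = 1}"

text \<open>A cell is a pair of its dimension and its characteristic map.\<close>

type_synonym 'a cell = "nat \<times> ((nat \<Rightarrow> real) \<Rightarrow> 'a)"

definition open_cell :: "'a cell \<Rightarrow> 'a set" where
  "open_cell c = snd c ` ndisk_interior (fst c)"

definition closed_cell :: "'a cell \<Rightarrow> 'a set" where
  "closed_cell c = snd c ` topspace (ndisk (fst c))"

definition CW_structure :: "'a topology \<Rightarrow> 'a cell set \<Rightarrow> bool" where
  "CW_structure K E \<longleftrightarrow>
     Hausdorff_space K \<and>
     (\<forall>(n,\<phi>)\<in>E. continuous_map (ndisk n) K \<phi> \<and>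
                 embedding_map (subtopology (ndisk n) (ndisk_interior n)) K \<phi>) \<and>
     pairwise (\<lambda>c d. disjnt (open_cell c) (open_cell d)) E \<and>
     (\<Union>c\<in>E. open_cell c) = topspace K \<and>
     (\<forall>(n,\<phi>)\<in>E. \<exists>F\<subseteq>E. finite F \<and> (\<forall>d\<in>F. fst d < n) \<and>
                 \<phi> ` ndisk_boundary n \<subseteq> (\<Union>d\<in>F. open_cell d)) \<and>
     (\<forall>S\<subseteq>topspace K. closedin K S \<longleftrightarrow> (\<forall>c\<in>E. closedin K (S \<inter> closed_cell c)))"

definition CW_complex :: "'a topology \<Rightarrow> bool" where
  "CW_complex K \<longleftrightarrow> (\<exists>E. CW_structure K E)"

section \<open>cw-spaces\<close>

text \<open>A formula cannot quantify over all types, so the contractible CW-complexes that are tested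
  are those carried by a type \<open>'c\<close>.  As soon as \<open>'c\<close> has at least \<open>max |Z| 2^\<aleph>\<^sub>0\<close> elements this
  is no restriction.  Indeed, let \<open>g : A \<rightarrow> C\<close> be a map from a closed subset of \<open>Z\<close> to a contractible
  CW-complex.  Its image lies in a subcomplex with at most \<open>max |Z| \<aleph>\<^sub>0\<close> cells.  A contraction of \<open>C\<close>
  carries (closed cell) \<open>\<times> [0,1]\<close> into a finite subcomplex, so closing up under the contraction
  gives a contractible subcomplex with at most \<open>max |Z| \<aleph>\<^sub>0\<close> cells that contains the image of \<open>g\<close>;
  it has a copy on \<open>'c\<close>, and an extension of \<open>g\<close> into it is an extension into \<open>C\<close>.

  The empty complex must be excluded explicitly, since \<^const>\<open>contractible_space\<close> holds of the
  empty space.\<close>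

definition cw_space :: "'c itself \<Rightarrow> 'a topology \<Rightarrow> bool" where
  "cw_space (_ :: 'c itself) Z \<longleftrightarrow> k_space Z \<and>
     (\<forall>C :: 'c topology.
        CW_complex C \<and> topspace C \<noteq> {} \<and> contractible_space C \<longrightarrow> abs_extensor C Z)"

section \<open>Iterated suspension\<close>

definition quotient_topology :: "'a topology \<Rightarrow> ('a \<Rightarrow> 'b) \<Rightarrow> 'b topology" where
  "quotient_topology X q =
     topology (\<lambda>U. U \<subseteq> q ` topspace X \<and> openin X {x \<in> topspace X. q x \<in> U})"

lemma openin_quotient_topology:
  "openin (quotient_topology X q) U \<longleftrightarrow>
     U \<subseteq> q ` topspace X \<and> openin X {x \<in> topspace X. q x \<in> U}"
proof -
  have "istopology (\<lambda>U. U \<subseteq> q ` topspace X \<and> openin X {x \<in> topspace X. q x \<in> U})"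
    unfolding istopology_def
  proof (intro conjI allI impI)
    fix S T
    assume "S \<subseteq> q ` topspace X \<and> openin X {x \<in> topspace X. q x \<in> S}"
      and "T \<subseteq> q ` topspace X \<and> openin X {x \<in> topspace X. q x \<in> T}"
    moreover have "{x \<in> topspace X. q x \<in> S \<inter> T} =
        {x \<in> topspace X. q x \<in> S} \<inter> {x \<in> topspace X. q x \<in> T}" by blast
    ultimately show "S \<inter> T \<subseteq> q ` topspace X" "openin X {x \<in> topspace X. q x \<in> S \<inter> T}"
      by auto
  next
    fix \<K>
    assume *: "\<forall>S\<in>\<K>. S \<subseteq> q ` topspace X \<and> openin X {x \<in> topspace X. q x \<in> S}"
    have "{x \<in> topspace X. q x \<in> \<Union>\<K>} = (\<Union>S\<in>\<K>. {x \<in> topspace X. q x \<in> S})" by blast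
    with * show "\<Union>\<K> \<subseteq> q ` topspace X" "openin X {x \<in> topspace X. q x \<in> \<Union>\<K>}"
      by auto
  qed
  then show ?thesis
    by (simp add: quotient_topology_def)
qed

lemma topspace_quotient_topology [simp]: "topspace (quotient_topology X q) = q ` topspace X"
proof
  show "topspace (quotient_topology X q) \<subseteq> q ` topspace X"
    using openin_topspace[of "quotient_topology X q"]
    by (simp add: openin_quotient_topology del: openin_topspace)
  have "{x \<in> topspace X. q x \<in> q ` topspace X} = topspace X" by blast
  then have "openin (quotient_topology X q) (q ` topspace X)"
    by (simp add: openin_quotient_topology)
  then show "q ` topspace X \<subseteq> topspace (quotient_topology X q)"
    by (rule openin_subset)
qed

lemma quotient_map_quotient_topology: "quotient_map X (quotient_topology X q) q"
  by (simp add: quotient_map_def openin_quotient_topology)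

text \<open>The points of all iterated suspensions of spaces carried by \<open>'a\<close>, in one type, so that the
  number of suspensions can be a variable: \<open>Mid p t\<close> is the point at height \<open>t\<close>, \<open>0 < t < 1\<close>, over
  the point \<open>p\<close> of the previous suspension.\<close>

datatype 'a susp_point = Base 'a | South | North | Mid "'a susp_point" real

definition susp_proj :: "'a susp_point \<times> real \<Rightarrow> 'a susp_point" where
  "susp_proj = (\<lambda>(p, t). if t = 0 then South else if t = 1 then North else Mid p t)"

text \<open>The unreduced suspension: \<open>K \<times> [0,1]\<close> with \<open>K \<times> {0}\<close> and \<open>K \<times> {1}\<close> each collapsed to a point.\<close>

definition suspension :: "'a susp_point topology \<Rightarrow> 'a susp_point topology" where
  "suspension K = quotient_topology (prod_topology K (top_of_set {0..1})) susp_proj"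

fun iterated_suspension :: "nat \<Rightarrow> 'a topology \<Rightarrow> 'a susp_point topology" where
  "iterated_suspension 0 K = quotient_topology K Base"
| "iterated_suspension (Suc m) K = suspension (iterated_suspension m K)"

lemma homeomorphic_map_iterated_suspension_0:
  "homeomorphic_map K (iterated_suspension 0 K) Base"
  unfolding homeomorphic_map_def iterated_suspension.simps
  by (intro conjI quotient_map_quotient_topology inj_onI) (erule susp_point.inject(1)[THEN iffD1])

end

theory Submission
  imports Defs
begin

text \<open>Cones over \<open>K\<close> and over its iterated suspensions are absolute
  extensors of \<open>X\<close>, because the cone over \<open>K\<close> is a contractible CW-complex and the cone over a
  suspension is a retract of (cone) \<open>\<times> [0,1]\<close>; so \<open>K\<close> and its suspensions are absolute
  neighbourhood extensors of \<open>X\<close>. Extending a partial map \<open>X \<rightarrow> \<Sigma>\<^sup>mK\<close> then amounts to the following: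
  given functions \<open>u 0, \<dots>, u (m-1)\<close> on \<open>X\<close> (the suspension heights) and a partial map to \<open>K\<close>, find
  functions \<open>w i\<close> with values in \<open>[1/3,2/3]\<close> such that the partial map extends over the set where
  \<open>u i = w i\<close> for all \<open>i\<close>.

  Every point of \<open>Y\<close> has a neighbourhood over which the partial map extends. Such local extensions
  are chosen in \<open>m + 1\<close> stages, each stage with a locally finite cover of \<open>Y\<close>; a map of a later stage
  depends on the choice of members of the earlier covers, agrees with the corresponding earlier map
  where \<open>u i \<ge> 2/3\<close>, and ignores the member of stage \<open>i\<close> where \<open>u i \<le> 1/3\<close>. Since
  \<open>dim Y \<le> m\<close>, all these covers have a common refinement that is a union of \<open>m + 1\<close> discrete families
  (colours), the \<open>i\<close>-th of which is to use the maps of stage \<open>i\<close>. Taking for \<open>w i\<close> functions of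
  \<open>f x\<close> that interpolate between \<open>2/3\<close> on a shrinking of the \<open>i\<close>-th colour and \<open>1/3\<close> off that colour makes all these maps fit together.\<close>

section \<open>Closed shrinkings and coloured refinements\<close>

text \<open>Two extensions into \<open>K\<close> over overlapping sets need not agree, so they
  cannot be glued over \<open>Y\<close> directly; the \<open>m\<close> suspension coordinates allow
  them to be compared only where all \<open>u i = w i\<close>. The colours that define
  \<open>w\<close> must refine the covers on which the maps live and are known only after all maps;
  hence a map of a later stage is prepared for every possible choice of earlier members. Colours
  \<open>j < l \<le> m\<close> are compared through \<open>w j\<close>, so the last colour needs no
  level and \<open>m\<close> levels serve \<open>m + 1\<close> colours. The bounds 1/3 and 2/3 lie
  strictly between the poles, so the \<open>K\<close>-coordinate exists at every level, and they
  differ, so the two matching conditions of one stage hold on disjoint sets. On the side of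
  \<open>Y\<close>, a closed image of \<open>X\<close>, paracompactness enters as the shrinking
  property below, in the form due to Michael that uses closure-preserving closed covers: a closed
  map carries these forward, which fails in general for locally finite open covers.\<close>

definition closed_shrinkable :: "'a topology \<Rightarrow> bool" where
  "closed_shrinkable X \<longleftrightarrow>
     (\<forall>\<U>. open_cover X \<U> \<longrightarrow>
        (\<exists>C. (\<forall>U\<in>\<U>. C U \<subseteq> U) \<and> (\<forall>\<W>\<subseteq>\<U>. closedin X (\<Union>(C ` \<W>))) \<and> \<Union>(C ` \<U>) = topspace X))"

text \<open>An indexed cover may list a set several times. One index per set, chosen by
  \<open>r\<close>, receives the closed set assigned to it; the others receive the empty
  set.\<close>

lemma closed_shrinkable_indexed:
  assumes "closed_shrinkable X"
    and U: "\<And>i. i \<in> I \<Longrightarrow> openin X (U i)" and cov: "\<Union>(U ` I) = topspace X"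
  obtains C where "\<And>i. i \<in> I \<Longrightarrow> C i \<subseteq> U i"
    and "\<And>J. J \<subseteq> I \<Longrightarrow> closedin X (\<Union>(C ` J))" and "\<Union>(C ` I) = topspace X"
proof -
  have "open_cover X (U ` I)"
    using U cov by (auto simp: open_cover_def)
  with assms(1) have "\<exists>C. (\<forall>u\<in>U ` I. C u \<subseteq> u) \<and> (\<forall>\<W>\<subseteq>U ` I. closedin X (\<Union>(C ` \<W>))) \<and>
      \<Union>(C ` (U ` I)) = topspace X"
    unfolding closed_shrinkable_def by (elim allE[of _ "U ` I"] impE)
  then obtain C where C: "\<forall>u\<in>U ` I. C u \<subseteq> u" "\<forall>\<W>\<subseteq>U ` I. closedin X (\<Union>(C ` \<W>))"
      "\<Union>(C ` (U ` I)) = topspace X"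
    by (elim exE conjE)
  define r where "r u = (SOME i. i \<in> I \<and> U i = u)" for u
  have r: "r (U i) \<in> I \<and> U (r (U i)) = U i" if "i \<in> I" for i
    unfolding r_def by (rule someI[of _ i]) (use that in auto)
  define D where "D i = (if r (U i) = i then C (U i) else {})" for i
  show thesis
  proof
    show "D i \<subseteq> U i" if "i \<in> I" for i
      using C(1) that by (auto simp: D_def)
    show "closedin X (\<Union>(D ` J))" if "J \<subseteq> I" for J
    proof -
      have "\<Union>(D ` J) = \<Union>(C ` (U ` {i\<in>J. r (U i) = i}))"
        by (auto simp: D_def split: if_splits)
      moreover have "U ` {i\<in>J. r (U i) = i} \<subseteq> U ` I"
        using that by auto
      ultimately show ?thesis
        using C(2) by metis
    qed
    show "\<Union>(D ` I) = topspace X"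
    proof -
      have "\<exists>j\<in>I. x \<in> D j" if "i \<in> I" "x \<in> C (U i)" for i x
        using r[OF that(1)] that(2) by (intro bexI[of _ "r (U i)"]) (auto simp: D_def)
      moreover have "D i \<subseteq> C (U i)" for i
        by (auto simp: D_def)
      ultimately have "\<Union>(D ` I) = \<Union>(C ` (U ` I))"
        by blast
      then show ?thesis using C(3) by simp
    qed
  qed
qed

text \<open>For a locally finite family every union of closures of members is closed. Regularity
  supplies a cover by sets whose closures fit inside members of \<open>\<U>\<close>; the closures of
  a locally finite refinement are grouped by the member \<open>u V\<close> containing them.\<close>

lemma regular_paracompact_imp_closed_shrinkable:
  assumes "paracompact_space X" "regular_space X"
  shows "closed_shrinkable X"
  unfolding closed_shrinkable_def
proof (intro allI impI)
  fix \<U> assume \<U>: "open_cover X \<U>"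
  define \<U>' where "\<U>' = {V. openin X V \<and> (\<exists>U\<in>\<U>. X closure_of V \<subseteq> U)}"
  have "open_cover X \<U>'"
    unfolding open_cover_def
  proof (intro conjI equalityI subsetI)
    fix x assume x: "x \<in> topspace X"
    then obtain U where U: "U \<in> \<U>" "x \<in> U" "openin X U"
      using \<U> by (auto simp: open_cover_def)
    then obtain V C where "openin X V" "closedin X C" "x \<in> V" "V \<subseteq> C" "C \<subseteq> U"
      using assms(2) unfolding neighbourhood_base_of_closedin[symmetric] neighbourhood_base_of by meson
    then show "x \<in> \<Union>\<U>'"
      using U closure_of_minimal[of V C X] unfolding \<U>'_def by blast
  qed (use openin_subset in \<open>auto simp: \<U>'_def\<close>)
  then obtain \<V> where \<V>: "open_cover X \<V>" "refines \<V> \<U>'" "locally_finite_in X \<V>"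
    using assms(1)[unfolded paracompact_space_def] by blast
  have "\<exists>U\<in>\<U>. X closure_of V \<subseteq> U" if V: "V \<in> \<V>" for V
  proof -
    obtain W where "W \<in> \<U>'" "V \<subseteq> W"
      using \<V>(2) V unfolding refines_def by blast
    then show ?thesis
      using closure_of_mono[of V W X] unfolding \<U>'_def by blast
  qed
  then obtain u where u: "\<And>V. V \<in> \<V> \<Longrightarrow> u V \<in> \<U> \<and> X closure_of V \<subseteq> u V"
    by metis
  define C where "C U = \<Union>((closure_of) X ` {V\<in>\<V>. u V = U})" for U
  show "\<exists>C. (\<forall>U\<in>\<U>. C U \<subseteq> U) \<and> (\<forall>\<W>\<subseteq>\<U>. closedin X (\<Union>(C ` \<W>))) \<and> \<Union>(C ` \<U>) = topspace X"
  proof (intro exI[of _ C] conjI ballI allI impI)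
    show "C U \<subseteq> U" if "U \<in> \<U>" for U
      using u by (auto simp: C_def)
    show "closedin X (\<Union>(C ` \<W>))" if "\<W> \<subseteq> \<U>" for \<W>
    proof -
      have "\<Union>(C ` \<W>) = \<Union>((closure_of) X ` {V\<in>\<V>. u V \<in> \<W>})"
        by (auto simp: C_def)
      moreover have "locally_finite_in X {V\<in>\<V>. u V \<in> \<W>}"
        by (rule locally_finite_in_subset[OF \<V>(3)]) auto
      ultimately show ?thesis
        using closedin_Union_locally_finite_closure by metis
    qed
    show "\<Union>(C ` \<U>) = topspace X"
    proof
      show "\<Union>(C ` \<U>) \<subseteq> topspace X"
        using closure_of_subset_topspace by (force simp: C_def)
      show "topspace X \<subseteq> \<Union>(C ` \<U>)"
      proof
        fix x assume "x \<in> topspace X"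
        then obtain V where V: "V \<in> \<V>" "x \<in> V" "openin X V"
          using \<V>(1) by (auto simp: open_cover_def)
        then have "x \<in> X closure_of V"
          using closure_of_subset[of V X] openin_subset by blast
        then show "x \<in> \<Union>(C ` \<U>)"
          using u[OF V(1)] V(1) by (auto simp: C_def)
      qed
    qed
  qed
qed

text \<open>Images commute with unions, so a closed map sends a shrinking of the pulled back cover
  to a shrinking of the original one.\<close>

lemma closed_shrinkable_closed_map_image:
  assumes "closed_shrinkable X" "continuous_map X Y f" "closed_map X Y f" "f ` topspace X = topspace Y"
  shows "closed_shrinkable Y"
  unfolding closed_shrinkable_def
proof (intro allI impI)
  fix \<U> assume \<U>: "open_cover Y \<U>"
  have 1: "openin X {x \<in> topspace X. f x \<in> U}" if "U \<in> \<U>" for U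
    using \<U> that assms(2) by (auto simp: open_cover_def intro: openin_continuous_map_preimage)
  have 2: "(\<Union>U\<in>\<U>. {x \<in> topspace X. f x \<in> U}) = topspace X"
    using \<U> assms(4)[symmetric] by (fastforce simp: open_cover_def)
  obtain C where C: "\<And>U. U \<in> \<U> \<Longrightarrow> C U \<subseteq> {x \<in> topspace X. f x \<in> U}"
     "\<And>J. J \<subseteq> \<U> \<Longrightarrow> closedin X (\<Union>(C ` J))" "\<Union>(C ` \<U>) = topspace X"
    by (rule closed_shrinkable_indexed[OF assms(1) 1 2]) auto
  show "\<exists>C. (\<forall>U\<in>\<U>. C U \<subseteq> U) \<and> (\<forall>\<W>\<subseteq>\<U>. closedin Y (\<Union>(C ` \<W>))) \<and> \<Union>(C ` \<U>) = topspace Y"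
  proof (intro exI[of _ "\<lambda>U. f ` C U"] conjI ballI allI impI)
    show "closedin Y (\<Union>((\<lambda>U. f ` C U) ` \<W>))" if "\<W> \<subseteq> \<U>" for \<W>
      using assms(3) C(2)[OF that] unfolding closed_map_def by (metis image_UN)
    show "\<Union>((\<lambda>U. f ` C U) ` \<U>) = topspace Y"
      using C(3) assms(4) by (metis image_UN)
  qed (use C(1) in blast)
qed

lemma closed_shrinkable_imp_normal:
  assumes "closed_shrinkable X"
  shows "normal_space X"
  unfolding normal_space_def
proof (intro allI impI, elim conjE)
  fix S T assume ST: "closedin X S" "closedin X T" "disjnt S T"
  let ?U = "\<lambda>b. topspace X - (if b then S else T)"
  have 1: "openin X (?U b)" for b
    using ST by (cases b) auto
  have 2: "\<Union>(?U ` UNIV) = topspace X"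
    using ST by (auto simp: disjnt_def UNIV_bool)
  obtain C where C: "\<And>b. b \<in> UNIV \<Longrightarrow> C b \<subseteq> ?U b"
     "\<And>J. J \<subseteq> UNIV \<Longrightarrow> closedin X (\<Union>(C ` J))" "\<Union>(C ` UNIV) = topspace X"
    by (rule closed_shrinkable_indexed[OF assms 1 2]) auto
  have cl: "closedin X (C b)" for b
    using C(2)[of "{b}"] by simp
  show "\<exists>U V. openin X U \<and> openin X V \<and> S \<subseteq> U \<and> T \<subseteq> V \<and> disjnt U V"
  proof (intro exI conjI)
    show "openin X (topspace X - C True)" "openin X (topspace X - C False)"
      using cl by auto
    show "S \<subseteq> topspace X - C True" "T \<subseteq> topspace X - C False"
      using C(1)[of True] C(1)[of False] ST(1,2)[THEN closedin_subset] by auto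
    show "disjnt (topspace X - C True) (topspace X - C False)"
      using C(3) by (auto simp: disjnt_iff UNIV_bool)
  qed
qed

text \<open>Michael's construction: \<open>C (n+1)\<close> shrinks the cover obtained from \<open>U\<close> by removing from
  each member what the earlier members have already caught at stage \<open>n\<close>; the point \<open>y\<close> lies in
  \<open>V k a\<close> if \<open>a\<close> is the least index over all stages with \<open>y \<in> C n a\<close> and \<open>k\<close> the stage after it
  is attained.\<close>

lemma closed_shrinkable_sigma_disjoint:
  fixes U :: "'i \<Rightarrow> 'a set"
  assumes "closed_shrinkable X"
    and U: "\<And>i. i \<in> I \<Longrightarrow> openin X (U i)" and cov: "\<Union>(U ` I) = topspace X"
  obtains C V :: "nat \<Rightarrow> 'i \<Rightarrow> 'a set"
  where "\<And>n i. i \<in> I \<Longrightarrow> closedin X (C n i)" "\<And>n i. i \<in> I \<Longrightarrow> C n i \<subseteq> U i"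
    "\<And>n i. i \<in> I \<Longrightarrow> openin X (V n i)" "\<And>n i. i \<in> I \<Longrightarrow> V n i \<subseteq> C n i"
    "\<And>n i j. i \<in> I \<Longrightarrow> j \<in> I \<Longrightarrow> i \<noteq> j \<Longrightarrow> disjnt (V n i) (V n j)"
    "(\<Union>n. \<Union>(V n ` I)) = topspace X"
proof -
  obtain r where wo: "well_order_on I r"
    using well_order_on by blast
  then have lin: "linear_order_on I r" and wf: "wf (r - Id)"
    by (auto simp: well_order_on_def)
  let ?lt = "\<lambda>j i. (j,i) \<in> r - Id"
  define P where "P D \<longleftrightarrow> (\<forall>i\<in>I. D i \<subseteq> U i) \<and> (\<forall>J\<subseteq>I. closedin X (\<Union>(D ` J))) \<and> \<Union>(D ` I) = topspace X"
    for D
  have base: "\<exists>D. P D"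
    using closed_shrinkable_indexed[OF assms(1) U cov] unfolding P_def by metis
  have step: "\<exists>D'. P D' \<and> (\<forall>i\<in>I. D' i \<inter> (\<Union>(D ` {j\<in>I. ?lt j i})) = {})" if D: "P D" for D
  proof -
    let ?U = "\<lambda>i. U i - (\<Union>(D ` {j\<in>I. ?lt j i}))"
    have 1: "openin X (?U i)" if "i \<in> I" for i
      using U[OF that] D unfolding P_def by (intro openin_diff) auto
    have 2: "\<Union>(?U ` I) = topspace X"
    proof
      show "\<Union>(?U ` I) \<subseteq> topspace X" using cov by auto
      show "topspace X \<subseteq> \<Union>(?U ` I)"
      proof
        fix x assume "x \<in> topspace X"
        \<comment> \<open>The least index whose \<open>U i\<close> contains \<open>x\<close>
          survives: an earlier \<open>D j\<close> lies in \<open>U j\<close>, which misses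
          \<open>x\<close>.\<close>
        then obtain i0 where "i0 \<in> {i. i \<in> I \<and> x \<in> U i}" using cov by blast
        then obtain i where i: "i \<in> {i. i \<in> I \<and> x \<in> U i}" "\<And>j. ?lt j i \<Longrightarrow> j \<notin> {i. i \<in> I \<and> x \<in> U i}"
          by (rule wfE_min[OF wf]) (rule that)
        have "x \<notin> D j" if "j \<in> I" "?lt j i" for j
          using D i(2)[OF that(2)] that(1) unfolding P_def by auto
        then have "x \<in> ?U i"
          using i(1) by blast
        then show "x \<in> \<Union>(?U ` I)" using i by blast
      qed
    qed
    obtain D' where "\<And>i. i \<in> I \<Longrightarrow> D' i \<subseteq> ?U i"
      "\<And>J. J \<subseteq> I \<Longrightarrow> closedin X (\<Union>(D' ` J))" "\<Union>(D' ` I) = topspace X"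
      by (rule closed_shrinkable_indexed[OF assms(1) 1 2]) auto
    then have "P D'" "\<forall>i\<in>I. D' i \<inter> (\<Union>(D ` {j\<in>I. ?lt j i})) = {}"
      unfolding P_def by (meson Diff_subset subset_trans, blast)
    then show ?thesis by blast
  qed
  define Q where "Q D D' \<longleftrightarrow> (\<forall>i\<in>I. D' i \<inter> (\<Union>(D ` {j\<in>I. ?lt j i})) = {})" for D D' :: "'i \<Rightarrow> 'a set"
  have "\<exists>C. \<forall>n. P (C n) \<and> Q (C n) (C (Suc n))"
    using dependent_nat_choice[of "\<lambda>_. P" "\<lambda>_. Q"] base step unfolding Q_def[symmetric] by blast
  then obtain C where C: "P (C n)" "Q (C n) (C (Suc n))" for n
    by blast
  \<comment> \<open>A point of \<open>V n i\<close> is caught at stage \<open>n\<close> by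
    \<open>i\<close> alone, which makes these sets disjoint; they are open because the union of the
    remaining members is closed.\<close>
  define V where "V n i = topspace X - \<Union>(C n ` (I - {i}))" for n i
  have cl: "closedin X (\<Union>(C n ` J))" if "J \<subseteq> I" for n J
    using C(1)[of n] that unfolding P_def by blast
  have cv: "\<Union>(C n ` I) = topspace X" for n
    using C(1)[of n] unfolding P_def by blast
  show thesis
  proof
    show "closedin X (C n i)" if "i \<in> I" for n i
      using cl[of "{i}" n] that by simp
    show "C n i \<subseteq> U i" if "i \<in> I" for n i
      using C(1)[of n] that unfolding P_def by blast
    show "openin X (V n i)" if "i \<in> I" for n i
      unfolding V_def by (intro openin_diff cl) auto
    show "V n i \<subseteq> C n i" if "i \<in> I" for n i
      using cv[of n] that by (auto simp: V_def)
    show "disjnt (V n i) (V n j)" if "i \<in> I" "j \<in> I" "i \<noteq> j" for n i j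
      using cv[of n] that by (auto simp: V_def disjnt_iff)
    show "(\<Union>n. \<Union>(V n ` I)) = topspace X"
    proof
      show "(\<Union>n. \<Union>(V n ` I)) \<subseteq> topspace X" by (auto simp: V_def)
      show "topspace X \<subseteq> (\<Union>n. \<Union>(V n ` I))"
      proof
        fix x assume x: "x \<in> topspace X"
        let ?Q = "{i\<in>I. \<exists>n. x \<in> C n i}"
        obtain i0 where "i0 \<in> ?Q" using x cv[of 0] by blast
        then obtain i where i: "i \<in> ?Q" "\<And>j. ?lt j i \<Longrightarrow> j \<notin> ?Q"
          by (rule wfE_min[OF wf]) (rule that)
        then obtain k where k: "i \<in> I" "x \<in> C k i" by auto
        \<comment> \<open>Indices before \<open>i\<close> catch \<open>x\<close> at no stage, by
          minimality; those after \<open>i\<close> were made at stage \<open>k + 1\<close> to avoid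
          \<open>C k i\<close>.\<close>
        have "x \<notin> C (Suc k) j" if j: "j \<in> I" "j \<noteq> i" for j
        proof (cases "?lt j i")
          case True
          then show ?thesis using i(2)[OF True] j(1) by auto
        next
          case False
          then have "?lt i j"
            using lin j k unfolding linear_order_on_def total_on_def by blast
          then show ?thesis using C(2)[of k] j(1) k unfolding Q_def by blast
        qed
        then have "x \<in> V (Suc k) i" using x by (auto simp: V_def)
        then show "x \<in> (\<Union>n. \<Union>(V n ` I))" using k by blast
      qed
    qed
  qed
qed

text \<open>With countably many indices, the closed sets \<open>C k i\<close> with
  \<open>k, i \<le> N\<close> have a closed finite union, whose interior contains the open sets
  \<open>V k i\<close> of the same range; these exhaust the space. The sets \<open>B\<close> later
  make a countable cover locally finite and cut the space into slabs.\<close>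

lemma countable_cover_exhaustion:
  fixes D :: "nat \<Rightarrow> 'a set"
  assumes "closed_shrinkable X" and D: "\<And>n. openin X (D n)" and cov: "(\<Union>n. D n) = topspace X"
  obtains B where "\<And>n. closedin X (B n)" "mono B" "\<And>n. B n \<subseteq> (\<Union>i\<le>n. D i)"
    "(\<Union>n. X interior_of B n) = topspace X"
proof -
  let ?U = "\<lambda>n. \<Union>i\<le>n. D i"
  have 1: "openin X (?U n)" for n using D by auto
  have 2: "\<Union>(range ?U) = topspace X" using cov by auto
  obtain C V :: "nat \<Rightarrow> nat \<Rightarrow> 'a set" where C: "\<And>n i. closedin X (C n i)" "\<And>n i. C n i \<subseteq> ?U i"
    and V: "\<And>n i. openin X (V n i)" "\<And>n i. V n i \<subseteq> C n i" "(\<Union>n. \<Union>(range (V n))) = topspace X"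
    by (rule closed_shrinkable_sigma_disjoint[OF assms(1) 1 2]) auto
  define B where "B N = (\<Union>k\<le>N. \<Union>i\<le>N. C k i)" for N
  show thesis
  proof
    show "closedin X (B n)" for n
      unfolding B_def by (intro closedin_Union finite_imageI) (auto intro!: closedin_Union C)
    show "mono B" by (intro monoI) (fastforce simp: B_def)
    show "B n \<subseteq> ?U n" for n
    proof
      fix y assume "y \<in> B n"
      then obtain k i where ki: "i \<le> n" "y \<in> C k i" by (auto simp: B_def)
      then have "y \<in> ?U i" using C(2) by blast
      then show "y \<in> ?U n" using ki by force
    qed
    show "(\<Union>n. X interior_of B n) = topspace X"
    proof
      show "(\<Union>n. X interior_of B n) \<subseteq> topspace X"
        using interior_of_subset_topspace by fastforce
      show "topspace X \<subseteq> (\<Union>n. X interior_of B n)"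
      proof
        fix y assume "y \<in> topspace X"
        then obtain k i where ki: "y \<in> V k i" using V(3) by blast
        have "V k i \<subseteq> B (max k i)" using V(2)[of k i] by (force simp: B_def)
        then have "V k i \<subseteq> X interior_of B (max k i)"
          by (rule interior_of_maximal) (rule V)
        then show "y \<in> (\<Union>n. X interior_of B n)" using ki by blast
      qed
    qed
  qed
qed

section \<open>Reducing the order of countable covers\<close>

lemma covering_dim_le_indexed:
  assumes "covering_dim_le X m" "finite I"
    and U: "\<And>i. i \<in> I \<Longrightarrow> openin X (U i)" and cov: "\<Union>(U ` I) = topspace X"
  obtains H where "\<And>i. i \<in> I \<Longrightarrow> openin X (H i)" "\<And>i. i \<in> I \<Longrightarrow> H i \<subseteq> U i"
    "\<Union>(H ` I) = topspace X" "\<And>x. x \<in> topspace X \<Longrightarrow> card {i\<in>I. x \<in> H i} \<le> m + 1"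
proof -
  have "finite (U ` I) \<and> open_cover X (U ` I)"
    using assms by (auto simp: open_cover_def)
  with assms(1) have "\<exists>\<V>. finite \<V> \<and> open_cover X \<V> \<and> refines \<V> (U ` I) \<and>
             (\<forall>x\<in>topspace X. card {V\<in>\<V>. x \<in> V} \<le> m + 1)"
    unfolding covering_dim_le_def by (elim allE[of _ "U ` I"] impE)
  then obtain \<V> where \<V>: "finite \<V>" "open_cover X \<V>" "refines \<V> (U ` I)"
             "\<And>x. x\<in>topspace X \<Longrightarrow> card {V\<in>\<V>. x \<in> V} \<le> m + 1" by blast
  have "\<forall>V\<in>\<V>. \<exists>i\<in>I. V \<subseteq> U i" using \<V>(3) unfolding refines_def by blast
  then obtain r where r: "\<And>V. V \<in> \<V> \<Longrightarrow> r V \<in> I \<and> V \<subseteq> U (r V)" by metis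
  define H where "H i = \<Union>{V\<in>\<V>. r V = i}" for i
  show thesis
  proof
    show "openin X (H i)" if "i \<in> I" for i
      unfolding H_def using \<V>(2) by (intro openin_Union) (auto simp: open_cover_def)
    show "H i \<subseteq> U i" if "i \<in> I" for i using r by (auto simp: H_def)
    have "\<Union>(H ` I) = \<Union>\<V>" using r by (auto simp: H_def)
    then show "\<Union>(H ` I) = topspace X" using \<V>(2) by (simp add: open_cover_def)
    show "card {i\<in>I. x \<in> H i} \<le> m + 1" if "x \<in> topspace X" for x
    proof -
      have "{i\<in>I. x \<in> H i} \<subseteq> r ` {V\<in>\<V>. x \<in> V}" by (auto simp: H_def)
      then have "card {i\<in>I. x \<in> H i} \<le> card (r ` {V\<in>\<V>. x \<in> V})"
        using \<V>(1) by (intro card_mono) auto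
      also have "\<dots> \<le> card {V\<in>\<V>. x \<in> V}" using \<V>(1) by (intro card_image_le) auto
      finally show ?thesis using \<V>(4)[OF that] by simp
    qed
  qed
qed

text \<open>Covering dimension speaks of finite covers. Since \<open>M\<close> meets only members
  with index at most \<open>N\<close>, these together with the complement of \<open>M\<close> form a
  finite cover of the whole space; its refinement is used on \<open>M\<close>, the old members off
  \<open>M\<close>.\<close>

lemma order_reduction_on_closed:
  fixes G :: "nat \<Rightarrow> 'a set"
  assumes "covering_dim_le X m" and M: "closedin X M" and "\<And>n. n > N \<Longrightarrow> M \<inter> G n = {}"
    and G: "\<And>n. openin X (G n)" and cov: "(\<Union>n. G n) = topspace X"
  obtains G' where "\<And>n. openin X (G' n)" "(\<Union>n. G' n) = topspace X" "\<And>n. G' n \<subseteq> G n"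
    "\<And>n. G' n - M = G n - M" "\<And>x. x \<in> M \<Longrightarrow> card {n. x \<in> G' n} \<le> m + 1"
proof -
  let ?U = "\<lambda>i. if i \<le> N then G i else topspace X - M"
  have 1: "openin X (?U i)" for i using G M by auto
  have 2: "\<Union>(?U ` {..Suc N}) = topspace X"
  proof
    show "\<Union>(?U ` {..Suc N}) \<subseteq> topspace X" using 1 openin_subset by blast
    show "topspace X \<subseteq> \<Union>(?U ` {..Suc N})"
    proof
      fix x assume x: "x \<in> topspace X"
      show "x \<in> \<Union>(?U ` {..Suc N})"
      proof (cases "x \<in> M")
        case True
        obtain n where "x \<in> G n" using x cov by blast
        moreover from this have "n \<le> N" using True assms(3)[of n] by (cases "N < n") auto
        ultimately show ?thesis by (intro UN_I[of n]) auto
      next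
        case False
        then show ?thesis using x by (intro UN_I[of "Suc N"]) auto
      qed
    qed
  qed
  obtain H where H: "\<And>i. i \<in> {..Suc N} \<Longrightarrow> openin X (H i)" "\<And>i. i \<in> {..Suc N} \<Longrightarrow> H i \<subseteq> ?U i"
    "\<Union>(H ` {..Suc N}) = topspace X" "\<And>x. x \<in> topspace X \<Longrightarrow> card {i\<in>{..Suc N}. x \<in> H i} \<le> m + 1"
    by (rule covering_dim_le_indexed[OF assms(1) _ 1 2]) auto
  define G' where "G' n = (if n \<le> N then H n \<union> (G n - M) else G n)" for n
  have HG: "H n \<subseteq> G n" if "n \<le> N" for n using H(2)[of n] that by auto
  have HM: "H (Suc N) \<inter> M = {}" using H(2)[of "Suc N"] by auto
  have MG: "n \<le> N" if "x \<in> M" "x \<in> G n" for x n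
    using assms(3)[of n] that by (cases "N < n") auto
  have Mn: "{n. x \<in> G' n} = {i\<in>{..Suc N}. x \<in> H i}" if "x \<in> M" for x
  proof (intro set_eqI iffI)
    fix n assume "n \<in> {n. x \<in> G' n}"
    then show "n \<in> {i\<in>{..Suc N}. x \<in> H i}"
      using that MG[OF that, of n] by (auto simp: G'_def split: if_splits)
  next
    fix n assume n: "n \<in> {i\<in>{..Suc N}. x \<in> H i}"
    then have "n \<noteq> Suc N" using HM that by auto
    then show "n \<in> {n. x \<in> G' n}" using n by (auto simp: G'_def)
  qed
  show thesis
  proof
    show "openin X (G' n)" for n
      using H(1)[of n] openin_diff[OF G M, of n] G by (auto simp: G'_def intro: openin_Un)
    show "G' n \<subseteq> G n" for n using HG by (auto simp: G'_def)
    show "G' n - M = G n - M" for n using HG by (auto simp: G'_def)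
    show "(\<Union>n. G' n) = topspace X"
    proof
      show "(\<Union>n. G' n) \<subseteq> topspace X" using \<open>\<And>n. G' n \<subseteq> G n\<close> cov by blast
      show "topspace X \<subseteq> (\<Union>n. G' n)"
      proof
        fix x assume x: "x \<in> topspace X"
        show "x \<in> (\<Union>n. G' n)"
        proof (cases "x \<in> M")
          case True
          then show ?thesis using Mn[OF True] H(3) x by blast
        next
          case False
          obtain n where "x \<in> G n" using cov x by blast
          with False have "x \<in> G' n - M" using \<open>\<And>n. G' n - M = G n - M\<close>[of n] by simp
          then show ?thesis by blast
        qed
      qed
    qed
    show "card {n. x \<in> G' n} \<le> m + 1" if "x \<in> M" for x
      using Mn[OF that] H(4)[of x] that closedin_subset[OF M] by auto
  qed
qed

text \<open>The order is reduced successively on the closed slabs \<open>B n - interior (B (n-1))\<close>; around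
  each point all but finitely many of these steps change nothing, so that the limit makes sense.\<close>

lemma order_reduction:
  fixes G B :: "nat \<Rightarrow> 'a set"
  assumes dim: "covering_dim_le X m"
    and B: "\<And>n. closedin X (B n)" "mono B" "(\<Union>n. X interior_of B n) = topspace X"
    and BG: "\<And>k n. k < n \<Longrightarrow> B k \<inter> G n = {}"
    and G: "\<And>n. openin X (G n)" and cov: "(\<Union>n. G n) = topspace X"
  obtains G' where "\<And>n. openin X (G' n)" "(\<Union>n. G' n) = topspace X" "\<And>n. G' n \<subseteq> G n"
    "\<And>x. x \<in> topspace X \<Longrightarrow> card {n. x \<in> G' n} \<le> m + 1"
proof -
  \<comment> \<open>Slab \<open>N\<close> misses the interior of \<open>B (N - 1)\<close>, so points
    of that interior are not touched from step \<open>N\<close> on. The slabs still cover: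
    \<open>x\<close> lies in slab \<open>r\<close> for the least \<open>r\<close> with
    \<open>x \<in> B r\<close>.\<close>
  define M where "M N = B N - (case N of 0 \<Rightarrow> {} | Suc k \<Rightarrow> X interior_of B k)" for N
  have M: "closedin X (M N)" for N
    unfolding M_def by (cases N) (auto intro!: closedin_diff B)
  define P where "P H \<longleftrightarrow> (\<forall>n. openin X (H n)) \<and> (\<Union>n. H n) = topspace X \<and> (\<forall>n. H n \<subseteq> G n)"
    for H :: "nat \<Rightarrow> 'a set"
  define Q where "Q N H H' \<longleftrightarrow> (\<forall>n. H' n \<subseteq> H n \<and> H' n - M N = H n - M N) \<and>
      (\<forall>x\<in>M N. card {n. x \<in> H' n} \<le> m + 1)" for N and H H' :: "nat \<Rightarrow> 'a set"
  have step: "\<exists>H'. P H' \<and> Q N H H'" if H: "P H" for H N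
  proof -
    have 1: "openin X (H n)" "H n \<subseteq> G n" for n using H by (auto simp: P_def)
    have 2: "(\<Union>n. H n) = topspace X" using H by (auto simp: P_def)
    have 3: "M N \<inter> H n = {}" if "n > N" for n
      using BG[OF that] 1(2)[of n] by (auto simp: M_def)
    obtain H' where "\<And>n. openin X (H' n)" "(\<Union>n. H' n) = topspace X" "\<And>n. H' n \<subseteq> H n"
      "\<And>n. H' n - M N = H n - M N" "\<And>x. x \<in> M N \<Longrightarrow> card {n. x \<in> H' n} \<le> m + 1"
      by (rule order_reduction_on_closed[where N=N, OF dim M[of N] 3 1(1) 2]) (assumption, rule that)
    then have "P H'" "Q N H H'" using 1(2) unfolding P_def Q_def by (blast, auto)
    then show ?thesis by blast
  qed
  have "P G" using G cov by (auto simp: P_def)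
  then have "\<exists>Gs. \<forall>N. P (Gs N) \<and> Q N (Gs N) (Gs (Suc N))"
    using dependent_nat_choice[of "\<lambda>_. P" Q] step by blast
  then obtain Gs where Gs: "P (Gs N)" "Q N (Gs N) (Gs (Suc N))" for N by blast
  \<comment> \<open>On the interior of \<open>B N\<close> the sequence is constant from
    \<open>Gs (Suc N)\<close> on; this value is the limit.\<close>
  define G' where "G' n = (\<Union>N. X interior_of B N \<inter> Gs (Suc N) n)" for n
  have dec: "Gs K n \<subseteq> Gs N n" if "N \<le> K" for N K n
    using that
  proof (induction K rule: dec_induct)
    case (step K)
    then show ?case using Gs(2)[of K] unfolding Q_def by blast
  qed simp
  have intmono: "X interior_of B N \<subseteq> X interior_of B K" if "N \<le> K" for N K
    using B(2) that by (intro interior_of_mono) (auto dest: monoD)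
  have stable: "x \<in> Gs K n \<longleftrightarrow> x \<in> Gs (Suc N) n" if "Suc N \<le> K" "x \<in> X interior_of B N" for x N K n
    using that(1)
  proof (induction K rule: dec_induct)
    case (step K)
    then obtain k where k: "K = Suc k" "N \<le> k" by (cases K) auto
    then have "x \<notin> M K" using intmono[of N k] that(2) by (auto simp: M_def)
    moreover have "Gs (Suc K) n - M K = Gs K n - M K" using Gs(2)[of K] by (auto simp: Q_def)
    ultimately show ?case using step by blast
  qed simp
  have G'_iff: "x \<in> G' n \<longleftrightarrow> x \<in> Gs (Suc N) n" if x: "x \<in> X interior_of B N" for x n N
  proof
    assume "x \<in> G' n"
    then obtain K where K: "x \<in> X interior_of B K" "x \<in> Gs (Suc K) n" by (auto simp: G'_def)
    then show "x \<in> Gs (Suc N) n"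
      using stable[of K "Suc (max K N)" x n] stable[of N "Suc (max K N)" x n] x by auto
  next
    assume "x \<in> Gs (Suc N) n"
    then show "x \<in> G' n" using x by (auto simp: G'_def)
  qed
  show thesis
  proof
    show "openin X (G' n)" for n
      unfolding G'_def using Gs(1) by (auto simp: P_def intro!: openin_Union openin_Int)
    show "G' n \<subseteq> G n" for n
      unfolding G'_def using Gs(1) by (auto simp: P_def)
    show "(\<Union>n. G' n) = topspace X"
    proof
      show "(\<Union>n. G' n) \<subseteq> topspace X" using \<open>\<And>n. G' n \<subseteq> G n\<close> cov by blast
      show "topspace X \<subseteq> (\<Union>n. G' n)"
      proof
        fix x assume x: "x \<in> topspace X"
        then obtain N where N: "x \<in> X interior_of B N" using B(3) by blast
        obtain n where "x \<in> Gs (Suc N) n" using x Gs(1)[of "Suc N"] unfolding P_def by blast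
        then show "x \<in> (\<Union>n. G' n)" using G'_iff[OF N] by blast
      qed
    qed
    show "card {n. x \<in> G' n} \<le> m + 1" if x: "x \<in> topspace X" for x
    proof -
      obtain N where N: "x \<in> X interior_of B N" using B(3) x by blast
      then have "x \<in> B N" using interior_of_subset[of X "B N"] by blast
      define r where "r = (LEAST r. x \<in> B r)"
      have r: "x \<in> B r" "r \<le> N" "\<And>k. k < r \<Longrightarrow> x \<notin> B k"
        unfolding r_def using \<open>x \<in> B N\<close> by (auto intro: LeastI Least_le dest: not_less_Least)
      have "x \<in> M r"
      proof (cases r)
        case (Suc k)
        then show ?thesis using r(1) r(3)[of k] interior_of_subset[of X "B k"] by (auto simp: M_def)
      qed (use r in \<open>auto simp: M_def\<close>)
      then have c: "card {n. x \<in> Gs (Suc r) n} \<le> m + 1" using Gs(2)[of r] by (auto simp: Q_def)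
      \<comment> \<open>An infinite set has cardinality 0 by convention, so the bound passes to a
        subset only once finiteness is known; members with \<open>n > r\<close> miss
        \<open>B r\<close>.\<close>
      have "{n. x \<in> Gs (Suc r) n} \<subseteq> {..r}"
      proof
        fix n assume "n \<in> {n. x \<in> Gs (Suc r) n}"
        then have "x \<in> G n" using Gs(1)[of "Suc r"] by (auto simp: P_def)
        then have "\<not> r < n" using BG[of r n] r(1) by blast
        then show "n \<in> {..r}" by simp
      qed
      then have "finite {n. x \<in> Gs (Suc r) n}" using finite_subset by blast
      moreover have "{n. x \<in> G' n} \<subseteq> {n. x \<in> Gs (Suc r) n}"
        using G'_iff[OF N] dec[of "Suc r" "Suc N"] r(2) by auto
      ultimately show ?thesis using c card_mono le_trans by blast
    qed
  qed
qed

section \<open>Colours from the order of a cover\<close>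

lemma openin_less_continuous_maps:
  assumes "continuous_map X euclideanreal f" "continuous_map X euclideanreal g"
  shows "openin X {x \<in> topspace X. f x < g x}"
proof -
  have "openin X {x \<in> topspace X. g x - f x \<in> {0<..}}"
    by (rule openin_continuous_map_preimage[where Y=euclideanreal]) (auto intro!: assms continuous_intros)
  then show ?thesis by simp
qed

text \<open>With functions \<open>\<phi> j\<close> subordinate to \<open>G\<close>, a point belongs to the set with index \<open>S\<close> if the
  values \<open>\<phi> j\<close> with \<open>j \<in> S\<close> are the largest ones.\<close>

lemma coloured_refinement:
  fixes G :: "nat \<Rightarrow> 'a set"
  assumes Y: "closed_shrinkable X"
    and G: "\<And>n. openin X (G n)" and cov: "(\<Union>n. G n) = topspace X"
    and lf: "\<And>x. x \<in> topspace X \<Longrightarrow> \<exists>T N. openin X T \<and> x \<in> T \<and> (\<forall>n>N. T \<inter> G n = {})"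
    and order: "\<And>x. x \<in> topspace X \<Longrightarrow> card {n. x \<in> G n} \<le> m + 1"
  obtains V where "\<And>S. finite S \<Longrightarrow> S \<noteq> {} \<Longrightarrow> openin X (V S)" "\<And>S j. j \<in> S \<Longrightarrow> V S \<subseteq> G j"
    "\<And>S S'. finite S \<Longrightarrow> finite S' \<Longrightarrow> card S = card S' \<Longrightarrow> S \<noteq> S' \<Longrightarrow> disjnt (V S) (V S')"
    "\<And>x. x \<in> topspace X \<Longrightarrow> \<exists>S. finite S \<and> S \<noteq> {} \<and> card S \<le> m + 1 \<and> x \<in> V S"
proof -
  obtain C where C: "\<And>i. C i \<subseteq> G i" "\<And>J. closedin X (\<Union>(C ` J))" "\<Union>(range C) = topspace X"
    using closed_shrinkable_indexed[of X UNIV G, OF Y G cov] by (metis subset_UNIV UNIV_I)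
  have "\<exists>f. continuous_map X euclideanreal f \<and> (\<forall>x\<in>topspace X. 0 \<le> f x) \<and> (\<forall>x\<in>C n. f x = 1) \<and>
     (\<forall>x\<in>topspace X - G n. f x = 0)" for n
  proof -
    have "closedin X (C n)" using C(2)[of "{n}"] by simp
    moreover have "closedin X (topspace X - G n)" using G by auto
    moreover have "disjnt (topspace X - G n) (C n)" using C(1)[of n] by (auto simp: disjnt_iff)
    ultimately obtain f where "continuous_map X (top_of_set {0..1::real}) f"
        "f ` (topspace X - G n) \<subseteq> {0}" "f ` C n \<subseteq> {1}"
      using Urysohn_lemma[of X "topspace X - G n" "C n" 0 1] closed_shrinkable_imp_normal[OF Y] by auto
    then show ?thesis
      by (intro exI[of _ f]) (auto simp: continuous_map_in_subtopology image_subset_iff Pi_iff)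
  qed
  then obtain \<phi> where \<phi>: "\<And>n. continuous_map X euclideanreal (\<phi> n)"
      "\<And>n x. x \<in> topspace X \<Longrightarrow> 0 \<le> \<phi> n x" "\<And>n x. x \<in> C n \<Longrightarrow> \<phi> n x = 1"
      "\<And>n x. x \<in> topspace X \<Longrightarrow> x \<notin> G n \<Longrightarrow> \<phi> n x = (0::real)"
    by (metis DiffI)
  define V where "V S = {x\<in>topspace X. \<forall>j\<in>S. 0 < \<phi> j x \<and> (\<forall>k. k \<notin> S \<longrightarrow> \<phi> k x < \<phi> j x)}" for S
  show thesis
  proof
    show "openin X (V S)" if S: "finite S" "S \<noteq> {}" for S
    proof (subst openin_subopen, intro ballI)
      fix x assume x: "x \<in> V S"
      then obtain T N where T: "openin X T" "x \<in> T" "\<And>n. n > N \<Longrightarrow> T \<inter> G n = {}"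
        using lf[of x] by (auto simp: V_def)
      \<comment> \<open>Near \<open>x\<close> only the \<open>\<phi> k\<close> with
        \<open>k \<le> N\<close> can be nonzero, so finitely many strict inequalities suffice.
        Inserting \<open>j\<close> keeps the index set of the inner intersection nonempty; the
        premise \<open>k \<noteq> j\<close> makes that entry harmless.\<close>
      define T' where "T' = T \<inter> (\<Inter>j\<in>S. {x\<in>topspace X. 0 < \<phi> j x}) \<inter>
         (\<Inter>j\<in>S. \<Inter>k\<in>insert j ({..N} - S). {x\<in>topspace X. k \<noteq> j \<longrightarrow> \<phi> k x < \<phi> j x})"
      have o: "openin X {x\<in>topspace X. k \<noteq> j \<longrightarrow> \<phi> k x < \<phi> j x}" for k j
        using openin_less_continuous_maps[OF \<phi>(1) \<phi>(1), of k j] by (cases "k = j") auto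
      have o': "openin X {x\<in>topspace X. 0 < \<phi> j x}" for j
        by (intro openin_less_continuous_maps \<phi>) auto
      have "openin X (\<Inter>k\<in>insert j ({..N} - S). {x\<in>topspace X. k \<noteq> j \<longrightarrow> \<phi> k x < \<phi> j x})" for j
        by (rule openin_Inter) (use o in blast)+
      then have "openin X (\<Inter>j\<in>S. \<Inter>k\<in>insert j ({..N} - S). {x\<in>topspace X. k \<noteq> j \<longrightarrow> \<phi> k x < \<phi> j x})"
        using S by (intro openin_Inter) blast+
      moreover have "openin X (\<Inter>j\<in>S. {x\<in>topspace X. 0 < \<phi> j x})"
        using S o' by (intro openin_Inter) blast+
      ultimately have "openin X T'"
        unfolding T'_def using T(1) by (intro openin_Int)
      moreover have "x \<in> T'" using x T(2) by (auto simp: T'_def V_def)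
      moreover have "T' \<subseteq> V S"
      proof
        fix z assume z: "z \<in> T'"
        have zX: "z \<in> topspace X" using z T(1) openin_subset by (auto simp: T'_def)
        have "\<phi> k z < \<phi> j z" if "j \<in> S" "k \<notin> S" for j k
        proof (cases "k \<le> N")
          case True
          then have "k \<in> insert j ({..N} - S)" using that by simp
          then have "z \<in> {x\<in>topspace X. k \<noteq> j \<longrightarrow> \<phi> k x < \<phi> j x}" 
            using z \<open>j \<in> S\<close> unfolding T'_def by blast
          then show ?thesis using that by auto
        next
          case False
          then have "z \<notin> G k" using T(3)[of k] z by (auto simp: T'_def)
          then show ?thesis using \<phi>(4)[OF zX] z that by (auto simp: T'_def)
        qed
        then show "z \<in> V S" using z zX by (auto simp: V_def T'_def)
      qed
      ultimately show "\<exists>T. openin X T \<and> x \<in> T \<and> T \<subseteq> V S" by blast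
    qed
    show "V S \<subseteq> G j" if "j \<in> S" for S j
      using \<phi>(4) that by (force simp: V_def)
    show "disjnt (V S) (V S')" if "finite S" "finite S'" "card S = card S'" "S \<noteq> S'" for S S'
    proof -
      \<comment> \<open>Distinct finite sets of equal size give \<open>j\<close> only in
        \<open>S\<close> and \<open>k\<close> only in \<open>S'\<close>; a common point would have
        \<open>\<phi> k x < \<phi> j x\<close> as well as the converse.\<close>
      have "\<not> S \<subseteq> S'" "\<not> S' \<subseteq> S" using that card_subset_eq by metis+
      then obtain j k where "j \<in> S" "j \<notin> S'" "k \<in> S'" "k \<notin> S" by blast
      then show ?thesis
        unfolding disjnt_iff V_def mem_Collect_eq by (meson less_asym)
    qed
    show "\<exists>S. finite S \<and> S \<noteq> {} \<and> card S \<le> m + 1 \<and> x \<in> V S" if x: "x \<in> topspace X" for x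
    proof -
      define S where "S = {n. 0 < \<phi> n x}"
      obtain T N where T: "x \<in> T" "\<And>n. n > N \<Longrightarrow> T \<inter> G n = {}" using lf[OF x] by metis
      have sub: "S \<subseteq> {n. x \<in> G n}" using \<phi>(4)[OF x] by (force simp: S_def)
      have fin: "finite {n. x \<in> G n}"
        by (rule finite_subset[of _ "{..N}"]) (use T in \<open>force simp: not_le[symmetric]\<close>, simp)
      obtain n where "x \<in> C n" using C(3) x by blast
      then have "n \<in> S" using \<phi>(3)[of x n] by (simp add: S_def)
      then have "S \<noteq> {}" by blast
      moreover have "card S \<le> m + 1" using card_mono[OF fin sub] order[OF x] by linarith
      moreover have "x \<in> V S"
      proof -
        have "\<phi> k x = 0" if "k \<notin> S" for k using \<phi>(2)[OF x, of k] that by (auto simp: S_def)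
        then show ?thesis using x by (auto simp: V_def S_def)
      qed
      ultimately show ?thesis using finite_subset[OF sub fin] by blast
    qed
  qed
qed

definition discrete_family :: "'a topology \<Rightarrow> 'a set set \<Rightarrow> bool" where
  "discrete_family X \<V> \<longleftrightarrow>
     (\<forall>x\<in>topspace X. \<exists>N. openin X N \<and> x \<in> N \<and> (\<forall>V\<in>\<V>. \<forall>V'\<in>\<V>. V \<inter> N \<noteq> {} \<and> V' \<inter> N \<noteq> {} \<longrightarrow> V = V'))"

text \<open>Dimension controls finite covers, while \<open>\<O>\<close> is arbitrary. The stages of
  a sigma-disjoint refinement are united to a countable cover, whose order can be reduced and which
  then splits into \<open>m + 1\<close> disjoint colours; intersecting with the disjoint members of
  a stage returns to subsets of members of \<open>\<O>\<close> and keeps disjointness.\<close>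

lemma discrete_coloured_refinement:
  assumes Y: "closed_shrinkable X" and dim: "covering_dim_le X m" and \<O>: "open_cover X \<O>"
  obtains \<V> :: "nat \<Rightarrow> 'a set set" where "\<And>i V. V \<in> \<V> i \<Longrightarrow> openin X V" "\<And>i. refines (\<V> i) \<O>"
    "(\<Union>i\<le>m. \<Union>(\<V> i)) = topspace X" "\<And>i. discrete_family X (\<V> i)"
proof -
  have o1: "openin X U" if "U \<in> \<O>" for U using \<O> that by (auto simp: open_cover_def)
  have o2: "\<Union>((\<lambda>U. U) ` \<O>) = topspace X" using \<O> by (auto simp: open_cover_def)
  obtain C0 A :: "nat \<Rightarrow> 'a set \<Rightarrow> 'a set" where "\<And>n i. i \<in> \<O> \<Longrightarrow> C0 n i \<subseteq> i"
    and A: "\<And>n i. i \<in> \<O> \<Longrightarrow> openin X (A n i)" "\<And>n i. i \<in> \<O> \<Longrightarrow> A n i \<subseteq> C0 n i"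
    "\<And>n i j. i \<in> \<O> \<Longrightarrow> j \<in> \<O> \<Longrightarrow> i \<noteq> j \<Longrightarrow> disjnt (A n i) (A n j)"
    "(\<Union>n. \<Union>(A n ` \<O>)) = topspace X"
    by (rule closed_shrinkable_sigma_disjoint[OF Y o1 o2]) auto
  then have A2: "\<And>n i. i \<in> \<O> \<Longrightarrow> A n i \<subseteq> i" by blast
  define D where "D n = \<Union>(A n ` \<O>)" for n
  have D: "\<And>n. openin X (D n)" "(\<Union>n. D n) = topspace X" using A(1,4) by (auto simp: D_def)
  obtain B where B: "\<And>n. closedin X (B n)" "mono B" "\<And>n. B n \<subseteq> (\<Union>i\<le>n. D i)"
    "(\<Union>n. X interior_of B n) = topspace X"
    by (rule countable_cover_exhaustion[OF Y D]) (rule that)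
  \<comment> \<open>Removing \<open>B (n - 1)\<close> keeps a cover, by the first \<open>n\<close>
    with \<open>x \<in> D n\<close>, and lets every \<open>B k\<close> meet only finitely many
    members.\<close>
  define G where "G n = D n - (case n of 0 \<Rightarrow> {} | Suc k \<Rightarrow> B k)" for n
  have G1: "openin X (G n)" for n
    unfolding G_def using D B by (cases n) (auto intro!: openin_diff)
  have G2: "(\<Union>n. G n) = topspace X"
  proof
    show "(\<Union>n. G n) \<subseteq> topspace X" using D by (auto simp: G_def)
    show "topspace X \<subseteq> (\<Union>n. G n)"
    proof
      fix x assume "x \<in> topspace X"
      then have ex: "\<exists>n. x \<in> D n" using D by blast
      define n where "n = (LEAST n. x \<in> D n)"
      have n: "x \<in> D n" "\<And>k. k < n \<Longrightarrow> x \<notin> D k"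
        unfolding n_def using LeastI_ex[OF ex] not_less_Least by auto
      have "x \<in> G n"
      proof (cases n)
        case (Suc k)
        then have "x \<notin> B k" using B(3)[of k] n(2) by fastforce
        then show ?thesis using n Suc by (auto simp: G_def)
      qed (use n in \<open>auto simp: G_def\<close>)
      then show "x \<in> (\<Union>n. G n)" by blast
    qed
  qed
  have BG: "B k \<inter> G n = {}" if kn: "k < n" for k n
  proof -
    obtain j where j: "n = Suc j" using kn by (cases n) auto
    then have "B k \<subseteq> B j" using monoD[OF B(2)] kn by simp
    then show ?thesis using j by (auto simp: G_def)
  qed
  obtain G' where G': "\<And>n. openin X (G' n)" "(\<Union>n. G' n) = topspace X" "\<And>n. G' n \<subseteq> G n"
    "\<And>x. x \<in> topspace X \<Longrightarrow> card {n. x \<in> G' n} \<le> m + 1"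
    by (rule order_reduction[OF dim B(1,2,4) BG G1 G2]) (assumption, rule that)
  have lf: "\<exists>T N. openin X T \<and> x \<in> T \<and> (\<forall>n>N. T \<inter> G' n = {})" if x: "x \<in> topspace X" for x
  proof -
    obtain N where N: "x \<in> X interior_of B N" using B(4) x by blast
    have "X interior_of B N \<inter> G' n = {}" if "n > N" for n
      using BG[OF that] G'(3)[of n] interior_of_subset[of X "B N"] by blast
    then show ?thesis using N openin_interior_of by metis
  qed
  obtain V where V: "\<And>S. finite S \<Longrightarrow> S \<noteq> {} \<Longrightarrow> openin X (V S)" "\<And>S j. j \<in> S \<Longrightarrow> V S \<subseteq> G' j"
    "\<And>S S'. finite S \<Longrightarrow> finite S' \<Longrightarrow> card S = card S' \<Longrightarrow> S \<noteq> S' \<Longrightarrow> disjnt (V S) (V S')"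
    "\<And>x. x \<in> topspace X \<Longrightarrow> \<exists>S. finite S \<and> S \<noteq> {} \<and> card S \<le> m + 1 \<and> x \<in> V S"
    by (rule coloured_refinement[OF Y G'(1,2) lf G'(4)]) (assumption, assumption, rule that)
  \<comment> \<open>Colour \<open>i\<close> belongs to index sets of size \<open>i + 1\<close>.
    Since \<open>V S\<close> lies in \<open>D (Min S)\<close>, the disjoint family of stage
    \<open>Min S\<close> covers it; any fixed choice of an element of \<open>S\<close> would
    serve.\<close>
  define \<W> where "\<W> i = {V S \<inter> A (Min S) u |S u. finite S \<and> card S = i + 1 \<and> u \<in> \<O>}" for i
  have W1: "openin X W" if W: "W \<in> \<W> i" for W i
  proof -
    obtain S u where "finite S" "card S = i + 1" "u \<in> \<O>" "W = V S \<inter> A (Min S) u"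
      using W unfolding \<W>_def by blast
    moreover from this have "S \<noteq> {}" by auto
    ultimately show ?thesis using V(1)[of S] A(1)[of u "Min S"] by (auto intro!: openin_Int)
  qed
  have W2: "\<exists>u\<in>\<O>. W \<subseteq> u" if "W \<in> \<W> i" for W i
    using that A2 unfolding \<W>_def by blast
  have W3: "W = W'" if W: "W \<in> \<W> i" "W' \<in> \<W> i" "W \<inter> W' \<noteq> {}" for W W' i
  proof -
    obtain S u where S: "finite S" "card S = i + 1" "u \<in> \<O>" "W = V S \<inter> A (Min S) u"
      using W unfolding \<W>_def by blast
    obtain S' u' where S': "finite S'" "card S' = i + 1" "u' \<in> \<O>" "W' = V S' \<inter> A (Min S') u'"
      using W unfolding \<W>_def by blast
    have "S = S'" using V(3)[of S S'] S S' W(3) by (auto simp: disjnt_iff)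
    moreover from this have "u = u'" using A(3)[of u u' "Min S"] S S' W(3) by (auto simp: disjnt_iff)
    ultimately show ?thesis using S S' by simp
  qed
  define E where "E i = \<Union>(\<W> i)" for i
  have E1: "openin X (E i)" for i using W1 by (auto simp: E_def)
  have E2: "\<Union>(E ` {..m}) = topspace X"
  proof
    show "\<Union>(E ` {..m}) \<subseteq> topspace X" using E1 openin_subset by blast
    show "topspace X \<subseteq> \<Union>(E ` {..m})"
    proof
      fix x assume x: "x \<in> topspace X"
      then obtain S where S: "finite S" "S \<noteq> {}" "card S \<le> m + 1" "x \<in> V S" using V(4) by blast
      then have c: "card S \<noteq> 0" by simp
      have "x \<in> D (Min S)"
        using V(2)[of "Min S" S] S G'(3)[of "Min S"] Min_in[of S] by (auto simp: G_def)
      then obtain u where "u \<in> \<O>" "x \<in> A (Min S) u" by (auto simp: D_def)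
      moreover have "card S = card S - 1 + 1" using c by simp
      ultimately have "V S \<inter> A (Min S) u \<in> \<W> (card S - 1)" "x \<in> V S \<inter> A (Min S) u"
        unfolding \<W>_def using S(1,4) by blast+
      then show "x \<in> \<Union>(E ` {..m})" using S unfolding E_def by (intro UN_I[of "card S - 1"]) auto
    qed
  qed
  obtain C where C: "\<And>i. i \<in> {..m} \<Longrightarrow> C i \<subseteq> E i" "\<And>J. J \<subseteq> {..m} \<Longrightarrow> closedin X (\<Union>(C ` J))"
    "\<Union>(C ` {..m}) = topspace X"
    by (rule closed_shrinkable_indexed[OF Y E1 E2]) (rule that)
  \<comment> \<open>Disjoint becomes discrete after cutting the colour down to \<open>O' i\<close>,
    whose closure lies in the union \<open>E i\<close> of the colour: a point of \<open>E i\<close>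
    has a member as neighbourhood, any other point avoids the closure of
    \<open>O' i\<close>.\<close>
  have "\<exists>T. openin X T \<and> C i \<subseteq> T \<and> X closure_of T \<subseteq> E i" if i: "i \<in> {..m}" for i
  proof -
    have "closedin X (C i)" using C(2)[of "{i}"] i by simp
    then show ?thesis
      using closed_shrinkable_imp_normal[OF Y] C(1)[OF i] E1[of i] by (simp add: normal_space_alt)
  qed
  then obtain O' where O': "\<And>i. i \<in> {..m} \<Longrightarrow> openin X (O' i) \<and> C i \<subseteq> O' i \<and> X closure_of (O' i) \<subseteq> E i"
    by metis
  define \<V> where "\<V> i = (if i \<le> m then (\<lambda>W. W \<inter> O' i) ` \<W> i else {})" for i
  show thesis
  proof
    show "openin X V" if "V \<in> \<V> i" for i V
      using that W1[of _ i] O'[of i] by (auto simp: \<V>_def intro!: openin_Int split: if_splits)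
    show "refines (\<V> i) \<O>" for i
      unfolding refines_def
    proof
      fix V assume "V \<in> \<V> i"
      then obtain W where "W \<in> \<W> i" "V \<subseteq> W" by (auto simp: \<V>_def split: if_splits)
      then show "\<exists>U\<in>\<O>. V \<subseteq> U" using W2[of W i] by blast
    qed
    show "(\<Union>i\<le>m. \<Union>(\<V> i)) = topspace X"
    proof
      show "(\<Union>i\<le>m. \<Union>(\<V> i)) \<subseteq> topspace X"
        using W1[THEN openin_subset] by (fastforce simp: \<V>_def split: if_splits)
      show "topspace X \<subseteq> (\<Union>i\<le>m. \<Union>(\<V> i))"
      proof
        fix x assume "x \<in> topspace X"
        then obtain i where i: "i \<le> m" "x \<in> C i" using C(3) by blast
        then have "x \<in> O' i" using O'[of i] by auto
        moreover obtain W where "W \<in> \<W> i" "x \<in> W" using i C(1)[of i] by (auto simp: E_def)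
        ultimately have "x \<in> \<Union>(\<V> i)" using i by (auto simp: \<V>_def)
        then show "x \<in> (\<Union>i\<le>m. \<Union>(\<V> i))" using i by blast
      qed
    qed
    show "discrete_family X (\<V> i)" for i
      unfolding discrete_family_def
    proof (intro ballI)
      fix x assume x: "x \<in> topspace X"
      show "\<exists>N. openin X N \<and> x \<in> N \<and> (\<forall>V\<in>\<V> i. \<forall>V'\<in>\<V> i. V \<inter> N \<noteq> {} \<and> V' \<inter> N \<noteq> {} \<longrightarrow> V = V')"
      proof (cases "i \<le> m")
        case i: True
        show ?thesis
        proof (cases "x \<in> E i")
          case True
          then obtain W where W: "W \<in> \<W> i" "x \<in> W" by (auto simp: E_def)
          have "V = W \<inter> O' i" if V: "V \<in> \<V> i" "V \<inter> W \<noteq> {}" for V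
          proof -
            obtain W' where "W' \<in> \<W> i" "V = W' \<inter> O' i" using V i by (auto simp: \<V>_def)
            then show ?thesis using W3[of W' i W] W(1) V(2) by blast
          qed
          then show ?thesis using W W1 by (intro exI[of _ W]) blast
        next
          case False
          let ?N = "topspace X - X closure_of (O' i)"
          have "V \<inter> ?N = {}" if "V \<in> \<V> i" for V
            using that i O'[of i] closure_of_subset[of "O' i" X] openin_subset[of X "O' i"]
            by (auto simp: \<V>_def)
          moreover have "openin X ?N" "x \<in> ?N" using x False O'[of i] i by auto
          ultimately show ?thesis by blast
        qed
      next
        case False
        then show ?thesis using x by (intro exI[of _ "topspace X"]) (auto simp: \<V>_def)
      qed
    qed
  qed
qed

section \<open>Extending maps into suspensions\<close>

text \<open>The extension is asked for on a closed neighbourhood, with \<open>T\<close> open in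
  between, because it is later pasted with maps given on other closed sets.\<close>

definition abs_nbhd_extensor :: "'a topology \<Rightarrow> 'b topology \<Rightarrow> bool" where
  "abs_nbhd_extensor L X \<longleftrightarrow>
     (\<forall>A g. closedin X A \<and> continuous_map (subtopology X A) L g \<longrightarrow>
        (\<exists>N T h. closedin X N \<and> openin X T \<and> A \<subseteq> T \<and> T \<subseteq> N \<and>
           continuous_map (subtopology X N) L h \<and> (\<forall>x\<in>A. h x = g x)))"

lemma abs_nbhd_extensorE:
  assumes "abs_nbhd_extensor L X" "closedin X A" "continuous_map (subtopology X A) L g"
  obtains N T h where "closedin X N" "openin X T" "A \<subseteq> T" "T \<subseteq> N"
    "continuous_map (subtopology X N) L h" "\<And>x. x \<in> A \<Longrightarrow> h x = g x"
proof -
  have "\<exists>N T h. closedin X N \<and> openin X T \<and> A \<subseteq> T \<and> T \<subseteq> N \<and>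
           continuous_map (subtopology X N) L h \<and> (\<forall>x\<in>A. h x = g x)"
    by (rule assms(1)[unfolded abs_nbhd_extensor_def, THEN spec[of _ A], THEN spec[of _ g], THEN mp, OF conjI[OF assms(2,3)]])
  then show thesis
    by (elim exE conjE) (rule that, assumption+, blast)
qed

lemma abs_nbhd_extensor_closed_subspace:
  assumes "abs_nbhd_extensor L X" "closedin X Z"
  shows "abs_nbhd_extensor L (subtopology X Z)"
  unfolding abs_nbhd_extensor_def
proof (intro allI impI, elim conjE)
  fix A g assume A: "closedin (subtopology X Z) A" and g: "continuous_map (subtopology (subtopology X Z) A) L g"
  have AZ: "closedin X A" "A \<subseteq> Z"
    using A assms(2) closedin_trans_full closedin_subset[OF A] by (auto simp: topspace_subtopology)
  then have "continuous_map (subtopology X A) L g"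
    using g by (simp add: subtopology_subtopology Int_absorb1)
  then obtain N T h where N: "closedin X N" "openin X T" "A \<subseteq> T" "T \<subseteq> N"
    "continuous_map (subtopology X N) L h" "\<And>x. x \<in> A \<Longrightarrow> h x = g x"
    by (rule abs_nbhd_extensorE[OF assms(1) AZ(1)]) (rule that)
  show "\<exists>N T h. closedin (subtopology X Z) N \<and> openin (subtopology X Z) T \<and> A \<subseteq> T \<and> T \<subseteq> N \<and>
           continuous_map (subtopology (subtopology X Z) N) L h \<and> (\<forall>x\<in>A. h x = g x)"
  proof (intro exI conjI ballI)
    show "closedin (subtopology X Z) (Z \<inter> N)" "openin (subtopology X Z) (Z \<inter> T)"
      using N by (auto simp: closedin_subtopology openin_subtopology)
    show "continuous_map (subtopology (subtopology X Z) (Z \<inter> N)) L h"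
      using continuous_map_from_subtopology_mono[OF N(5), of "Z \<inter> (Z \<inter> N)"]
      by (simp add: subtopology_subtopology)
  qed (use N AZ in auto)
qed

section \<open>Coordinates and stretching on a suspension\<close>

abbreviation unit_interval :: "real topology" where
  "unit_interval \<equiv> top_of_set {0..1}"

lemma locally_compact_unit_interval: "locally_compact_space unit_interval" "Hausdorff_space unit_interval"
  by (auto intro!: compact_imp_locally_compact_space Hausdorff_space_subtopology compact_space_subtopology)

fun height :: "'a susp_point \<Rightarrow> real" where
  "height (Base _) = 0"
| "height South = 0"
| "height North = 1"
| "height (Mid p t) = t"

fun equator :: "'a susp_point \<Rightarrow> 'a susp_point" where
  "equator (Mid p t) = p"
| "equator z = z"

definition clamp01 :: "real \<Rightarrow> real" where
  "clamp01 r = max 0 (min 1 r)"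

text \<open>A homotopy in \<open>s\<close> from the identity to the map that expands the heights
  between 1/3 and 2/3 to the full interval and sends the outer thirds to the poles:
  \<open>3 * t - 1\<close> takes 1/3 to 0 and 2/3 to 1. At its end the equator coordinate matters
  only in the middle third.\<close>

fun stretch :: "real \<times> 'a susp_point \<Rightarrow> 'a susp_point" where
  "stretch (s, Mid p t) = susp_proj (p, (1 - s) * t + s * clamp01 (3 * t - 1))"
| "stretch (s, z) = z"

lemma height_susp_proj [simp]: "height (susp_proj (p, t)) = t"
  by (simp add: susp_proj_def)

lemma susp_proj_0 [simp]: "susp_proj (p, 0) = South" and susp_proj_1 [simp]: "susp_proj (p, 1) = North"
  by (simp_all add: susp_proj_def)

lemma equator_susp_proj: "0 < t \<Longrightarrow> t < 1 \<Longrightarrow> equator (susp_proj (p, t)) = p"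
  by (simp add: susp_proj_def)

lemma stretch_susp_proj:
  "stretch (s, susp_proj (p, t)) = susp_proj (p, (1 - s) * t + s * clamp01 (3 * t - 1))"
  by (auto simp: susp_proj_def clamp01_def)

lemma topspace_suspension: "topspace (suspension L) = susp_proj ` (topspace L \<times> {0..1})"
  by (simp add: suspension_def)

lemma quotient_map_susp_proj: "quotient_map (prod_topology L unit_interval) (suspension L) susp_proj"
  unfolding suspension_def by (rule quotient_map_quotient_topology)

lemma continuous_map_susp_proj: "continuous_map (prod_topology L unit_interval) (suspension L) susp_proj"
  by (rule quotient_imp_continuous_map[OF quotient_map_susp_proj])

lemma continuous_map_into_suspension:
  assumes "continuous_map Z L p" "continuous_map Z euclideanreal t" "\<And>z. z \<in> topspace Z \<Longrightarrow> t z \<in> {0..1}"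
  shows "continuous_map Z (suspension L) (\<lambda>z. susp_proj (p z, t z))"
proof -
  have "continuous_map Z (prod_topology L unit_interval) (\<lambda>z. (p z, t z))"
    using assms by (auto intro!: continuous_map_pairedI simp: continuous_map_in_subtopology)
  from continuous_map_compose[OF this continuous_map_susp_proj] show ?thesis
    by (simp add: o_def)
qed

lemma continuous_map_height: "continuous_map (suspension L) euclideanreal height"
proof (rule continuous_compose_quotient_map[OF quotient_map_susp_proj])
  have "height \<circ> susp_proj = snd" by auto
  then show "continuous_map (prod_topology L unit_interval) euclideanreal (height \<circ> susp_proj)"
    using continuous_map_snd continuous_map_into_fulltopology by metis
qed

lemma height_in_unit_interval: "z \<in> topspace (suspension L) \<Longrightarrow> height z \<in> {0..1}"
  by (auto simp: topspace_suspension)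

lemma susp_proj_equator:
  "t = 0 \<longleftrightarrow> s = 0 \<Longrightarrow> t = 1 \<longleftrightarrow> s = 1 \<Longrightarrow> susp_proj (equator (susp_proj (p, t)), s) = susp_proj (p, s)"
  by (cases "t = 0"; cases "t = 1") (auto simp: susp_proj_def)

lemma continuous_map_equator:
  "continuous_map (subtopology (suspension L) {z \<in> topspace (suspension L). height z \<in> {0<..<1}}) L equator"
proof -
  let ?V = "{z \<in> topspace (suspension L). height z \<in> {0<..<1}}"
  let ?U = "{x \<in> topspace (prod_topology L unit_interval). susp_proj x \<in> ?V}"
  have "openin (suspension L) ?V"
    by (rule openin_continuous_map_preimage[OF continuous_map_height]) auto
  then have q: "quotient_map (subtopology (prod_topology L unit_interval) ?U) (subtopology (suspension L) ?V) susp_proj"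
    by (intro quotient_map_restriction[OF quotient_map_susp_proj]) auto
  show ?thesis
  proof (rule continuous_compose_quotient_map[OF q])
    have "continuous_map (subtopology (prod_topology L unit_interval) ?U) L fst"
      by (intro continuous_map_from_subtopology continuous_map_fst)
    then show "continuous_map (subtopology (prod_topology L unit_interval) ?U) L (equator \<circ> susp_proj)"
      by (rule continuous_map_eq) (auto simp: equator_susp_proj)
  qed
qed

lemma continuous_map_clamp01:
  "continuous_map X euclideanreal f \<Longrightarrow> continuous_map X euclideanreal (\<lambda>x. clamp01 (f x))"
  unfolding clamp01_def by (intro continuous_map_real_max continuous_map_real_min) auto

lemma clamp01_bounds: "clamp01 r \<in> {0..1}"
  by (simp add: clamp01_def)

text \<open>Continuity can be tested before the identifications, because the product of a quotient
  map with the locally compact interval is again a quotient map.\<close>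

lemma continuous_map_stretch:
  "continuous_map (prod_topology unit_interval (suspension L)) (suspension L) stretch"
proof (rule continuous_compose_quotient_map
    [OF quotient_map_prod_right[OF locally_compact_unit_interval(1) _ quotient_map_susp_proj]])
  let ?P = "prod_topology unit_interval (prod_topology L unit_interval)"
  have 1: "continuous_map ?P L (\<lambda>x. fst (snd x))"
    using continuous_map_compose[OF continuous_map_snd continuous_map_fst] by (simp add: o_def)
  have "continuous_map ?P unit_interval (\<lambda>x. snd (snd x))"
    using continuous_map_compose[OF continuous_map_snd continuous_map_snd] by (simp add: o_def)
  then have 2: "continuous_map ?P euclideanreal (\<lambda>x. snd (snd x))"
    by (rule continuous_map_into_fulltopology)
  have 3: "continuous_map ?P euclideanreal fst"
    using continuous_map_fst by (rule continuous_map_into_fulltopology)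
  have "continuous_map ?P (suspension L)
     (\<lambda>x. susp_proj (fst (snd x), (1 - fst x) * snd (snd x) + fst x * clamp01 (3 * snd (snd x) - 1)))"
  proof (rule continuous_map_into_suspension[OF 1])
    show "continuous_map ?P euclideanreal (\<lambda>x. (1 - fst x) * snd (snd x) + fst x * clamp01 (3 * snd (snd x) - 1))"
      by (intro continuous_intros continuous_map_clamp01 2 3)
    show "(1 - fst x) * snd (snd x) + fst x * clamp01 (3 * snd (snd x) - 1) \<in> {0..1}" if "x \<in> topspace ?P" for x
    proof -
      have "(1 - fst x) * snd (snd x) + fst x * clamp01 (3 * snd (snd x) - 1) \<le> 1"
        using that clamp01_bounds[of "3 * snd (snd x) - 1"]
        by (intro convex_bound_le) auto
      moreover have "0 \<le> (1 - fst x) * snd (snd x) + fst x * clamp01 (3 * snd (snd x) - 1)"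
        using that clamp01_bounds[of "3 * snd (snd x) - 1"] by auto
      ultimately show ?thesis by simp
    qed
  qed
  then show "continuous_map ?P (suspension L) (stretch \<circ> (\<lambda>(x, y). (x, susp_proj y)))"
    by (rule continuous_map_eq) (auto simp: stretch_susp_proj)
qed (use locally_compact_unit_interval in auto)

lemma stretch_0: "z \<in> topspace (suspension L) \<Longrightarrow> stretch (0, z) = z"
  by (auto simp: topspace_suspension stretch_susp_proj)

lemma stretch_1: "z \<in> topspace (suspension L) \<Longrightarrow> stretch (1, z) = susp_proj (equator z, clamp01 (3 * height z - 1))"
proof -
  have "stretch (1, susp_proj (p, t)) = susp_proj (equator (susp_proj (p, t)), clamp01 (3 * t - 1))" for p :: "'a susp_point" and t
    by (cases "t = 0"; cases "t = 1") (simp_all add: stretch_susp_proj clamp01_def susp_proj_def)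
  then show "z \<in> topspace (suspension L) \<Longrightarrow> stretch (1, z) = susp_proj (equator z, clamp01 (3 * height z - 1))"
    by (auto simp: topspace_suspension)
qed

lemma closedin_le_continuous_maps:
  assumes "continuous_map X euclideanreal f" "continuous_map X euclideanreal g"
  shows "closedin X {x \<in> topspace X. f x \<le> g x}"
proof -
  have "{x \<in> topspace X. f x \<le> g x} = topspace X - {x \<in> topspace X. g x < f x}" by auto
  then show ?thesis using openin_less_continuous_maps[OF assms(2,1)] by auto
qed

lemma closedin_eq_continuous_maps:
  assumes "continuous_map X euclideanreal f" "continuous_map X euclideanreal g"
  shows "closedin X {x \<in> topspace X. f x = g x}"
proof -
  have "{x \<in> topspace X. f x = g x} = {x \<in> topspace X. f x \<le> g x} \<inter> {x \<in> topspace X. g x \<le> f x}" by auto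
  then show ?thesis
    using closedin_Int[OF closedin_le_continuous_maps[OF assms] closedin_le_continuous_maps[OF assms(2,1)]]
    by simp
qed

lemma pasting_two_closed:
  assumes "closedin X S" "closedin X T" "continuous_map (subtopology X S) Y f"
    "continuous_map (subtopology X T) Y g" "\<And>x. x \<in> S \<inter> T \<Longrightarrow> f x = g x"
  obtains h where "continuous_map (subtopology X (S \<union> T)) Y h"
    "\<And>x. x \<in> S \<Longrightarrow> h x = f x" "\<And>x. x \<in> T \<Longrightarrow> h x = g x"
proof -
  have ST: "S \<subseteq> topspace X" "T \<subseteq> topspace X" using assms closedin_subset by auto
  define h where "h x = (if x \<in> S then f x else g x)" for x
  have "continuous_map (subtopology X (S \<union> T)) Y h"
  proof (rule pasting_lemma_closed[where I=UNIV and T="\<lambda>b. if b then S else T" and f="\<lambda>b. if b then f else g"])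
    show "closedin (subtopology X (S \<union> T)) (if i then S else T)" for i
      using assms closedin_subset_topspace by (auto intro!: closedin_subset_topspace)
    show "continuous_map (subtopology (subtopology X (S \<union> T)) (if i then S else T)) Y (if i then f else g)" for i
      using assms by (auto simp: subtopology_subtopology Int_absorb1)
    show "(if i then f else g) x = (if j then f else g) x"
      if "x \<in> topspace (subtopology X (S \<union> T)) \<inter> (if i then S else T) \<inter> (if j then S else T)" for i j x
      using that assms(5)[of x] by (auto split: if_splits)
    show "\<exists>j. j \<in> UNIV \<and> x \<in> (if j then S else T) \<and> h x = (if j then f else g) x"
      if "x \<in> topspace (subtopology X (S \<union> T))" for x
      using that by (intro exI[of _ "x \<in> S"]) (auto simp: h_def)
  qed auto
  then show thesis
    using that[of h] assms(5) by (auto simp: h_def)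
qed

text \<open>The set \<open>v = w\<close> separates \<open>v < w\<close> from \<open>v > w\<close>.
  Around it \<open>e\<close> supplies an equator coordinate; away from it the two sides go to the
  two poles, where none is needed. The stretched map on \<open>B\<close> fits: as \<open>w\<close>
  stays between 1/3 and 2/3, a point of \<open>B\<close> that is sent to a pole in this way has its
  prescribed value there.\<close>

lemma suspension_extension_step:
  fixes L :: "'a susp_point topology"
  assumes Z: "normal_space Z" and L: "abs_nbhd_extensor L Z" "topspace L \<noteq> {}"
    and B: "closedin Z B" and g: "continuous_map (subtopology Z B) (suspension L) g"
    and v: "continuous_map Z euclideanreal v" "\<And>x. x \<in> B \<Longrightarrow> v x = height (g x)"
    and w: "continuous_map Z euclideanreal w" "\<And>x. x \<in> topspace Z \<Longrightarrow> w x \<in> {1/3..2/3}"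
    and e: "continuous_map (subtopology Z {x \<in> topspace Z. v x = w x}) L e"
      "\<And>x. x \<in> B \<Longrightarrow> v x = w x \<Longrightarrow> e x = equator (g x)"
  obtains G where "continuous_map Z (suspension L) G" "\<And>x. x \<in> B \<Longrightarrow> G x = stretch (1, g x)"
proof -
  let ?C = "{x \<in> topspace Z. v x = w x}"
  have BZ: "B \<subseteq> topspace Z" using B closedin_subset by blast
  have gB: "g x \<in> topspace (suspension L)" if "x \<in> B" for x
    using continuous_map_image_subset_topspace[OF g] that BZ by auto
  define A where "A = {x \<in> B. v x \<in> {1/3..2/3}}"
  have A: "closedin Z A"
  proof -
    have "A = B \<inter> {x \<in> topspace Z. v x \<in> {1/3..2/3}}" using BZ by (auto simp: A_def)
    then show ?thesis
      using B closedin_continuous_map_preimage[OF v(1), of "{1/3..2/3}"] by auto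
  qed
  have C: "closedin Z ?C" by (rule closedin_eq_continuous_maps[OF v(1) w(1)])
  have gA: "continuous_map (subtopology Z A) L (\<lambda>x. equator (g x))"
  proof -
    have "continuous_map (subtopology Z A) (suspension L) g"
      using g by (rule continuous_map_from_subtopology_mono) (auto simp: A_def)
    moreover have "g ` A \<subseteq> {z \<in> topspace (suspension L). height z \<in> {0<..<1}}"
      using v(2) gB by (auto simp: A_def)
    ultimately have "continuous_map (subtopology Z A)
        (subtopology (suspension L) {z \<in> topspace (suspension L). height z \<in> {0<..<1}}) g"
      by (auto simp: continuous_map_in_subtopology)
    from continuous_map_compose[OF this continuous_map_equator] show ?thesis by (simp add: o_def)
  qed
  obtain e' where e': "continuous_map (subtopology Z (?C \<union> A)) L e'"
    "\<And>x. x \<in> ?C \<Longrightarrow> e' x = e x" "\<And>x. x \<in> A \<Longrightarrow> e' x = equator (g x)"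
    by (rule pasting_two_closed[OF C A e(1) gA]) (use e(2) in \<open>auto simp: A_def\<close>)
  obtain N T eN where N: "closedin Z N" "openin Z T" "?C \<union> A \<subseteq> T" "T \<subseteq> N"
    "continuous_map (subtopology Z N) L eN" "\<And>x. x \<in> ?C \<union> A \<Longrightarrow> eN x = e' x"
    by (rule abs_nbhd_extensorE[OF L(1) closedin_Un[OF C A] e'(1)]) (rule that)
  \<comment> \<open>\<open>T\<close> contains all points with \<open>v x = w x\<close>, so what is
    left splits into two disjoint closed sets.\<close>
  define S0 where "S0 = {x \<in> topspace Z. v x \<le> w x} - T"
  define S1 where "S1 = {x \<in> topspace Z. w x \<le> v x} - T"
  have S: "closedin Z S0" "closedin Z S1"
    unfolding S0_def S1_def by (intro closedin_diff closedin_le_continuous_maps v w N)+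
  have S01: "S0 \<inter> S1 = {}" using N(3) by (auto simp: S0_def S1_def)
  have cover: "topspace Z = N \<union> S0 \<union> S1"
    using N(4) closedin_subset[OF N(1)] by (auto simp: S0_def S1_def)
  have BS0: "clamp01 (3 * v x - 1) = 0" if "x \<in> B" "x \<in> S0" for x
  proof -
    have "v x < 1/3"
      using that N(3) w(2)[of x] by (auto simp: S0_def A_def)
    then show ?thesis by (simp add: clamp01_def)
  qed
  have BS1: "clamp01 (3 * v x - 1) = 1" if "x \<in> B" "x \<in> S1" for x
  proof -
    have "v x > 2/3"
      using that N(3) w(2)[of x] by (auto simp: S1_def A_def)
    then show ?thesis by (simp add: clamp01_def)
  qed
  \<comment> \<open>Heights are prescribed as 0 on \<open>S0\<close>, 1 on \<open>S1\<close> and the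
    stretched height on \<open>B\<close>. Tietze's theorem interpolates, so the formula on
    \<open>N\<close> meets the constant poles where the pieces overlap.\<close>
  obtain t0 where t0: "continuous_map (subtopology Z (B \<union> S0)) euclideanreal t0"
    "\<And>x. x \<in> B \<Longrightarrow> t0 x = clamp01 (3 * v x - 1)" "\<And>x. x \<in> S0 \<Longrightarrow> t0 x = 0"
  proof (rule pasting_two_closed[OF B S(1)])
    show "continuous_map (subtopology Z B) euclideanreal (\<lambda>x. clamp01 (3 * v x - 1))"
      by (intro continuous_map_from_subtopology continuous_map_clamp01 continuous_intros v)
    show "continuous_map (subtopology Z S0) euclideanreal (\<lambda>x. 0)" by simp
  qed (use BS0 in \<open>auto intro: that\<close>)
  obtain t1 where t1: "continuous_map (subtopology Z (B \<union> S0 \<union> S1)) euclideanreal t1"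
    "\<And>x. x \<in> B \<union> S0 \<Longrightarrow> t1 x = t0 x" "\<And>x. x \<in> S1 \<Longrightarrow> t1 x = 1"
  proof (rule pasting_two_closed[OF closedin_Un[OF B S(1)] S(2) t0(1)])
    show "continuous_map (subtopology Z S1) euclideanreal (\<lambda>x. 1)" by simp
  qed (use BS1 t0 S01 in \<open>auto intro: that\<close>)
  have "t1 ` (B \<union> S0 \<union> S1) \<subseteq> {0..1}"
    using t0 t1 clamp01_bounds by fastforce
  then obtain t where t: "continuous_map Z euclideanreal t"
    "\<And>x. x \<in> B \<union> S0 \<union> S1 \<Longrightarrow> t x = t1 x" "t ` topspace Z \<subseteq> {0..1}"
    using Tietze_extension_closed_real_interval[OF Z closedin_Un[OF closedin_Un[OF B S(1)] S(2)] t1(1), of 0 1]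
    by auto
  obtain p where p: "p \<in> topspace L" using L(2) by blast
  have poles: "South \<in> topspace (suspension L)" "North \<in> topspace (suspension L)"
    using imageI[of "(p, 0)" "topspace L \<times> {0..1}" susp_proj] imageI[of "(p, 1)" "topspace L \<times> {0..1}" susp_proj] p
    by (simp_all add: topspace_suspension)
  have GN: "continuous_map (subtopology Z N) (suspension L) (\<lambda>x. susp_proj (eN x, t x))"
    using t(3) by (intro continuous_map_into_suspension N continuous_map_from_subtopology t) auto
  obtain G0 where G0: "continuous_map (subtopology Z (N \<union> S0)) (suspension L) G0"
    "\<And>x. x \<in> N \<Longrightarrow> G0 x = susp_proj (eN x, t x)" "\<And>x. x \<in> S0 \<Longrightarrow> G0 x = South"
  proof (rule pasting_two_closed[OF N(1) S(1) GN])
    show "continuous_map (subtopology Z S0) (suspension L) (\<lambda>x. South)" using poles by simp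
  qed (use t0 t1 t in \<open>auto intro: that\<close>)
  obtain G where G: "continuous_map (subtopology Z (N \<union> S0 \<union> S1)) (suspension L) G"
    "\<And>x. x \<in> N \<union> S0 \<Longrightarrow> G x = G0 x" "\<And>x. x \<in> S1 \<Longrightarrow> G x = North"
  proof (rule pasting_two_closed[OF closedin_Un[OF N(1) S(1)] S(2) G0(1)])
    show "continuous_map (subtopology Z S1) (suspension L) (\<lambda>x. North)" using poles by simp
  qed (use t0 t1 t G0 S01 in \<open>auto intro: that\<close>)
  show thesis
  proof
    show "continuous_map Z (suspension L) G"
      using G(1) unfolding cover[symmetric] by simp
    show "G x = stretch (1, g x)" if x: "x \<in> B" for x
    proof -
      have tx: "t x = clamp01 (3 * v x - 1)" using t(2) t1(2) t0(2) x by simp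
      have st: "stretch (1, g x) = susp_proj (equator (g x), clamp01 (3 * v x - 1))"
        using stretch_1[OF gB[OF x]] v(2)[OF x] by simp
      consider "x \<in> S1" | "x \<in> S0" | "x \<in> N" using x BZ cover by blast
      then show ?thesis
      proof cases
        case 1
        then show ?thesis using G(3) st BS1[OF x] by simp
      next
        case 2
        then show ?thesis using G(2) G0(3) st BS0[OF x] by simp
      next
        case 3
        then have Gx: "G x = susp_proj (eN x, clamp01 (3 * v x - 1))" using G(2) G0(2) tx by simp
        show ?thesis
        proof (cases "x \<in> A")
          case True
          then show ?thesis using Gx st N(6) e'(3) by simp
        next
          case False
          \<comment> \<open>Here the stretched height is 0 or 1, so \<open>susp_proj\<close> ignores
            that \<open>eN x\<close> and \<open>equator (g x)\<close> may differ.\<close>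
          then have "v x < 1/3 \<or> v x > 2/3" using x by (auto simp: A_def)
          then have "clamp01 (3 * v x - 1) = 0 \<or> clamp01 (3 * v x - 1) = 1" by (auto simp: clamp01_def)
          then show ?thesis using Gx st by auto
        qed
      qed
    qed
  qed
qed

section \<open>Reduction to a problem about level sets\<close>

lemma topspace_iterated_suspension_nonempty:
  "topspace K \<noteq> {} \<Longrightarrow> topspace (iterated_suspension m K) \<noteq> {}"
  by (induction m) (auto simp: topspace_suspension)

text \<open>The data \<open>A0\<close>, \<open>g0\<close>, \<open>u\<close> are to be extracted from \<open>g\<close> before the levels \<open>w\<close> are chosen: the
  functions \<open>u i\<close> extend the heights, and \<open>g0\<close> is the \<open>K\<close>-coordinate of \<open>g\<close>.\<close>

definition reduces_extension ::
  "'z topology \<Rightarrow> 'k topology \<Rightarrow> nat \<Rightarrow> 'z set \<Rightarrow> ('z \<Rightarrow> 'k susp_point) \<Rightarrow>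
    'z set \<Rightarrow> ('z \<Rightarrow> 'k) \<Rightarrow> (nat \<Rightarrow> 'z \<Rightarrow> real) \<Rightarrow> bool" where
  "reduces_extension Z K m A g A0 g0 u \<longleftrightarrow>
     (\<forall>w Z' h. closedin Z Z' \<and>
        (\<forall>i<m. continuous_map Z euclideanreal (w i) \<and> (\<forall>x\<in>topspace Z. w i x \<in> {1/3..2/3})) \<and>
        continuous_map (subtopology Z {x\<in>Z'. \<forall>i<m. u i x = w i x}) K h \<and>
        (\<forall>x\<in>A0 \<inter> Z'. (\<forall>i<m. u i x = w i x) \<longrightarrow> h x = g0 x) \<longrightarrow>
        (\<exists>G. continuous_map (subtopology Z Z') (iterated_suspension m K) G \<and> (\<forall>x\<in>A \<inter> Z'. G x = g x)))"

lemma reduces_extensionE: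
  assumes "reduces_extension Z K m A g A0 g0 u" "closedin Z Z'"
    and "\<And>i. i < m \<Longrightarrow> continuous_map Z euclideanreal (w i)"
    and "\<And>i x. i < m \<Longrightarrow> x \<in> topspace Z \<Longrightarrow> w i x \<in> {1/3..2/3}"
    and "continuous_map (subtopology Z {x\<in>Z'. \<forall>i<m. u i x = w i x}) K h"
    and "\<And>x. x \<in> A0 \<inter> Z' \<Longrightarrow> (\<forall>i<m. u i x = w i x) \<Longrightarrow> h x = g0 x"
  obtains G where "continuous_map (subtopology Z Z') (iterated_suspension m K) G" "\<And>x. x \<in> A \<inter> Z' \<Longrightarrow> G x = g x"
proof -
  have "\<exists>G. continuous_map (subtopology Z Z') (iterated_suspension m K) G \<and> (\<forall>x\<in>A \<inter> Z'. G x = g x)"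
    by (rule assms(1)[unfolded reduces_extension_def, THEN spec[of _ w], THEN spec[of _ Z'], THEN spec[of _ h], THEN mp])
      (use assms(2-6) in auto)
  then show thesis
    using that by auto
qed

text \<open>Each induction step treats the outermost suspension. Extending \<open>g\<close> to a
  closed neighbourhood \<open>N\<close> of \<open>A\<close> gives room for the homotopy
  \<open>stretch\<close>: on \<open>A\<close> the given map is kept, at the outer edge of the room
  its stretched version is reached, and this version extends once the equator coordinate extends
  over \<open>um = w m\<close>, which is the task left to the induction hypothesis.\<close>

lemma iterated_suspension_extension_criterion:
  fixes K :: "'k topology"
  assumes Z: "normal_space Z" and K: "topspace K \<noteq> {}"
    and ane: "\<And>j. j \<le> m \<Longrightarrow> abs_nbhd_extensor (iterated_suspension j K) Z"
    and A: "closedin Z A" and g: "continuous_map (subtopology Z A) (iterated_suspension m K) g"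
  shows "\<exists>A0 g0 u. closedin Z A0 \<and> continuous_map (subtopology Z A0) K g0 \<and>
     (\<forall>i<m. continuous_map Z euclideanreal (u i)) \<and> reduces_extension Z K m A g A0 g0 u"
  using ane A g
proof (induction m arbitrary: A g)
  case 0
  obtain r where r: "homeomorphic_maps K (iterated_suspension 0 K) Base r"
    using homeomorphic_map_iterated_suspension_0 homeomorphic_map_maps by blast
  then have r1: "continuous_map (iterated_suspension 0 K) K r" "continuous_map K (iterated_suspension 0 K) Base"
     "\<And>z. z \<in> topspace (iterated_suspension 0 K) \<Longrightarrow> Base (r z) = z"
    by (auto simp: homeomorphic_maps_def)
  have gA: "g x \<in> topspace (iterated_suspension 0 K)" if "x \<in> A" for x
    using continuous_map_image_subset_topspace[OF 0(3)] that closedin_subset[OF 0(2)] by auto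
  have "reduces_extension Z K 0 A g A (r \<circ> g) u" for u
    unfolding reduces_extension_def
  proof (intro allI impI, elim conjE)
    fix w Z' h
    assume h: "continuous_map (subtopology Z {x \<in> Z'. \<forall>i<0::nat. u i x = w i x}) K h"
       and "\<forall>x\<in>A \<inter> Z'. (\<forall>i<0::nat. u i x = w i x) \<longrightarrow> h x = (r \<circ> g) x"
    then have "\<forall>x\<in>A \<inter> Z'. (Base \<circ> h) x = g x" using r1(3) gA by auto
    moreover have "continuous_map (subtopology Z Z') (iterated_suspension 0 K) (Base \<circ> h)"
      using continuous_map_compose[OF h r1(2)] by simp
    ultimately show "\<exists>G. continuous_map (subtopology Z Z') (iterated_suspension 0 K) G \<and> (\<forall>x\<in>A \<inter> Z'. G x = g x)"
      by blast
  qed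
  moreover have "continuous_map (subtopology Z A) K (r \<circ> g)"
    by (rule continuous_map_compose[OF 0(3) r1(1)])
  ultimately show ?case using 0(2) by blast
next
  case (Suc m)
  let ?L = "iterated_suspension m K"
  have g: "continuous_map (subtopology Z A) (suspension ?L) g" using Suc.prems(3) by simp
  have neL: "topspace ?L \<noteq> {}" by (rule topspace_iterated_suspension_nonempty[OF K])
  have aneL: "abs_nbhd_extensor ?L Z" "abs_nbhd_extensor (suspension ?L) Z"
    using Suc.prems(1)[of m] Suc.prems(1)[of "Suc m"] by auto
  obtain N T gN where N: "closedin Z N" "openin Z T" "A \<subseteq> T" "T \<subseteq> N"
    "continuous_map (subtopology Z N) (suspension ?L) gN" "\<And>x. x \<in> A \<Longrightarrow> gN x = g x"
    by (rule abs_nbhd_extensorE[OF aneL(2) Suc.prems(2) g]) (rule that)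
  have NZ: "N \<subseteq> topspace Z" using N(1) closedin_subset by blast
  have gNt: "gN x \<in> topspace (suspension ?L)" if "x \<in> N" for x
    using continuous_map_image_subset_topspace[OF N(5)] that NZ by auto
  have hN: "continuous_map (subtopology Z N) euclideanreal (\<lambda>x. height (gN x))"
    using continuous_map_compose[OF N(5) continuous_map_height] by (simp add: o_def)
  have "(\<lambda>x. height (gN x)) ` N \<subseteq> {0..1}" using height_in_unit_interval[OF gNt] by blast
  then obtain um where um: "continuous_map Z euclideanreal um" "\<And>x. x \<in> N \<Longrightarrow> um x = height (gN x)"
    by (rule Tietze_extension_closed_real_interval[OF Z N(1) hN, of 0 1]) (auto intro: that)
  define A' where "A' = N \<inter> {x \<in> topspace Z. um x \<in> {1/3..2/3}}"
  have A': "closedin Z A'"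
    unfolding A'_def by (intro closedin_Int N closedin_continuous_map_preimage[OF um(1)]) auto
  have g': "continuous_map (subtopology Z A') ?L (\<lambda>x. equator (gN x))"
  proof -
    have "continuous_map (subtopology Z A') (suspension ?L) gN"
      using N(5) by (rule continuous_map_from_subtopology_mono) (auto simp: A'_def)
    moreover have "gN ` A' \<subseteq> {z \<in> topspace (suspension ?L). height z \<in> {0<..<1}}"
      using um(2) gNt by (auto simp: A'_def)
    ultimately have "continuous_map (subtopology Z A')
        (subtopology (suspension ?L) {z \<in> topspace (suspension ?L). height z \<in> {0<..<1}}) gN"
      by (auto simp: continuous_map_in_subtopology)
    from continuous_map_compose[OF this continuous_map_equator] show ?thesis by (simp add: o_def)
  qed
  obtain A0 g0 u where ih: "closedin Z A0" "continuous_map (subtopology Z A0) K g0"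
     "\<forall>i<m. continuous_map Z euclideanreal (u i)" "reduces_extension Z K m A' (\<lambda>x. equator (gN x)) A0 g0 u"
    using Suc.IH[OF _ A' g'] Suc.prems(1) by (meson le_SucI)
  define u' where "u' = u(m := um)"
  have "closedin Z (topspace Z - T)" "disjnt A (topspace Z - T)"
    using N(2,3) by (auto simp: disjnt_iff)
  \<comment> \<open>The parameter of the homotopy: 0 on \<open>A\<close>, 1 outside
    \<open>T\<close>.\<close>
  then obtain l where l0: "continuous_map Z unit_interval l" "l ` A \<subseteq> {0}" "l ` (topspace Z - T) \<subseteq> {1}"
    using Urysohn_lemma[OF Z Suc.prems(2), of "topspace Z - T" 0 1] by auto
  have l: "continuous_map Z euclideanreal l" using l0(1) by (rule continuous_map_into_fulltopology)
  define R where "R = {x \<in> topspace Z. l x = 1}"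
  have R: "closedin Z R"
    unfolding R_def by (rule closedin_eq_continuous_maps[OF l]) simp
  have NR: "N \<union> R = topspace Z" using N(4) NZ l0(3) by (auto simp: R_def)
  have "reduces_extension Z K (Suc m) A g A0 g0 u'"
    unfolding reduces_extension_def
  proof (intro allI impI, elim conjE)
    fix w Z' h
    assume Z': "closedin Z Z'"
      and w: "\<forall>i<Suc m. continuous_map Z euclideanreal (w i) \<and> (\<forall>x\<in>topspace Z. w i x \<in> {1/3..2/3})"
      and h: "continuous_map (subtopology Z {x \<in> Z'. \<forall>i<Suc m. u' i x = w i x}) K h"
       and hg0: "\<forall>x\<in>A0 \<inter> Z'. (\<forall>i<Suc m. u' i x = w i x) \<longrightarrow> h x = g0 x"
    have Z'Z: "Z' \<subseteq> topspace Z" using Z' closedin_subset by blast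
    have wm: "continuous_map Z euclideanreal (w m)" "\<And>x. x \<in> topspace Z \<Longrightarrow> w m x \<in> {1/3..2/3}"
      using w by auto
    \<comment> \<open>The equator coordinate is required only on this closed set, which is why
      \<open>reduces_extension\<close> quantifies over closed subsets \<open>Z'\<close>.\<close>
    define C where "C = Z' \<inter> {x \<in> topspace Z. um x = w m x}"
    have C: "closedin Z C" unfolding C_def by (intro closedin_Int Z' closedin_eq_continuous_maps um wm)
    have eq: "{x \<in> C. \<forall>i<m. u i x = w i x} = {x \<in> Z'. \<forall>i<Suc m. u' i x = w i x}"
      using Z'Z by (auto simp: C_def u'_def less_Suc_eq)
    obtain e where e: "continuous_map (subtopology Z C) ?L e" "\<And>x. x \<in> A' \<inter> C \<Longrightarrow> e x = equator (gN x)"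
    proof (rule reduces_extensionE[OF ih(4) C])
      show "continuous_map (subtopology Z {x \<in> C. \<forall>i<m. u i x = w i x}) K h"
        unfolding eq by (rule h)
      show "h x = g0 x" if "x \<in> A0 \<inter> C" "\<forall>i<m. u i x = w i x" for x
        using that hg0 eq by (auto simp: C_def u'_def less_Suc_eq)
    qed (use w in \<open>auto intro: that\<close>)
    let ?Z = "subtopology Z Z'" and ?B = "Z' \<inter> (N \<inter> R)"
    have tZ: "topspace ?Z = Z'" using Z'Z by auto
    obtain G where G: "continuous_map ?Z (suspension ?L) G" "\<And>x. x \<in> ?B \<Longrightarrow> G x = stretch (1, gN x)"
    proof (rule suspension_extension_step[of ?Z ?L ?B gN um "w m" e])
      show "normal_space ?Z" by (rule normal_space_closed_subtopology[OF Z Z'])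
      show "abs_nbhd_extensor ?L ?Z" by (rule abs_nbhd_extensor_closed_subspace[OF aneL(1) Z'])
      show "closedin ?Z ?B" using N(1) R by (auto simp: closedin_subtopology)
      show "continuous_map (subtopology ?Z ?B) (suspension ?L) gN"
        using continuous_map_from_subtopology_mono[OF N(5), of "Z' \<inter> ?B"]
        by (auto simp: subtopology_subtopology)
      show "continuous_map ?Z euclideanreal um" "continuous_map ?Z euclideanreal (w m)"
        by (intro continuous_map_from_subtopology um wm)+
      have "C = Z' \<inter> {x \<in> topspace ?Z. um x = w m x}" using Z'Z by (auto simp: C_def)
      then show "continuous_map (subtopology ?Z {x \<in> topspace ?Z. um x = w m x}) ?L e"
        using e(1) by (simp add: subtopology_subtopology)
      show "e x = equator (gN x)" if "x \<in> ?B" "um x = w m x" for x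
        using that e(2)[of x] wm(2)[of x] Z'Z by (auto simp: C_def A'_def)
    qed (use neL um wm tZ Z'Z in \<open>auto intro: that\<close>)
    have SN: "continuous_map (subtopology ?Z (Z' \<inter> N)) (suspension ?L) (\<lambda>x. stretch (l x, gN x))"
    proof -
      have 1: "continuous_map (subtopology ?Z (Z' \<inter> N)) (suspension ?L) gN"
        using continuous_map_from_subtopology_mono[OF N(5), of "Z' \<inter> (Z' \<inter> N)"]
        by (auto simp: subtopology_subtopology)
      have 2: "continuous_map (subtopology ?Z (Z' \<inter> N)) unit_interval l"
        by (intro continuous_map_from_subtopology l0)
      have "continuous_map (subtopology ?Z (Z' \<inter> N)) (prod_topology unit_interval (suspension ?L)) (\<lambda>x. (l x, gN x))"
        by (intro continuous_map_pairedI 1 2)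
      from continuous_map_compose[OF this continuous_map_stretch] show ?thesis by (simp add: o_def)
    qed
    have cl: "closedin ?Z (Z' \<inter> N)" "closedin ?Z (Z' \<inter> R)"
      using N(1) R by (auto simp: closedin_subtopology)
    obtain F where F: "continuous_map (subtopology ?Z (Z' \<inter> N \<union> Z' \<inter> R)) (suspension ?L) F"
      "\<And>x. x \<in> Z' \<inter> N \<Longrightarrow> F x = stretch (l x, gN x)" "\<And>x. x \<in> Z' \<inter> R \<Longrightarrow> F x = G x"
    proof (rule pasting_two_closed[OF cl SN])
      show "continuous_map (subtopology ?Z (Z' \<inter> R)) (suspension ?L) G"
        by (intro continuous_map_from_subtopology G)
      show "stretch (l x, gN x) = G x" if "x \<in> Z' \<inter> N \<inter> (Z' \<inter> R)" for x
        using that G(2)[of x] by (auto simp: R_def)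
    qed (rule that)
    have "Z' \<inter> N \<union> Z' \<inter> R = Z'" using NR Z'Z by blast
    then have "continuous_map ?Z (iterated_suspension (Suc m) K) F"
      using F(1) by (simp add: subtopology_subtopology)
    moreover have "F x = g x" if x: "x \<in> A \<inter> Z'" for x
    proof -
      have "x \<in> N" using x N by blast
      then have "F x = stretch (l x, gN x)" using F(2) x by blast
      also have "l x = 0" using l0(2) x by auto
      finally show ?thesis using stretch_0[OF gNt[OF \<open>x \<in> N\<close>]] N(6)[of x] x by auto
    qed
    ultimately show "\<exists>G. continuous_map ?Z (iterated_suspension (Suc m) K) G \<and> (\<forall>x\<in>A \<inter> Z'. G x = g x)"
      by blast
  qed
  moreover have "\<forall>i<Suc m. continuous_map Z euclideanreal (u' i)"
    using ih(3) um(1) by (auto simp: u'_def less_Suc_eq)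
  ultimately show ?case using ih(1,2) by blast
qed

section \<open>Local extensions along a closed map\<close>

locale fibre_extension =
  fixes X :: "'x topology" and Y :: "'y topology" and K :: "'k topology" and f :: "'x \<Rightarrow> 'y"
    and m :: nat and A0 :: "'x set" and g0 :: "'x \<Rightarrow> 'k" and u :: "nat \<Rightarrow> 'x \<Rightarrow> real"
  assumes Y_T1: "t1_space Y" and Y_regular: "regular_space Y"
    and Y_shrinkable: "closed_shrinkable Y" and Y_dim: "covering_dim_le Y m"
    and f_cont: "continuous_map X Y f" and f_closed: "closed_map X Y f"
    and K_ane: "abs_nbhd_extensor K X"
    and fibres: "\<And>y. y \<in> topspace Y \<Longrightarrow> abs_extensor K (subtopology X {x \<in> topspace X. f x = y})"
    and A0: "closedin X A0" and g0: "continuous_map (subtopology X A0) K g0"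
    and u: "\<And>i. i < m \<Longrightarrow> continuous_map X euclideanreal (u i)"
begin

abbreviation pre :: "'y set \<Rightarrow> 'x set" where
  "pre S \<equiv> {x \<in> topspace X. f x \<in> S}"

lemma fX: "x \<in> topspace X \<Longrightarrow> f x \<in> topspace Y"
  using f_cont continuous_map_image_subset_topspace by fastforce

lemma closed_nbhd:
  assumes "openin Y T" "y \<in> T"
  obtains T' where "openin Y T'" "y \<in> T'" "Y closure_of T' \<subseteq> T"
proof -
  obtain U C where "openin Y U" "closedin Y C" "y \<in> U" "U \<subseteq> C" "C \<subseteq> T"
    using Y_regular assms unfolding neighbourhood_base_of_closedin[symmetric] neighbourhood_base_of by meson
  then show thesis using that[of U] closure_of_minimal[of U C Y] by blast
qed

text \<open>The hypothesis on fibres extends the prescribed values over the fibre of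
  \<open>y\<close>, the neighbourhood extensor \<open>K\<close> extends them to a neighbourhood of
  that fibre, and since \<open>f\<close> is closed, such a neighbourhood contains the preimage of a
  neighbourhood of \<open>y\<close>.\<close>

lemma local_extension:
  fixes B :: "'i \<Rightarrow> 'x set" and p :: "'i \<Rightarrow> 'x \<Rightarrow> 'k"
  assumes y: "openin Y T" "y \<in> T" and fin: "finite I"
    and B: "\<And>i. i \<in> I \<Longrightarrow> closedin X (B i)"
    and p: "\<And>i. i \<in> I \<Longrightarrow> continuous_map (subtopology X (B i \<inter> pre T)) K (p i)"
    and eq: "\<And>i j x. i \<in> I \<Longrightarrow> j \<in> I \<Longrightarrow> x \<in> B i \<Longrightarrow> x \<in> B j \<Longrightarrow> x \<in> pre T \<Longrightarrow> p i x = p j x"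
  obtains T' e where "openin Y T'" "y \<in> T'" "T' \<subseteq> T" "continuous_map (subtopology X (pre T')) K e"
    "\<And>i x. i \<in> I \<Longrightarrow> x \<in> B i \<Longrightarrow> x \<in> pre T' \<Longrightarrow> e x = p i x"
proof -
  have yY: "y \<in> topspace Y" using y openin_subset by blast
  obtain T1 where T1: "openin Y T1" "y \<in> T1" "Y closure_of T1 \<subseteq> T"
    by (rule closed_nbhd[OF y]) (rule that)
  \<comment> \<open>The prescriptions live over the open set \<open>T\<close>; over the closure of a
    smaller set they become prescriptions on closed subsets of \<open>X\<close>.\<close>
  define X1 where "X1 = pre (Y closure_of T1)"
  have X1: "closedin X X1" "X1 \<subseteq> pre T"
    unfolding X1_def using T1(3) by (auto intro!: closedin_continuous_map_preimage[OF f_cont])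
  define S where "S = (\<Union>i\<in>I. B i \<inter> X1)"
  have clBX: "closedin X (B i \<inter> X1)" if "i \<in> I" for i using B[OF that] X1(1) by (rule closedin_Int)
  have clS: "closedin X S"
    unfolding S_def using fin clBX by (intro closedin_Union) auto
  have SX: "S \<subseteq> topspace X" using clS closedin_subset by blast
  obtain g where g: "continuous_map (subtopology X S) K g"
    "\<And>x i. i \<in> I \<Longrightarrow> x \<in> topspace (subtopology X S) \<inter> (B i \<inter> X1) \<Longrightarrow> g x = p i x"
  proof (rule pasting_lemma_exists_closed[OF fin, of "subtopology X S" "\<lambda>i. B i \<inter> X1" K p])
    show "topspace (subtopology X S) \<subseteq> \<Union> ((\<lambda>i. B i \<inter> X1) ` I)"
      by (auto simp: S_def)
    show "closedin (subtopology X S) (B i \<inter> X1)" if "i \<in> I" for i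
      using clBX[OF that] that by (auto intro!: closedin_subset_topspace simp: S_def)
    show "continuous_map (subtopology (subtopology X S) (B i \<inter> X1)) K (p i)" if "i \<in> I" for i
    proof -
      have "S \<inter> (B i \<inter> X1) \<subseteq> B i \<inter> pre T" using X1(2) by blast
      from continuous_map_from_subtopology_mono[OF p[OF that] this] show ?thesis
        by (simp add: subtopology_subtopology)
    qed
    show "p i x = p j x" if "i \<in> I" "j \<in> I" "x \<in> topspace (subtopology X S) \<inter> (B i \<inter> X1) \<inter> (B j \<inter> X1)" for i j x
      using that eq[of i j x] X1(2) by blast
  qed (rule that)
  have gS: "g x = p i x" if "i \<in> I" "x \<in> B i" "x \<in> X1" for i x
    using that SX g(2)[of i x] by (auto simp: S_def)
  define F where "F = {x \<in> topspace X. f x = y}"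
  have F: "closedin X F"
    using closedin_continuous_map_preimage[OF f_cont, of "{y}"] Y_T1 yY by (simp add: F_def t1_space_closedin_singleton)
  have "closedin (subtopology X F) (F \<inter> S)" using clS by (auto simp: closedin_subtopology)
  moreover have "continuous_map (subtopology (subtopology X F) (F \<inter> S)) K g"
    using continuous_map_from_subtopology_mono[OF g(1), of "F \<inter> (F \<inter> S)"] by (auto simp: subtopology_subtopology)
  ultimately obtain eF where eF: "continuous_map (subtopology X F) K eF" "\<And>x. x \<in> F \<inter> S \<Longrightarrow> eF x = g x"
    using fibres[OF yY, folded F_def, unfolded abs_extensor_def, THEN spec[of _ "F \<inter> S"], THEN spec[of _ g]]
    by blast
  obtain g' where g': "continuous_map (subtopology X (S \<union> F)) K g'"
    "\<And>x. x \<in> S \<Longrightarrow> g' x = g x" "\<And>x. x \<in> F \<Longrightarrow> g' x = eF x"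
    by (rule pasting_two_closed[OF clS F g(1) eF(1)]) (use eF(2) in \<open>auto intro: that\<close>)
  obtain N U h where N: "closedin X N" "openin X U" "S \<union> F \<subseteq> U" "U \<subseteq> N"
    "continuous_map (subtopology X N) K h" "\<And>x. x \<in> S \<union> F \<Longrightarrow> h x = g' x"
    by (rule abs_nbhd_extensorE[OF K_ane closedin_Un[OF clS F] g'(1)]) (rule that)
  have "{x \<in> topspace X. f x = y} \<subseteq> U" using N(3) by (auto simp: F_def)
  then have U: "openin X U \<and> y \<in> topspace Y \<and> {x \<in> topspace X. f x = y} \<subseteq> U"
    using N(2) yY by blast
  obtain T2 where T2: "openin Y T2" "y \<in> T2" "pre T2 \<subseteq> U"
    using f_closed[unfolded closed_map_fibre_neighbourhood, THEN conjunct2, THEN spec[of _ U], THEN spec[of _ y],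
      THEN mp, OF U] by (elim exE conjE)
  have T1c: "T1 \<subseteq> Y closure_of T1" by (rule closure_of_subset[OF openin_subset[OF T1(1)]])
  show thesis
  proof (rule that)
    show "openin Y (T1 \<inter> T2)" "y \<in> T1 \<inter> T2" using T1 T2 by auto
    show "T1 \<inter> T2 \<subseteq> T" using T1(3) T1c by blast
    show "continuous_map (subtopology X (pre (T1 \<inter> T2))) K h"
      by (rule continuous_map_from_subtopology_mono[OF N(5)]) (use T2(3) N(4) in auto)
    show "h x = p i x" if "i \<in> I" "x \<in> B i" "x \<in> pre (T1 \<inter> T2)" for i x
    proof -
      have "x \<in> X1" using that(3) T1c by (auto simp: X1_def)
      moreover from this have "x \<in> S" using that by (auto simp: S_def)
      ultimately show ?thesis using N(6) g'(2) gS that by auto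
    qed
  qed
qed

text \<open>An index \<open>a\<close> records, for some of the levels below \<open>l\<close>, one member of the cover of that level.\<close>

definition admissible :: "nat \<Rightarrow> (nat \<Rightarrow> 'y set set) \<Rightarrow> (nat \<Rightarrow> 'y set option) \<Rightarrow> bool" where
  "admissible l \<W> a \<longleftrightarrow> (\<forall>i W. a i = Some W \<longrightarrow> i < l \<and> W \<in> \<W> i)"

text \<open>The two conditions anticipate the values of the levels. Where \<open>w i\<close> is 2/3,
  a map of a later stage must equal the map of stage \<open>i\<close> for the truncated index; where
  \<open>w i\<close> is 1/3, the member recorded for stage \<open>i\<close> may be forgotten, since
  it ceases to be selected there. The thresholds differ, so the two demands for one \<open>i\<close>
  never meet at a point.\<close>

definition compatible ::
  "(nat \<Rightarrow> 'y set \<Rightarrow> (nat \<Rightarrow> 'y set option) \<Rightarrow> 'x \<Rightarrow> 'k) \<Rightarrow> 'y set \<Rightarrow>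
    ((nat \<Rightarrow> 'y set option) \<Rightarrow> 'x \<Rightarrow> 'k) \<Rightarrow> (nat \<Rightarrow> 'y set option) \<Rightarrow> bool" where
  "compatible E S e a \<longleftrightarrow> continuous_map (subtopology X (pre S)) K (e a) \<and>
     (\<forall>x\<in>pre S. (x \<in> A0 \<longrightarrow> e a x = g0 x) \<and>
        (\<forall>i W. a i = Some W \<longrightarrow>
           ((\<forall>j V. a j = Some V \<longrightarrow> f x \<in> Y closure_of V) \<and> 2/3 \<le> u i x \<longrightarrow> e a x = E i W (a |` {..<i}) x) \<and>
           (u i x \<le> 1/3 \<longrightarrow> e a x = e (a(i := None)) x)))"

text \<open>The maps are controlled over closures of members, so that agreement with them can be
  prescribed on closed sets when later levels are built.\<close>

definition level :: "nat \<Rightarrow> (nat \<Rightarrow> 'y set set) \<Rightarrow>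
    (nat \<Rightarrow> 'y set \<Rightarrow> (nat \<Rightarrow> 'y set option) \<Rightarrow> 'x \<Rightarrow> 'k) \<Rightarrow> bool" where
  "level l \<W> E \<longleftrightarrow> open_cover Y (\<W> l) \<and> locally_finite_in Y (\<W> l) \<and>
     (\<forall>W\<in>\<W> l. \<forall>a. admissible l \<W> a \<longrightarrow> compatible E (Y closure_of W) (E l W) a)"

lemma compatibleD:
  assumes "compatible E S e a"
  shows "continuous_map (subtopology X (pre S)) K (e a)"
    and "x \<in> pre S \<Longrightarrow> x \<in> A0 \<Longrightarrow> e a x = g0 x"
    and "x \<in> pre S \<Longrightarrow> a i = Some W \<Longrightarrow> (\<And>j V. a j = Some V \<Longrightarrow> f x \<in> Y closure_of V) \<Longrightarrow> 2/3 \<le> u i x \<Longrightarrow>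
      e a x = E i W (a |` {..<i}) x"
    and "x \<in> pre S \<Longrightarrow> a i = Some W \<Longrightarrow> u i x \<le> 1/3 \<Longrightarrow> e a x = e (a(i := None)) x"
  using assms unfolding compatible_def by blast+

lemma compatible_subset:
  assumes "compatible E S e a" "S' \<subseteq> S" "e' a = e a" "\<And>i W. a i = Some W \<Longrightarrow> e' (a(i := None)) = e (a(i := None))"
  shows "compatible E S' e' a"
proof -
  have sub: "pre S' \<subseteq> pre S" using assms(2) by blast
  show ?thesis
    unfolding compatible_def
  proof (intro conjI ballI allI impI)
    show "continuous_map (subtopology X (pre S')) K (e' a)"
      unfolding assms(3) by (rule continuous_map_from_subtopology_mono[OF compatibleD(1)[OF assms(1)] sub])
  qed (use sub assms(3,4) compatibleD(2-4)[OF assms(1)] in auto)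
qed

lemma admissible_restrict: "admissible l \<W> a \<Longrightarrow> admissible i \<W> (a |` {..<i})"
  by (auto simp: admissible_def restrict_map_def split: if_splits)

lemma admissible_drop: "admissible l \<W> a \<Longrightarrow> admissible l \<W> (a(i := None))"
  by (auto simp: admissible_def split: if_splits)

lemma finite_dom_admissible: "admissible l \<W> a \<Longrightarrow> finite (dom a)"
  by (rule finite_subset[of _ "{..<l}"]) (auto simp: admissible_def dom_def)

lemma locally_finite_closure_nbhd:
  assumes "locally_finite_in Y \<W>" "y \<in> topspace Y"
  obtains T where "openin Y T" "y \<in> T" "finite {W\<in>\<W>. y \<in> Y closure_of W}"
    "\<And>W. W \<in> \<W> \<Longrightarrow> Y closure_of W \<inter> T \<noteq> {} \<Longrightarrow> y \<in> Y closure_of W"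
proof -
  obtain V where V: "openin Y V" "y \<in> V" "finite {W\<in>\<W>. W \<inter> V \<noteq> {}}"
    using assms unfolding locally_finite_in_def by blast
  have meet: "W \<inter> V \<noteq> {}" if "Y closure_of W \<inter> V \<noteq> {}" for W
    using openin_Int_closure_of_eq_empty[OF V(1)] that by blast
  define T where "T = V - \<Union>((closure_of) Y ` {W\<in>{W\<in>\<W>. W \<inter> V \<noteq> {}}. y \<notin> Y closure_of W})"
  show thesis
  proof
    have "finite ((closure_of) Y ` {W\<in>{W\<in>\<W>. W \<inter> V \<noteq> {}}. y \<notin> Y closure_of W})"
      by (intro finite_imageI finite_Collect_conjI disjI1) (simp add: V(3))
    then show "openin Y T"
      unfolding T_def using V(1) by (intro openin_diff closedin_Union) auto
    show "y \<in> T" using V by (auto simp: T_def)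
    show "finite {W\<in>\<W>. y \<in> Y closure_of W}"
      by (rule finite_subset[OF _ V(3)]) (use meet V(2) in blast)
    show "y \<in> Y closure_of W" if "W \<in> \<W>" "Y closure_of W \<inter> T \<noteq> {}" for W
    proof (rule ccontr)
      assume n: "y \<notin> Y closure_of W"
      have "W \<inter> V \<noteq> {}" using meet that(2) by (auto simp: T_def)
      then have "Y closure_of W \<inter> T = {}" using that(1) n by (auto simp: T_def)
      then show False using that(2) by blast
    qed
  qed
qed

text \<open>Every condition on the new map \<open>e'\<close> prescribes it on a closed set:
  \<open>g0\<close> on \<open>A0\<close>, an earlier map where \<open>u i x \<ge> 2/3\<close>, the
  map of a shorter index where \<open>u i x \<le> 1/3\<close>. These prescriptions agree pairwise
  because the maps they name already satisfy the same conditions.\<close>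

lemma local_step:
  assumes lev: "\<And>j. j < l \<Longrightarrow> level j \<W> E" and lm: "l \<le> m"
    and y: "openin Y T" "y \<in> T"
    and a: "admissible l \<W> a" 
    and e: "\<And>i W. a i = Some W \<Longrightarrow> compatible E T e (a(i := None))"
  obtains T' e' where "openin Y T'" "y \<in> T'" "T' \<subseteq> T" "compatible E T' (e(a := e')) a"
proof -
  \<comment> \<open>The first condition is demanded only over points in the closures of all recorded
    members; there all earlier maps named by \<open>a\<close> are controlled.\<close>
  define R where "R = pre (topspace Y \<inter> (\<Inter>V\<in>ran a. Y closure_of V))"
  have R: "closedin X R"
  proof -
    have "closedin Y (\<Inter>(insert (topspace Y) ((closure_of) Y ` ran a)))"
      by (intro closedin_Inter) auto
    then have "closedin Y (topspace Y \<inter> (\<Inter>V\<in>ran a. Y closure_of V))"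
      by (simp only: Inter_insert)
    then show ?thesis
      unfolding R_def by (rule closedin_continuous_map_preimage[OF f_cont])
  qed
  have RD: "f x \<in> Y closure_of V" if "x \<in> R" "a j = Some V" for x j V
    using that by (auto simp: R_def ran_def)
  define I where "I = insert None (Some ` (dom a \<times> (UNIV :: bool set)))"
  define B where "B k = (case k of None \<Rightarrow> A0 | Some (i, True) \<Rightarrow> R \<inter> {x\<in>topspace X. 2/3 \<le> u i x}
      | Some (i, False) \<Rightarrow> {x\<in>topspace X. u i x \<le> 1/3})" for k
  define p where "p k = (case k of None \<Rightarrow> g0 | Some (i, True) \<Rightarrow> E i (the (a i)) (a |` {..<i})
      | Some (i, False) \<Rightarrow> e (a(i := None)))" for k
  have il: "i < l" "i < m" "W \<in> \<W> i" if "a i = Some W" for i W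
    using a[unfolded admissible_def, rule_format, OF that] lm by auto
  have Ii: "k \<in> I \<Longrightarrow> k = None \<or> (\<exists>i W. a i = Some W \<and> (k = Some (i, True) \<or> k = Some (i, False)))" for k
    by (auto simp: I_def)
  have comp: "compatible E (Y closure_of W) (E i W) (a |` {..<i})" if "a i = Some W" for i W
    using lev[OF il(1)[OF that]] il(3)[OF that] admissible_restrict[OF a] unfolding level_def by blast
  have cB: "closedin X (B k)" if "k \<in> I" for k
  proof -
    have "closedin X {x\<in>topspace X. 2/3 \<le> u i x}" "closedin X {x\<in>topspace X. u i x \<le> 1/3}" if "i < m" for i
      using closedin_le_continuous_maps[of X "\<lambda>x. 2/3" "u i"] closedin_le_continuous_maps[of X "u i" "\<lambda>x. 1/3"] u[OF that]
      by simp_all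
    then show ?thesis using Ii[OF that] A0 R il(2) by (auto simp: B_def intro!: closedin_Int)
  qed
  have cp: "continuous_map (subtopology X (B k \<inter> pre T)) K (p k)" if "k \<in> I" for k
    using Ii[OF that]
  proof (elim disjE exE conjE)
    assume "k = None"
    then show ?thesis
      using continuous_map_from_subtopology_mono[OF g0, of "A0 \<inter> pre T"] by (auto simp: B_def p_def)
  next
    fix i W assume i: "a i = Some W" "k = Some (i, True)"
    have "R \<subseteq> pre (Y closure_of W)" using RD[OF _ i(1)] by (auto simp: R_def)
    then show ?thesis
      using continuous_map_from_subtopology_mono[OF compatibleD(1)[OF comp[OF i(1)]], of "B k \<inter> pre T"] i
      by (auto simp: B_def p_def)
  next
    fix i W assume i: "a i = Some W" "k = Some (i, False)"
    then show ?thesis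
      using continuous_map_from_subtopology_mono[OF compatibleD(1)[OF e[OF i(1)]], of "B k \<inter> pre T"]
      by (auto simp: B_def p_def)
  qed
  have g0E: "E i W (a |` {..<i}) x = g0 x" if "a i = Some W" "x \<in> R" "x \<in> A0" for i W x
  proof (rule compatibleD(2)[OF comp[OF that(1)]])
    show "x \<in> pre (Y closure_of W)" using RD[OF that(2,1)] that(2) by (simp add: R_def)
  qed (rule that(3))
  have g0e: "e (a(i := None)) x = g0 x" if "a i = Some W" "x \<in> pre T" "x \<in> A0" for i W x
    by (rule compatibleD(2)[OF e[OF that(1)] that(2,3)])
  \<comment> \<open>The map of the higher of two levels was itself built to agree with that of the
    lower one, and truncating twice is truncating at the smaller level.\<close>
  have EE: "E i W (a |` {..<i}) x = E j V (a |` {..<j}) x"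
    if ij: "a i = Some W" "a j = Some V" "j < i" "x \<in> R" "2/3 \<le> u j x" for i W j V x
  proof -
    have "E i W (a |` {..<i}) x = E j V ((a |` {..<i}) |` {..<j}) x"
    proof (rule compatibleD(3)[OF comp[OF ij(1)]])
      show "x \<in> pre (Y closure_of W)" using RD[OF ij(4,1)] ij(4) by (auto simp: R_def)
      show "(a |` {..<i}) j = Some V" using ij by simp
      show "f x \<in> Y closure_of V'" if "(a |` {..<i}) j' = Some V'" for j' V'
        using RD[OF ij(4), of j' V'] that by (auto simp: restrict_map_def split: if_splits)
    qed (use ij in simp)
    also have "(a |` {..<i}) |` {..<j} = a |` {..<j}"
      using ij(3) by (simp add: Int_absorb1)
    finally show ?thesis .
  qed
  have Ee: "e (a(j := None)) x = E i W (a |` {..<i}) x"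
    if ij: "a i = Some W" "a j = Some V" "x \<in> R" "x \<in> pre T" "2/3 \<le> u i x" "u j x \<le> 1/3" for i W j V x
  proof -
    have ne: "i \<noteq> j" using ij by auto
    \<comment> \<open>The shorter index still records \<open>W\<close> at level \<open>i\<close>, so
      its map agrees with one of level \<open>i\<close>; in the index of the latter the entry
      \<open>j\<close> is either truncated away or may be dropped because
      \<open>u j x \<le> 1/3\<close>.\<close>
    have "e (a(j := None)) x = E i W (a(j := None) |` {..<i}) x"
    proof (rule compatibleD(3)[OF e[OF ij(2)] ij(4)])
      show "(a(j := None)) i = Some W" using ij ne by simp
      show "f x \<in> Y closure_of V'" if "(a(j := None)) j' = Some V'" for j' V'
        using RD[OF ij(3), of j' V'] that by (auto split: if_splits)
    qed (use ij in simp)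
    also have "\<dots> = E i W (a |` {..<i}) x"
    proof (cases "j < i")
      case True
      have "E i W (a |` {..<i}) x = E i W ((a |` {..<i})(j := None)) x"
        by (rule compatibleD(4)[OF comp[OF ij(1)]])
          (use ij True RD[OF ij(3,1)] in \<open>auto simp: R_def\<close>)
      moreover have "(a |` {..<i})(j := None) = a(j := None) |` {..<i}"
        by (auto simp: restrict_map_def)
      ultimately show ?thesis by simp
    next
      case False
      then have "a(j := None) |` {..<i} = a |` {..<i}" by (auto simp: restrict_map_def)
      then show ?thesis by simp
    qed
    finally show ?thesis .
  qed
  have ee: "e (a(i := None)) x = e (a(j := None)) x"
    if ij: "a i = Some W" "a j = Some V" "x \<in> pre T" "u i x \<le> 1/3" "u j x \<le> 1/3" for i W j V x
  proof (cases "i = j")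
    case False
    \<comment> \<open>Both maps equal that of the index with the two entries dropped.\<close>
    have "e (a(i := None)) x = e (a(i := None, j := None)) x"
      by (rule compatibleD(4)[OF e[OF ij(1)] ij(3)]) (use ij False in auto)
    moreover have "e (a(j := None)) x = e (a(j := None, i := None)) x"
      by (rule compatibleD(4)[OF e[OF ij(2)] ij(3)]) (use ij False in auto)
    ultimately show ?thesis using False by (simp add: fun_upd_twist)
  qed simp
  have agree: "p k x = p k' x" if k: "k \<in> I" "k' \<in> I" and x: "x \<in> B k" "x \<in> B k'" "x \<in> pre T" for k k' x
  proof -
    have sym: "p k x = p k' x"
      if "k = None" "k' \<in> I" "x \<in> B k" "x \<in> B k'" for k k'
      using Ii[OF that(2)] that(1,3,4) g0E[of _ _ x] g0e[of _ _ x] x(3) by (auto simp: B_def p_def)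
    have EE': "E i W (a |` {..<i}) x = E j V (a |` {..<j}) x"
      if "a i = Some W" "a j = Some V" "x \<in> R" "2/3 \<le> u i x" "2/3 \<le> u j x" for i W j V
    proof -
      consider "i = j" | "j < i" | "i < j" by linarith
      then show ?thesis
      proof cases
        case 1
        then show ?thesis using that by simp
      next
        case 2
        then show ?thesis using EE[of i W j V x] that by simp
      next
        case 3
        then show ?thesis using EE[of j V i W x] that by simp
      qed
    qed
    show ?thesis
    proof (cases "k = None \<or> k' = None")
      case True
      then show ?thesis
      proof
        assume "k = None"
        then show ?thesis by (rule sym) (rule k x)+
      next
        assume "k' = None"
        then show ?thesis by (rule sym[symmetric]) (rule k x)+
      qed
    next
      case False
      obtain i W b where i: "a i = Some W" "k = Some (i, b)" using Ii[OF k(1)] False by auto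
      obtain j V b' where j: "a j = Some V" "k' = Some (j, b')" using Ii[OF k(2)] False by auto
      show ?thesis
      proof (cases b; cases b')
        assume b: "b" "b'"
        then have "E i W (a |` {..<i}) x = E j V (a |` {..<j}) x"
          using x i j by (intro EE') (simp_all add: B_def)
        then show ?thesis using i j b by (simp add: p_def)
      next
        assume b: "b" "\<not> b'"
        then have "e (a(j := None)) x = E i W (a |` {..<i}) x"
          using x i j by (intro Ee) (simp_all add: B_def)
        then show ?thesis using i j b by (simp add: p_def)
      next
        assume b: "\<not> b" "b'"
        then have "e (a(i := None)) x = E j V (a |` {..<j}) x"
          using x i j by (intro Ee) (simp_all add: B_def)
        then show ?thesis using i j b by (simp add: p_def)
      next
        assume b: "\<not> b" "\<not> b'"
        then have "e (a(i := None)) x = e (a(j := None)) x"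
          using x i j by (intro ee) (simp_all add: B_def)
        then show ?thesis using i j b by (simp add: p_def)
      qed
    qed
  qed
  have finI: "finite I" using finite_dom_admissible[OF a] by (auto simp: I_def)
  obtain T' e' where T': "openin Y T'" "y \<in> T'" "T' \<subseteq> T" "continuous_map (subtopology X (pre T')) K e'"
    "\<And>k x. k \<in> I \<Longrightarrow> x \<in> B k \<Longrightarrow> x \<in> pre T' \<Longrightarrow> e' x = p k x"
    by (rule local_extension[OF y finI cB cp agree]) (assumption+, rule that)
  have "compatible E T' (e(a := e')) a"
    unfolding compatible_def
  proof (intro conjI ballI allI impI)
    show "continuous_map (subtopology X (pre T')) K ((e(a := e')) a)" using T'(4) by simp
    fix x assume x: "x \<in> pre T'"
    show "(e(a := e')) a x = g0 x" if "x \<in> A0"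
      using T'(5)[of None x] that x by (simp add: I_def B_def p_def)
    fix i W assume i: "a i = Some W"
    show "(e(a := e')) a x = E i W (a |` {..<i}) x"
      if "(\<forall>j V. a j = Some V \<longrightarrow> f x \<in> Y closure_of V) \<and> 2/3 \<le> u i x"
    proof -
      have "x \<in> R" using that x fX by (auto simp: R_def ran_def)
      then have "x \<in> B (Some (i, True))" using that x by (simp add: B_def)
      moreover have "Some (i, True) \<in> I" using i by (auto simp: I_def)
      ultimately show ?thesis using T'(5)[of "Some (i, True)" x] x i by (simp add: p_def)
    qed
    show "(e(a := e')) a x = (e(a := e')) (a(i := None)) x" if "u i x \<le> 1/3"
    proof -
      have "x \<in> B (Some (i, False))" using that x by (simp add: B_def)
      moreover have "Some (i, False) \<in> I" using i by (auto simp: I_def)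
      moreover have "a(i := None) \<noteq> a" using i by (metis fun_upd_same option.distinct(1))
      ultimately show ?thesis using T'(5)[of "Some (i, False)" x] x i by (simp add: p_def)
    qed
  qed
  then show thesis using T' that by blast
qed

lemma finite_indices:
  fixes l :: nat
  assumes "\<And>i. i < l \<Longrightarrow> finite (S i)"
  shows "finite {a. \<forall>i W. a i = Some W \<longrightarrow> i < l \<and> W \<in> S i}"
proof (rule finite_subset)
  show "finite {a. \<forall>i. (i \<in> {..<l} \<longrightarrow> a i \<in> insert None (Some ` (\<Union>i<l. S i))) \<and> (i \<notin> {..<l} \<longrightarrow> a i = None)}"
    by (rule finite_set_of_finite_funs) (use assms in auto)
  show "{a. \<forall>i W. a i = Some W \<longrightarrow> i < l \<and> W \<in> S i} \<subseteq>
    {a. \<forall>i. (i \<in> {..<l} \<longrightarrow> a i \<in> insert None (Some ` (\<Union>i<l. S i))) \<and> (i \<notin> {..<l} \<longrightarrow> a i = None)}"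
  proof (intro subsetI CollectI allI conjI impI)
    fix a i assume "a \<in> {a. \<forall>i W. a i = Some W \<longrightarrow> i < l \<and> W \<in> S i}"
    then have a: "\<And>i W. a i = Some W \<Longrightarrow> i < l \<and> W \<in> S i" by blast
    show "a i \<in> insert None (Some ` (\<Union>i<l. S i))" using a[of i] by (cases "a i") auto
    show "a i = None" if "i \<notin> {..<l}" using a[of i] that by (cases "a i") auto
  qed
qed

text \<open>Near \<open>y\<close> only members whose closures contain \<open>y\<close> count,
  finitely many by local finiteness. So finitely many indices have to be treated, in order of
  increasing number of entries, shrinking the neighbourhood each time.\<close>

lemma local_family:
  assumes lev: "\<And>j. j < l \<Longrightarrow> level j \<W> E" and lm: "l \<le> m" and y: "y \<in> topspace Y"
  obtains T e where "openin Y T" "y \<in> T" "\<And>a. admissible l \<W> a \<Longrightarrow> compatible E T e a"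
proof -
  define P where "P i T \<longleftrightarrow> openin Y T \<and> y \<in> T \<and> finite {W\<in>\<W> i. y \<in> Y closure_of W} \<and>
      (\<forall>W. W \<in> \<W> i \<longrightarrow> Y closure_of W \<inter> T \<noteq> {} \<longrightarrow> y \<in> Y closure_of W)" for i T
  have "\<exists>T. P i T" if "i < l" for i
  proof -
    have "locally_finite_in Y (\<W> i)" using lev[OF that] by (simp add: level_def)
    then show ?thesis unfolding P_def by (rule locally_finite_closure_nbhd[OF _ y]) blast
  qed
  then obtain Ti where "\<And>i. i < l \<Longrightarrow> P i (Ti i)" by metis
  then have Ti: "\<And>i. i < l \<Longrightarrow> openin Y (Ti i)" "\<And>i. i < l \<Longrightarrow> y \<in> Ti i"
      "\<And>i. i < l \<Longrightarrow> finite {W\<in>\<W> i. y \<in> Y closure_of W}"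
      "\<And>i W. i < l \<Longrightarrow> W \<in> \<W> i \<Longrightarrow> Y closure_of W \<inter> Ti i \<noteq> {} \<Longrightarrow> y \<in> Y closure_of W"
    unfolding P_def by blast+
  define T0 where "T0 = \<Inter>(insert (topspace Y) (Ti ` {..<l}))"
  have T0: "openin Y T0"
    unfolding T0_def by (rule openin_Inter) (use Ti(1) in auto)
  have T0': "y \<in> T0" "\<And>i. i < l \<Longrightarrow> T0 \<subseteq> Ti i"
    unfolding T0_def using Ti(2) y by auto
  define adm where "adm a \<longleftrightarrow> admissible l \<W> a \<and> (\<forall>i W. a i = Some W \<longrightarrow> y \<in> Y closure_of W)" for a
  have fin: "finite {a. adm a}"
  proof (rule finite_subset[OF _ finite_indices])
    show "finite {W\<in>\<W> i. y \<in> Y closure_of W}" if "i < l" for i using Ti(3)[OF that] .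
  qed (auto simp: adm_def admissible_def)
  have drop: "adm (a(i := None))" if "adm a" for a i
    using that admissible_drop[of l \<W> a i] by (auto simp: adm_def split: if_splits)
  have cd: "card (dom (a(i := None))) < card (dom a)" if "adm a" "a i = Some W" for a i W
    using that finite_dom_admissible[of l \<W> a] by (intro psubset_card_mono) (auto simp: adm_def)
  have all: "\<exists>T e. openin Y T \<and> y \<in> T \<and> T \<subseteq> T0 \<and> (\<forall>a. adm a \<and> card (dom a) < n \<longrightarrow> compatible E T e a)" for n
  proof (induction n)
    case 0
    then show ?case using T0 T0'(1) by auto
  next
    case (Suc n)
    then obtain T e where Te: "openin Y T" "y \<in> T" "T \<subseteq> T0"
      "\<And>a. adm a \<Longrightarrow> card (dom a) < n \<Longrightarrow> compatible E T e a" by blast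
    have finn: "finite {a. adm a \<and> card (dom a) = n}" by (rule finite_subset[OF _ fin]) auto
    have "\<exists>T e. openin Y T \<and> y \<in> T \<and> T \<subseteq> T0 \<and>
       (\<forall>a. adm a \<and> card (dom a) < n \<or> a \<in> F \<longrightarrow> compatible E T e a)"
      if "finite F" "F \<subseteq> {a. adm a \<and> card (dom a) = n}" for F
      using that
    proof (induction F rule: finite_induct)
      case empty
      then show ?case using Te by blast
    next
      case (insert a F)
      obtain T e where Te: "openin Y T" "y \<in> T" "T \<subseteq> T0"
        "\<And>a. adm a \<and> card (dom a) < n \<or> a \<in> F \<Longrightarrow> compatible E T e a"
        using insert.IH insert.prems by blast
      have a: "adm a" "card (dom a) = n" using insert.prems by auto
      obtain T' e' where T': "openin Y T'" "y \<in> T'" "T' \<subseteq> T" "compatible E T' (e(a := e')) a"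
      proof (rule local_step[OF lev lm Te(1,2)])
        show "admissible l \<W> a" using a by (simp add: adm_def)
        show "compatible E T e (a(i := None))" if "a i = Some W" for i W
          using Te(4)[of "a(i := None)"] drop[OF a(1)] cd[OF a(1) that] a(2) by simp
      qed (assumption, rule that)
      have "compatible E T' (e(a := e')) b" if b: "adm b \<and> card (dom b) < n \<or> b \<in> insert a F" for b
      proof (cases "b = a")
        case True
        then show ?thesis using T'(4) by simp
      next
        case False
        then have b': "adm b" "card (dom b) \<le> n" "compatible E T e b"
          using b insert.prems Te(4)[of b] by auto
        show ?thesis
        proof (rule compatible_subset[OF b'(3) T'(3)])
          show "(e(a := e')) b = e b" using False by simp
          \<comment> \<open>A shortened \<open>b\<close> has fewer than \<open>n\<close> entries, so
            it is not \<open>a\<close> and its map is unchanged.\<close>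
          show "(e(a := e')) (b(i := None)) = e (b(i := None))" if "b i = Some W" for i W
            using cd[OF b'(1) that] b'(2) a(2) by auto
        qed
      qed
      then show ?case using T'(1,2,3) Te(3) by blast
    qed
    from this[OF finn order_refl] obtain T e where "openin Y T" "y \<in> T" "T \<subseteq> T0"
      "\<And>a. adm a \<and> card (dom a) < n \<or> a \<in> {a. adm a \<and> card (dom a) = n} \<Longrightarrow> compatible E T e a"
      by blast
    then show ?case by (metis (mono_tags, lifting) less_Suc_eq mem_Collect_eq)
  qed
  obtain T e where Te: "openin Y T" "y \<in> T" "T \<subseteq> T0"
      "\<And>a. adm a \<Longrightarrow> card (dom a) < Suc l \<Longrightarrow> compatible E T e a"
    using all[of "Suc l"] by blast
  have Te': "compatible E T e a" if "adm a" for a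
  proof (rule Te(4)[OF that])
    have "dom a \<subseteq> {..<l}" using that by (auto simp: adm_def admissible_def)
    then show "card (dom a) < Suc l" using card_mono[of "{..<l}" "dom a"] by simp
  qed
  \<comment> \<open>An arbitrary admissible index uses the map of its reduction to members with
    \<open>y\<close> in their closure. If an entry is erased, the first condition is void over
    \<open>T\<close>, no point of which lies in the closure of that member; otherwise the reduction
    changes nothing.\<close>
  define red where "red a i = (case a i of None \<Rightarrow> None | Some W \<Rightarrow> if y \<in> Y closure_of W then Some W else None)"
    for a :: "nat \<Rightarrow> 'y set option" and i
  have red: "adm (red a)" if "admissible l \<W> a" for a
    using that by (auto simp: adm_def admissible_def red_def split: option.splits if_splits)
  have "compatible E T (\<lambda>a. e (red a)) a" if a: "admissible l \<W> a" for a
    unfolding compatible_def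
  proof (intro conjI ballI allI impI)
    note c = Te'[OF red[OF a]]
    show "continuous_map (subtopology X (pre T)) K (e (red a))" by (rule compatibleD(1)[OF c])
    fix x assume x: "x \<in> pre T"
    show "e (red a) x = g0 x" if "x \<in> A0" by (rule compatibleD(2)[OF c x that])
    fix i W assume i: "a i = Some W"
    show "e (red a) x = E i W (a |` {..<i}) x"
      if h: "(\<forall>j V. a j = Some V \<longrightarrow> f x \<in> Y closure_of V) \<and> 2/3 \<le> u i x"
    proof -
      have "y \<in> Y closure_of V" if j: "a j = Some V" for j V
      proof -
        have jl: "j < l" "V \<in> \<W> j" using a j by (auto simp: admissible_def)
        have "f x \<in> Y closure_of V \<inter> Ti j" using h j x Te(3) T0'(2)[OF jl(1)] by blast
        then show ?thesis using Ti(4)[OF jl] by blast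
      qed
      then have "red a = a" by (intro ext) (auto simp: red_def split: option.splits)
      then show ?thesis using compatibleD(3)[OF c x, of i W] i h by auto
    qed
    show "e (red a) x = e (red (a(i := None))) x" if h: "u i x \<le> 1/3"
    proof -
      have eq: "red (a(i := None)) = (red a)(i := None)" by (intro ext) (auto simp: red_def)
      show ?thesis
      proof (cases "red a i")
        case None
        then show ?thesis unfolding eq by (simp add: fun_upd_idem)
      next
        case (Some V)
        then show ?thesis unfolding eq by (rule compatibleD(4)[OF c x _ h])
      qed
    qed
  qed
  then show thesis using that Te(1,2) by blast
qed

section \<open>Building the levels one after another\<close>

lemma admissible_cong:
  assumes "\<And>i. i < l \<Longrightarrow> \<W> i = \<W>' i"
  shows "admissible l \<W> a \<longleftrightarrow> admissible l \<W>' a"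
  using assms unfolding admissible_def by blast

lemma compatible_cong:
  assumes "\<And>i W. a i = Some W \<Longrightarrow> E i = E' i"
  shows "compatible E S e a \<longleftrightarrow> compatible E' S e a"
  unfolding compatible_def by (intro conj_cong ball_cong all_cong refl imp_cong) (simp_all add: assms)

text \<open>The conditions at level \<open>l\<close> mention only data up to \<open>l\<close>, so
  adding a further level preserves those already built.\<close>

lemma level_cong:
  assumes "\<And>i. i \<le> l \<Longrightarrow> \<W> i = \<W>' i" "\<And>i. i \<le> l \<Longrightarrow> E i = E' i"
  shows "level l \<W> E \<longleftrightarrow> level l \<W>' E'"
proof -
  have 1: "admissible l \<W> a \<longleftrightarrow> admissible l \<W>' a" for a
    by (rule admissible_cong) (use assms in auto)
  have 2: "compatible E S e a \<longleftrightarrow> compatible E' S e a" if "admissible l \<W>' a" for S e a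
    using that by (intro compatible_cong assms(2)) (auto simp: admissible_def intro: less_imp_le)
  show ?thesis
    unfolding level_def using assms[of l] 1 2 by auto
qed

lemma discrete_family_imp_locally_finite:
  fixes n :: nat
  assumes "\<And>i. i \<le> n \<Longrightarrow> discrete_family Y (\<V> i)" "\<And>i V. V \<in> \<V> i \<Longrightarrow> openin Y V"
  shows "locally_finite_in Y (\<Union>i\<le>n. \<V> i)"
  unfolding locally_finite_in_def
proof (intro conjI ballI)
  show "\<Union>(\<Union>i\<le>n. \<V> i) \<subseteq> topspace Y" using assms(2) openin_subset by blast
  fix y assume y: "y \<in> topspace Y"
  define P where "P i N \<longleftrightarrow> openin Y N \<and> y \<in> N \<and> (\<forall>V\<in>\<V> i. \<forall>V'\<in>\<V> i. V \<inter> N \<noteq> {} \<and> V' \<inter> N \<noteq> {} \<longrightarrow> V = V')"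
    for i N
  have "\<exists>N. P i N" if "i \<le> n" for i
    using assms(1)[OF that] y unfolding discrete_family_def P_def by blast
  then obtain N where "\<And>i. i \<le> n \<Longrightarrow> P i (N i)" by metis
  then have N: "\<And>i. i \<le> n \<Longrightarrow> openin Y (N i)" "\<And>i. i \<le> n \<Longrightarrow> y \<in> N i"
    "\<And>i V V'. i \<le> n \<Longrightarrow> V \<in> \<V> i \<Longrightarrow> V' \<in> \<V> i \<Longrightarrow> V \<inter> N i \<noteq> {} \<Longrightarrow> V' \<inter> N i \<noteq> {} \<Longrightarrow> V = V'"
    unfolding P_def by blast+
  let ?N = "\<Inter>(N ` {..n})"
  have fin: "finite {V\<in>\<V> i. V \<inter> ?N \<noteq> {}}" if "i \<le> n" for i
  proof (cases "{V\<in>\<V> i. V \<inter> ?N \<noteq> {}} = {}")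
    case False
    then obtain V where "V \<in> {V\<in>\<V> i. V \<inter> ?N \<noteq> {}}" by (meson ex_in_conv)
    then have V: "V \<in> \<V> i" "V \<inter> ?N \<noteq> {}" by simp_all
    have "{V\<in>\<V> i. V \<inter> ?N \<noteq> {}} \<subseteq> {V}"
      using N(3)[OF that _ V(1)] V(2) that by blast
    then show ?thesis using finite_subset by blast
  next
    case True
    then show ?thesis by (simp only: finite.emptyI)
  qed
  have "{V \<in> (\<Union>i\<le>n. \<V> i). V \<inter> ?N \<noteq> {}} = (\<Union>i\<le>n. {V\<in>\<V> i. V \<inter> ?N \<noteq> {}})" by blast
  moreover have "finite (\<Union>i\<le>n. {V\<in>\<V> i. V \<inter> ?N \<noteq> {}})"
    by (intro finite_UN_I) (use fin in auto)
  ultimately have "finite {V \<in> (\<Union>i\<le>n. \<V> i). V \<inter> ?N \<noteq> {}}" by simp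
  moreover have "openin Y ?N" using N(1) by (intro openin_Inter) auto
  moreover have "y \<in> ?N" using N(2) by blast
  ultimately show "\<exists>V. openin Y V \<and> y \<in> V \<and> finite {U \<in> (\<Union>i\<le>n. \<V> i). U \<inter> V \<noteq> {}}" by blast
qed

text \<open>Each point of \<open>Y\<close> has a compatible family over some \<open>T y\<close>. The
  sets \<open>T' y\<close> have closures inside \<open>T y\<close>, so that the family of the chosen
  centre \<open>c W\<close> stays valid over the closure of \<open>W\<close>.\<close>

lemma level_step:
  assumes lev: "\<And>j. j < l \<Longrightarrow> level j \<W> E" and lm: "l \<le> m"
  obtains Wl El where "level l (\<W>(l := Wl)) (E(l := El))"
proof -
  define P where "P y T e T' \<longleftrightarrow> (\<forall>a. admissible l \<W> a \<longrightarrow> compatible E T e a) \<and>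
      openin Y T' \<and> y \<in> T' \<and> Y closure_of T' \<subseteq> T" for y T e T'
  have "\<exists>T e T'. P y T e T'" if y: "y \<in> topspace Y" for y
  proof -
    obtain T e where T: "openin Y T" "y \<in> T" "\<And>a. admissible l \<W> a \<Longrightarrow> compatible E T e a"
      by (rule local_family[OF lev lm y]) (assumption, rule that)
    obtain T' where "openin Y T'" "y \<in> T'" "Y closure_of T' \<subseteq> T"
      by (rule closed_nbhd[OF T(1,2)]) (rule that)
    then show ?thesis using T(3) unfolding P_def by blast
  qed
  then obtain T e T' where "\<And>y. y \<in> topspace Y \<Longrightarrow> P y (T y) (e y) (T' y)" by metis
  then have T: "\<And>y. y \<in> topspace Y \<Longrightarrow> y \<in> T' y" "\<And>y. y \<in> topspace Y \<Longrightarrow> openin Y (T' y)"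
     "\<And>y. y \<in> topspace Y \<Longrightarrow> Y closure_of T' y \<subseteq> T y"
     "\<And>y a. y \<in> topspace Y \<Longrightarrow> admissible l \<W> a \<Longrightarrow> compatible E (T y) (e y) a"
    unfolding P_def by blast+
  have "open_cover Y (T' ` topspace Y)"
    using T(1,2) openin_subset by (fastforce simp: open_cover_def)
  then obtain \<V> where \<V>: "\<And>i V. V \<in> \<V> i \<Longrightarrow> openin Y V" "\<And>i. refines (\<V> i) (T' ` topspace Y)"
    "(\<Union>i\<le>m. \<Union>(\<V> i)) = topspace Y" "\<And>i. discrete_family Y (\<V> i)"
    by (rule discrete_coloured_refinement[OF Y_shrinkable Y_dim]) (rule that)
  define Wl where "Wl = (\<Union>i\<le>m. \<V> i)"
  have "\<exists>y\<in>topspace Y. W \<subseteq> T' y" if "W \<in> Wl" for W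
    using that \<V>(2) unfolding Wl_def refines_def by blast
  then obtain c where c: "\<And>W. W \<in> Wl \<Longrightarrow> c W \<in> topspace Y" "\<And>W. W \<in> Wl \<Longrightarrow> W \<subseteq> T' (c W)" by metis
  have "level l (\<W>(l := Wl)) (E(l := (\<lambda>W. e (c W))))"
    unfolding level_def
  proof (intro conjI ballI allI impI)
    show "open_cover Y ((\<W>(l := Wl)) l)"
      using \<V>(1) \<V>(3)[symmetric] by (auto simp: open_cover_def Wl_def)
    show "locally_finite_in Y ((\<W>(l := Wl)) l)"
      using discrete_family_imp_locally_finite[of m \<V>] \<V>(1,4) by (simp add: Wl_def)
    fix W a assume W: "W \<in> (\<W>(l := Wl)) l" and a: "admissible l (\<W>(l := Wl)) a"
    have W': "W \<in> Wl" using W by simp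
    have a': "admissible l \<W> a" using a admissible_cong[of l \<W> "\<W>(l := Wl)" a] by simp
    have "compatible E (T (c W)) (e (c W)) a" by (rule T(4)[OF c(1)[OF W'] a'])
    then have "compatible E (Y closure_of W) (e (c W)) a"
      by (rule compatible_subset) (use T(3)[OF c(1)[OF W']] closure_of_mono[OF c(2)[OF W'], of Y] in auto)
    moreover have "compatible E (Y closure_of W) (e (c W)) a \<longleftrightarrow>
      compatible (E(l := (\<lambda>W. e (c W)))) (Y closure_of W) (e (c W)) a"
      by (rule compatible_cong) (use a' in \<open>auto simp: admissible_def\<close>)
    ultimately show "compatible (E(l := (\<lambda>W. e (c W)))) (Y closure_of W) ((E(l := (\<lambda>W. e (c W)))) l W) a"
      by simp
  qed
  then show thesis by (rule that)
qed

lemma levels_exist: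
  obtains \<W> E where "\<And>l. l \<le> m \<Longrightarrow> level l \<W> E"
proof -
  have "\<exists>\<W> E. \<forall>j<l. level j \<W> E" if "l \<le> Suc m" for l
    using that
  proof (induction l)
    case (Suc l)
    then obtain \<W> E where lev: "\<And>j. j < l \<Longrightarrow> level j \<W> E" by auto
    obtain Wl El where n: "level l (\<W>(l := Wl)) (E(l := El))"
      by (rule level_step[OF lev]) (use Suc.prems in \<open>auto intro: that\<close>)
    have "level j (\<W>(l := Wl)) (E(l := El))" if "j < Suc l" for j
    proof (cases "j = l")
      case False
      then have "j < l" using that by simp
      then show ?thesis using lev[of j] level_cong[of j \<W> "\<W>(l := Wl)" E "E(l := El)"] by simp
    qed (use n in simp)
    then show ?case by blast
  qed simp
  from this[of "Suc m"] show thesis using that by (auto simp: less_Suc_eq_le)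
qed

text \<open>Entries outside \<open>J\<close> are dropped one at a time; each drop is the second
  condition of compatibility for the index that remains.\<close>

lemma compatible_drop:
  assumes c: "\<And>a. admissible l \<W> a \<Longrightarrow> compatible E S e a" and a: "admissible l \<W> a"
    and x: "x \<in> pre S" and J: "\<And>i. i \<in> dom a - J \<Longrightarrow> u i x \<le> 1/3"
  shows "e a x = e (a |` J) x"
proof -
  have "e a x = e (a |` (-F)) x" if "finite F" "F \<subseteq> dom a - J" for F
    using that
  proof (induction F rule: finite_induct)
    case (insert i F)
    have eq: "a |` (- insert i F) = (a |` (-F))(i := None)" by (auto simp: restrict_map_def)
    obtain W where "a i = Some W" using insert by blast
    then have i: "(a |` (-F)) i = Some W" using insert by simp
    have "admissible l \<W> (a |` (-F))" using a by (auto simp: admissible_def restrict_map_def split: if_splits)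
    from compatibleD(4)[OF c[OF this] x i] have "e (a |` (-F)) x = e ((a |` (-F))(i := None)) x"
      using J[of i] insert.prems by blast
    then show ?case using insert eq by simp
  qed (simp add: restrict_map_def)
  moreover have "a |` J = a |` (- (dom a - J))" by (intro ext) (auto simp: restrict_map_def dom_def)
  ultimately show ?thesis using finite_dom_admissible[OF a] by (metis finite_Diff order_refl)
qed

text \<open>The levels \<open>w i\<close> equal \<open>2/3\<close> where the map of colour \<open>i\<close> is to be used and \<open>1/3\<close> outside the
  union of the members of colour \<open>i\<close>; on the set of the points with \<open>u i = w i\<close> the two
  compatibility conditions make the maps of different colours and with different indices agree.\<close>

lemma extension_on_levels:
  obtains w h where "\<And>i. i < m \<Longrightarrow> continuous_map X euclideanreal (w i)"
    "\<And>i x. i < m \<Longrightarrow> x \<in> topspace X \<Longrightarrow> w i x \<in> {1/3..2/3}"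
    "continuous_map (subtopology X {x \<in> topspace X. \<forall>i<m. u i x = w i x}) K h"
    "\<And>x. x \<in> A0 \<Longrightarrow> (\<forall>i<m. u i x = w i x) \<Longrightarrow> h x = g0 x"
proof -
  obtain \<W> E where lev: "\<And>l. l \<le> m \<Longrightarrow> level l \<W> E"
    by (rule levels_exist) (rule that)
  have Wcov: "open_cover Y (\<W> l)" if "l \<le> m" for l using lev[OF that] by (simp add: level_def)
  have comp: "compatible E (Y closure_of W) (E l W) a" if "l \<le> m" "W \<in> \<W> l" "admissible l \<W> a" for l W a
    using lev[OF that(1)] that(2,3) unfolding level_def by blast
  \<comment> \<open>The common refinement of all \<open>m + 1\<close> covers. A set \<open>V\<close>
    of any colour lies in a member of each cover; for colour \<open>i\<close> the member
    \<open>\<omega> i V\<close> of the cover of stage \<open>i\<close> is retained.\<close>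
  define \<O> where "\<O> = {topspace Y \<inter> (\<Inter>i\<le>m. c i) | c. \<forall>i\<le>m. c i \<in> \<W> i}"
  have "open_cover Y \<O>"
    unfolding open_cover_def
  proof (intro conjI ballI equalityI subsetI)
    fix U assume "U \<in> \<O>"
    then obtain c where c: "U = topspace Y \<inter> (\<Inter>i\<le>m. c i)" "\<forall>i\<le>m. c i \<in> \<W> i" by (auto simp: \<O>_def)
    have "openin Y (\<Inter>i\<le>m. c i)"
      using c(2) Wcov by (intro openin_Inter) (auto simp: open_cover_def)
    then show "openin Y U" unfolding c(1) by auto
  next
    fix y assume y: "y \<in> topspace Y"
    have "\<forall>i. \<exists>W. i \<le> m \<longrightarrow> W \<in> \<W> i \<and> y \<in> W"
      using Wcov y unfolding open_cover_def by blast
    then obtain c where c: "\<And>i. i \<le> m \<Longrightarrow> c i \<in> \<W> i \<and> y \<in> c i" by metis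
    then have "topspace Y \<inter> (\<Inter>i\<le>m. c i) \<in> \<O>" unfolding \<O>_def by blast
    moreover have "y \<in> topspace Y \<inter> (\<Inter>i\<le>m. c i)" using c y by blast
    ultimately show "y \<in> \<Union>\<O>" by blast
  qed (auto simp: \<O>_def)
  then obtain \<V> where \<V>: "\<And>i V. V \<in> \<V> i \<Longrightarrow> openin Y V" "\<And>i. refines (\<V> i) \<O>"
    "(\<Union>i\<le>m. \<Union>(\<V> i)) = topspace Y" "\<And>i. discrete_family Y (\<V> i)"
    by (rule discrete_coloured_refinement[OF Y_shrinkable Y_dim]) (rule that)
  have "\<exists>W. W \<in> \<W> i \<and> V \<subseteq> W" if i: "i \<le> m" and V: "V \<in> \<V> i" for i V
  proof -
    obtain U where U: "U \<in> \<O>" "V \<subseteq> U" using \<V>(2)[of i] V unfolding refines_def by blast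
    then obtain c where "U = topspace Y \<inter> (\<Inter>i\<le>m. c i)" "\<forall>i\<le>m. c i \<in> \<W> i" by (auto simp: \<O>_def)
    then show ?thesis using U(2) i by blast
  qed
  then obtain \<omega> where \<omega>: "\<And>i V. i \<le> m \<Longrightarrow> V \<in> \<V> i \<Longrightarrow> \<omega> i V \<in> \<W> i \<and> V \<subseteq> \<omega> i V" by metis
  have \<omega>c: "V \<subseteq> Y closure_of (\<omega> i V)" if "i \<le> m" "V \<in> \<V> i" for i V
  proof -
    have "\<omega> i V \<subseteq> topspace Y" using Wcov[OF that(1)] \<omega>[OF that] by (auto simp: open_cover_def)
    then show ?thesis using \<omega>[OF that] closure_of_subset by blast
  qed
  have uniq: "V = V'" if "V \<in> \<V> i" "V' \<in> \<V> i" "y \<in> V" "y \<in> V'" for i V V' y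
  proof -
    have "y \<in> topspace Y" using \<V>(1)[OF that(1)] that(3) openin_subset by blast
    then show ?thesis using \<V>(4)[of i] that unfolding discrete_family_def by blast
  qed
  define D where "D i = \<Union>(\<V> i)" for i
  have D1: "openin Y (D i)" for i using \<V>(1) by (auto simp: D_def)
  have D2: "\<Union>(D ` {..m}) = topspace Y" using \<V>(3) by (simp add: D_def)
  obtain C where C: "\<And>i. i \<in> {..m} \<Longrightarrow> C i \<subseteq> D i" "\<And>J. J \<subseteq> {..m} \<Longrightarrow> closedin Y (\<Union>(C ` J))"
    "\<Union>(C ` {..m}) = topspace Y"
    by (rule closed_shrinkable_indexed[OF Y_shrinkable D1 D2]) (rule that)
  have Cc: "closedin Y (C i)" if "i \<le> m" for i using C(2)[of "{i}"] that by simp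
  have "\<exists>s. continuous_map Y unit_interval s \<and> s ` (topspace Y - D i) \<subseteq> {0} \<and> s ` C i \<subseteq> {1}" if i: "i \<le> m" for i
  proof -
    have "closedin Y (topspace Y - D i)" "disjnt (topspace Y - D i) (C i)"
      using C(1)[of i] i D1[of i] by (auto simp: disjnt_iff)
    from Urysohn_lemma[OF closed_shrinkable_imp_normal[OF Y_shrinkable] this(1) Cc[OF i] this(2), of 0 1]
    show ?thesis by (metis zero_le_one)
  qed
  then obtain s where s: "\<And>i. i \<le> m \<Longrightarrow> continuous_map Y unit_interval (s i)"
     "\<And>i. i \<le> m \<Longrightarrow> s i ` (topspace Y - D i) \<subseteq> {0}" "\<And>i. i \<le> m \<Longrightarrow> s i ` C i \<subseteq> {1}" by metis
  define w where "w i x = 1/3 + s i (f x) / 3" for i x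
  have sc: "continuous_map Y euclideanreal (s i)" if "i \<le> m" for i
    using s(1)[OF that] by (rule continuous_map_into_fulltopology)
  have w1: "continuous_map X euclideanreal (w i)" if "i < m" for i
  proof -
    have "continuous_map X euclideanreal (\<lambda>x. s i (f x))"
      using continuous_map_compose[OF f_cont sc[of i]] that by (simp add: o_def)
    then show ?thesis unfolding w_def by (intro continuous_intros) auto
  qed
  have w2: "w i x \<in> {1/3..2/3}" if "i < m" "x \<in> topspace X" for i x
  proof -
    have "s i (f x) \<in> {0..1}"
      using continuous_map_image_subset_topspace[OF s(1)[of i]] that fX[OF that(2)] by auto
    then show ?thesis by (simp add: w_def)
  qed
  define Z where "Z = {x \<in> topspace X. \<forall>i<m. u i x = w i x}"
  define v where "v i y = (THE V. V \<in> \<V> i \<and> y \<in> V)" for i y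
  have v: "v i y = V" if "V \<in> \<V> i" "y \<in> V" for i y V
    unfolding v_def
  proof (rule the_equality)
    show "V' = V" if "V' \<in> \<V> i \<and> y \<in> V'" for V'
      using uniq[of V' i V y] that \<open>V \<in> \<V> i\<close> \<open>y \<in> V\<close> by simp
  qed (use that in simp)
  have vD: "v i y \<in> \<V> i" "y \<in> v i y" if y: "y \<in> D i" for i y
  proof -
    obtain V where "V \<in> \<V> i" "y \<in> V" using y by (auto simp: D_def)
    then show "v i y \<in> \<V> i" "y \<in> v i y" using v[of V i y] by simp_all
  qed
  define a where "a l y = (\<lambda>i. if i < l \<and> y \<in> D i then Some (\<omega> i (v i y)) else None)" for l :: nat and y
  have a_adm: "admissible l \<W> (a l y)" if "l \<le> m" for l y
    unfolding admissible_def a_def using \<omega> vD that by auto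
  define H where "H l x = E l (\<omega> l (v l (f x))) (a l (f x)) x" for l x
  have u_out: "u i x = 1/3" if "i < m" "x \<in> Z" "f x \<notin> D i" for i x
  proof -
    have "s i (f x) = 0" using s(2)[of i] that fX[of x] by (auto simp: Z_def)
    then show ?thesis using that by (simp add: Z_def w_def)
  qed
  have u_in: "u i x = 2/3" if "i < m" "x \<in> Z" "f x \<in> C i" for i x
  proof -
    have "s i (f x) = 1" using s(3)[of i] that by auto
    then show ?thesis using that by (simp add: Z_def w_def)
  qed
  have CD: "y \<in> D i" if "i \<le> m" "y \<in> C i" for i y using C(1)[of i] that by auto
  have ZX: "x \<in> topspace X" if "x \<in> Z" for x using that by (simp add: Z_def)
  have fin_pre: "x \<in> pre (Y closure_of (\<omega> l (v l (f x))))" if "l \<le> m" "x \<in> topspace X" "f x \<in> D l" for l x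
    using \<omega>c[OF that(1) vD(1)[OF that(3)]] vD(2)[OF that(3)] that by auto
  \<comment> \<open>Over \<open>C j\<close> the value \<open>u j x\<close> is 2/3, so the first
    condition replaces the map of stage \<open>l\<close> by one of stage \<open>j\<close>;
    truncation turns the index used at stage \<open>l\<close> into the one used at stage
    \<open>j\<close>.\<close>
  have H_less: "H l x = H j x" if jl: "j < l" "l \<le> m" and x: "x \<in> Z" "f x \<in> C j" "f x \<in> C l" for j l x
  proof -
    have Dj: "f x \<in> D j" "f x \<in> D l" using CD[of j "f x"] CD[of l "f x"] jl x by auto
    have "E l (\<omega> l (v l (f x))) (a l (f x)) x = E j (\<omega> j (v j (f x))) (a l (f x) |` {..<j}) x"
    proof (rule compatibleD(3)[OF comp])
      show "l \<le> m" "\<omega> l (v l (f x)) \<in> \<W> l" "admissible l \<W> (a l (f x))"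
        using jl \<omega>[of l "v l (f x)"] vD(1)[OF Dj(2)] a_adm by auto
      show "x \<in> pre (Y closure_of \<omega> l (v l (f x)))" by (rule fin_pre[OF jl(2) ZX[OF x(1)] Dj(2)])
      show "a l (f x) j = Some (\<omega> j (v j (f x)))" using jl Dj by (simp add: a_def)
      show "f x \<in> Y closure_of V" if "a l (f x) i = Some V" for i V
        using that fin_pre[of i x] ZX[OF x(1)] jl by (auto simp: a_def split: if_splits)
      show "2/3 \<le> u j x" using u_in[of j x] jl x by simp
    qed
    also have "a l (f x) |` {..<j} = a j (f x)"
      using jl by (auto simp: a_def restrict_map_def)
    finally show ?thesis by (simp add: H_def)
  qed
  have H_eq: "H l x = H j x" if "j \<le> m" "l \<le> m" "x \<in> Z" "f x \<in> C j" "f x \<in> C l" for j l x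
    using H_less[of j l x] H_less[of l j x] that by (cases j l rule: linorder_cases) auto
  \<comment> \<open>The index \<open>a l (f x)\<close> jumps as \<open>f x\<close> leaves a colour.
    Near a given point it is replaced by one fixed index \<open>b\<close>; the surplus entries
    belong to colours that do not contain \<open>f x\<close>, where \<open>u i x\<close> is 1/3 and
    entries may be dropped.\<close>
  have Hc: "continuous_map (subtopology X (Z \<inter> pre (C l))) K (H l)" if l: "l \<le> m" for l
  proof -
    let ?S = "Z \<inter> pre (C l)"
    define Q where "Q z N W b \<longleftrightarrow> openin Y N \<and> f z \<in> N \<and> W \<in> \<W> l \<and> admissible l \<W> b \<and>
        N \<subseteq> Y closure_of W \<and> (\<forall>x\<in>?S. f x \<in> N \<longrightarrow> H l x = E l W b x)" for z N W b
    have "\<exists>N W b. Q z N W b" if z: "z \<in> ?S" for z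
    proof -
      have zD: "f z \<in> D l" using CD[OF l] z by auto
      have zY: "f z \<in> topspace Y" using fX z by auto
      define P where "P i N \<longleftrightarrow> openin Y N \<and> f z \<in> N \<and> (\<forall>V\<in>\<V> i. \<forall>V'\<in>\<V> i. V \<inter> N \<noteq> {} \<and> V' \<inter> N \<noteq> {} \<longrightarrow> V = V')"
        for i N
      have "\<exists>N. P i N" for i
        using \<V>(4)[of i] zY unfolding discrete_family_def P_def by blast
      then obtain N where "\<And>i. P i (N i)" by metis
      then have N: "\<And>i. openin Y (N i)" "\<And>i. f z \<in> N i"
        "\<And>i V V'. V \<in> \<V> i \<Longrightarrow> V' \<in> \<V> i \<Longrightarrow> V \<inter> N i \<noteq> {} \<Longrightarrow> V' \<inter> N i \<noteq> {} \<Longrightarrow> V = V'"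
        unfolding P_def by blast+
      let ?V = "v l (f z)" and ?W = "\<omega> l (v l (f z))"
      define N' where "N' = \<Inter>(insert ?V (N ` {..l}))"
      have N': "openin Y N'" "f z \<in> N'" "N' \<subseteq> ?V" "\<And>i. i \<le> l \<Longrightarrow> N' \<subseteq> N i"
      proof -
        show "openin Y N'"
          unfolding N'_def by (rule openin_Inter) (use N(1) \<V>(1)[OF vD(1)[OF zD]] in auto)
      qed (use N(2) vD(2)[OF zD] in \<open>auto simp: N'_def\<close>)
      \<comment> \<open>By discreteness \<open>N i\<close> meets at most one set of colour
        \<open>i\<close>; \<open>b\<close> records it whether or not the point itself lies in
        it.\<close>
      define b where "b i = (if i < l \<and> (\<exists>V\<in>\<V> i. V \<inter> N i \<noteq> {})
          then Some (\<omega> i (SOME V. V \<in> \<V> i \<and> V \<inter> N i \<noteq> {})) else None)" for i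
      have b: "b i = Some (\<omega> i V)" if "i < l" "V \<in> \<V> i" "V \<inter> N i \<noteq> {}" for i V
      proof -
        have "(SOME V. V \<in> \<V> i \<and> V \<inter> N i \<noteq> {}) = V"
          by (rule some_equality) (use that N(3) in blast)+
        then show ?thesis using that by (auto simp: b_def)
      qed
      have b_adm: "admissible l \<W> b"
        unfolding admissible_def
      proof (intro allI impI)
        fix i W assume i: "b i = Some W"
        then obtain V where V: "i < l" "V \<in> \<V> i" "V \<inter> N i \<noteq> {}" by (auto simp: b_def split: if_splits)
        then have "W = \<omega> i V" using b[OF V] i by simp
        then show "i < l \<and> W \<in> \<W> i" using \<omega>[of i V] V l by auto
      qed
      have W: "?W \<in> \<W> l" using \<omega>[OF l vD(1)[OF zD]] by simp
      have sub: "N' \<subseteq> Y closure_of ?W" using N'(3) \<omega>c[OF l vD(1)[OF zD]] by blast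
      have "H l x = E l ?W b x" if x: "x \<in> ?S" "f x \<in> N'" for x
      proof -
        have "v l (f x) = ?V" using v[OF vD(1)[OF zD]] N'(3) x by blast
        then have "H l x = E l ?W (a l (f x)) x" by (simp add: H_def)
        also have "a l (f x) = b |` {i. f x \<in> D i}"
        proof
          fix i
          show "a l (f x) i = (b |` {i. f x \<in> D i}) i"
          proof (cases "i < l \<and> f x \<in> D i")
            case True
            then have "v i (f x) \<inter> N i \<noteq> {}" using vD(2)[of "f x" i] N'(4)[of i] x by auto
            then show ?thesis using True b[of i "v i (f x)"] vD(1)[of "f x" i] by (simp add: a_def)
          next
            case False
            then show ?thesis by (auto simp: a_def b_def restrict_map_def)
          qed
        qed
        also have "E l ?W (b |` {i. f x \<in> D i}) x = E l ?W b x"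
        proof (rule compatible_drop[symmetric, OF comp[OF l W] b_adm])
          show "x \<in> pre (Y closure_of ?W)" using sub x by auto
          show "u i x \<le> 1/3" if "i \<in> dom b - {i. f x \<in> D i}" for i
            using u_out[of i x] that x l by (auto simp: b_def split: if_splits)
        qed
        finally show ?thesis .
      qed
      then have "Q z N' ?W b" using N'(1,2) W b_adm sub by (simp add: Q_def)
      then show ?thesis by blast
    qed
    then obtain N W b where "\<And>z. z \<in> ?S \<Longrightarrow> Q z (N z) (W z) (b z)" by metis
    then have N: "\<And>z. z \<in> ?S \<Longrightarrow> openin Y (N z) \<and> f z \<in> N z \<and> W z \<in> \<W> l \<and> admissible l \<W> (b z) \<and>
        N z \<subseteq> Y closure_of (W z) \<and> (\<forall>x\<in>?S. f x \<in> N z \<longrightarrow> H l x = E l (W z) (b z) x)"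
      unfolding Q_def by blast
    show ?thesis
    proof (rule pasting_lemma[where I="?S" and T="\<lambda>z. ?S \<inter> pre (N z)" and f="\<lambda>z. E l (W z) (b z)"])
      show "openin (subtopology X ?S) (?S \<inter> pre (N z))" if "z \<in> ?S" for z
        using openin_continuous_map_preimage[OF f_cont, of "N z"] N[OF that] by (auto simp: openin_subtopology)
      show "continuous_map (subtopology (subtopology X ?S) (?S \<inter> pre (N z))) K (E l (W z) (b z))" if "z \<in> ?S" for z
      proof -
        have "continuous_map (subtopology X (pre (Y closure_of (W z)))) K (E l (W z) (b z))"
          by (rule compatibleD(1)[OF comp[OF l]]) (use N[OF that] in auto)
        then show ?thesis
          unfolding subtopology_subtopology
          by (rule continuous_map_from_subtopology_mono) (use N[OF that] in auto)
      qed
      show "E l (W i) (b i) x = E l (W j) (b j) x"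
        if "i \<in> ?S" "j \<in> ?S" "x \<in> topspace (subtopology X ?S) \<inter> (?S \<inter> pre (N i)) \<inter> (?S \<inter> pre (N j))" for i j x
      proof -
        have "x \<in> ?S" "f x \<in> N i" "f x \<in> N j" using that(3) by auto
        then have "H l x = E l (W i) (b i) x" "H l x = E l (W j) (b j) x" using N[OF that(1)] N[OF that(2)] by blast+
        then show ?thesis by simp
      qed
      show "\<exists>j. j \<in> ?S \<and> x \<in> ?S \<inter> pre (N j) \<and> H l x = E l (W j) (b j) x"
        if "x \<in> topspace (subtopology X ?S)" for x
      proof -
        have x: "x \<in> ?S" using that by simp
        then have "H l x = E l (W x) (b x) x" "f x \<in> N x" using N[OF x] by blast+
        then show ?thesis using x by blast
      qed
    qed
  qed
  have Zc: "closedin (subtopology X Z) (Z \<inter> pre (C l))" if "l \<le> m" for l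
    using closedin_continuous_map_preimage[OF f_cont Cc[OF that]] by (auto simp: closedin_subtopology)
  obtain h where h: "continuous_map (subtopology X Z) K h"
    "\<And>x l. l \<in> {..m} \<Longrightarrow> x \<in> topspace (subtopology X Z) \<inter> (Z \<inter> pre (C l)) \<Longrightarrow> h x = H l x"
  proof (rule pasting_lemma_exists_closed[of "{..m}" "subtopology X Z" "\<lambda>l. Z \<inter> pre (C l)" K H])
    show "topspace (subtopology X Z) \<subseteq> \<Union> ((\<lambda>l. Z \<inter> pre (C l)) ` {..m})"
      using C(3) fX by auto
    show "closedin (subtopology X Z) (Z \<inter> pre (C l))" if "l \<in> {..m}" for l using Zc that by simp
    show "continuous_map (subtopology (subtopology X Z) (Z \<inter> pre (C l))) K (H l)" if "l \<in> {..m}" for l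
      using Hc[of l] that by (simp add: subtopology_subtopology Int_absorb1 flip: Int_assoc)
    show "H i x = H j x"
      if "i \<in> {..m}" "j \<in> {..m}" "x \<in> topspace (subtopology X Z) \<inter> (Z \<inter> pre (C i)) \<inter> (Z \<inter> pre (C j))" for i j x
      using H_eq[of j i x] that by auto
  qed (auto intro: that)
  show thesis
  proof (rule that[OF w1 w2])
    show "continuous_map (subtopology X {x \<in> topspace X. \<forall>i<m. u i x = w i x}) K h"
      using h(1) by (simp add: Z_def)
    show "h x = g0 x" if x: "x \<in> A0" "\<forall>i<m. u i x = w i x" for x
    proof -
      have xZ: "x \<in> Z" using closedin_subset[OF A0] x by (auto simp: Z_def)
      then obtain l where l: "l \<le> m" "f x \<in> C l" using C(3) fX[OF ZX] by blast
      have Dl: "f x \<in> D l" by (rule CD[OF l])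
      have "h x = H l x" using h(2)[of l x] l xZ ZX by auto
      also have "\<dots> = g0 x"
        unfolding H_def
        by (rule compatibleD(2)[OF comp[OF l(1) _ a_adm[OF l(1)]] fin_pre[OF l(1) ZX[OF xZ] Dl] x(1)])
          (use \<omega>[OF l(1) vD(1)[OF Dl]] in simp)
      finally show ?thesis .
    qed
  qed
qed

end

section \<open>Cones\<close>

text \<open>The point set of the cone is left open: \<open>q\<close> is any map whose only
  identification on the cylinder is the collapse of its top. One copy must live on the type on which
  \<open>cw_space\<close> tests complexes, others on a product with \<open>real\<close> for the
  suspensions.\<close>

definition cone_map :: "'a topology \<Rightarrow> ('a \<times> real \<Rightarrow> 'b) \<Rightarrow> bool" where
  "cone_map L q \<longleftrightarrow> (\<forall>p\<in>topspace L. \<forall>p'\<in>topspace L. \<forall>t\<in>{0..1}. \<forall>t'\<in>{0..1}.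
     q (p, t) = q (p', t') \<longleftrightarrow> (p = p' \<and> t = t') \<or> (t = 1 \<and> t' = 1))"

definition topcone :: "'a topology \<Rightarrow> ('a \<times> real \<Rightarrow> 'b) \<Rightarrow> 'b topology" where
  "topcone L q = quotient_topology (prod_topology L unit_interval) q"

definition std_cone_map :: "'a \<times> real \<Rightarrow> 'a \<times> real" where
  "std_cone_map = (\<lambda>(p, t). if t = 1 then (undefined, 1) else (p, t))"

lemma cone_map_std: "cone_map L std_cone_map"
  by (auto simp: cone_map_def std_cone_map_def)

lemma cone_mapD:
  assumes "cone_map L q" "p \<in> topspace L" "p' \<in> topspace L" "t \<in> {0..1}" "t' \<in> {0..1}"
  shows "q (p, t) = q (p', t') \<longleftrightarrow> (p = p' \<and> t = t') \<or> (t = 1 \<and> t' = 1)"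
  using assms unfolding cone_map_def by blast

lemma quotient_map_cone: "quotient_map (prod_topology L unit_interval) (topcone L q) q"
  unfolding topcone_def by (rule quotient_map_quotient_topology)

lemma topspace_cone: "topspace (topcone L q) = q ` (topspace L \<times> {0..1})"
  by (simp add: topcone_def)

lemma continuous_map_cone: "continuous_map (prod_topology L unit_interval) (topcone L q) q"
  by (rule quotient_imp_continuous_map[OF quotient_map_cone])

lemma continuous_map_into_cone:
  assumes "continuous_map Z L p" "continuous_map Z euclideanreal t" "\<And>z. z \<in> topspace Z \<Longrightarrow> t z \<in> {0..1}"
  shows "continuous_map Z (topcone L q) (\<lambda>z. q (p z, t z))"
proof -
  have "continuous_map Z (prod_topology L unit_interval) (\<lambda>z. (p z, t z))"
    using assms by (auto intro!: continuous_map_pairedI simp: continuous_map_in_subtopology)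
  from continuous_map_compose[OF this continuous_map_cone] show ?thesis
    by (simp add: o_def)
qed

text \<open>The base coordinate exists only below the apex, an open set over which \<open>q\<close>
  remains a quotient map; so both coordinates are induced continuously by the projections of the
  cylinder.\<close>

lemma cone_coordinates:
  assumes q: "cone_map L q"
  obtains \<eta> \<beta> where "continuous_map (topcone L q) euclideanreal \<eta>"
    "continuous_map (subtopology (topcone L q) {z \<in> topspace (topcone L q). \<eta> z \<in> {..<1}}) L \<beta>"
    "\<And>p t. p \<in> topspace L \<Longrightarrow> t \<in> {0..1} \<Longrightarrow> \<eta> (q (p, t)) = t"
    "\<And>p t. p \<in> topspace L \<Longrightarrow> t \<in> {0..<1} \<Longrightarrow> \<beta> (q (p, t)) = p"
proof -
  define \<eta> where "\<eta> z = (THE t. t \<in> {0..1} \<and> (\<exists>p\<in>topspace L. z = q (p, t)))" for z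
  define \<beta> where "\<beta> z = (THE p. p \<in> topspace L \<and> (\<exists>t\<in>{0..<1}. z = q (p, t)))" for z
  have \<eta>: "\<eta> (q (p, t)) = t" if "p \<in> topspace L" "t \<in> {0..1}" for p t
    unfolding \<eta>_def
  proof (rule the_equality)
    show "t' = t" if "t' \<in> {0..1} \<and> (\<exists>p'\<in>topspace L. q (p, t) = q (p', t'))" for t'
      using that cone_mapD[OF q \<open>p \<in> topspace L\<close> _ \<open>t \<in> {0..1}\<close>, of _ t'] by auto
  qed (use that in blast)
  have \<beta>: "\<beta> (q (p, t)) = p" if "p \<in> topspace L" "t \<in> {0..<1}" for p t
    unfolding \<beta>_def
  proof (rule the_equality)
    have t: "t \<in> {0..1}" "t \<noteq> 1" using that by auto
    show "p' = p" if "p' \<in> topspace L \<and> (\<exists>t'\<in>{0..<1}. q (p, t) = q (p', t'))" for p'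
      using that cone_mapD[OF q \<open>p \<in> topspace L\<close> _ t(1), of p'] t(2) by force
  qed (use that in blast)
  have c1: "continuous_map (topcone L q) euclideanreal \<eta>"
  proof (rule continuous_compose_quotient_map[OF quotient_map_cone])
    have "continuous_map (prod_topology L unit_interval) euclideanreal snd"
      using continuous_map_snd continuous_map_into_fulltopology by metis
    then show "continuous_map (prod_topology L unit_interval) euclideanreal (\<eta> \<circ> q)"
      by (rule continuous_map_eq) (auto simp: \<eta>)
  qed
  let ?V = "{z \<in> topspace (topcone L q). \<eta> z \<in> {..<1}}"
  let ?U = "{x \<in> topspace (prod_topology L unit_interval). q x \<in> ?V}"
  have "openin (topcone L q) ?V"
    by (rule openin_continuous_map_preimage[OF c1]) auto
  then have qm: "quotient_map (subtopology (prod_topology L unit_interval) ?U) (subtopology (topcone L q) ?V) q"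
    by (intro quotient_map_restriction[OF quotient_map_cone]) auto
  have c2: "continuous_map (subtopology (topcone L q) ?V) L \<beta>"
  proof (rule continuous_compose_quotient_map[OF qm])
    have "continuous_map (subtopology (prod_topology L unit_interval) ?U) L fst"
      by (intro continuous_map_from_subtopology continuous_map_fst)
    then show "continuous_map (subtopology (prod_topology L unit_interval) ?U) L (\<beta> \<circ> q)"
      by (rule continuous_map_eq) (auto simp: \<beta> \<eta>)
  qed
  show thesis by (rule that[OF c1 c2 \<eta> \<beta>])
qed

text \<open>A partial map into the base extends to a map into the cone; where the extension stays at
  height at most 1/2 it can be projected down to the base. Any bound strictly between 0 and 1 would
  do.\<close>

lemma abs_nbhd_extensor_if_cone:
  assumes q: "cone_map L q" and ae: "abs_extensor (topcone L q) Z"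
  shows "abs_nbhd_extensor L Z"
  unfolding abs_nbhd_extensor_def
proof (intro allI impI, elim conjE)
  fix A g assume A: "closedin Z A" and g: "continuous_map (subtopology Z A) L g"
  obtain \<eta> \<beta> where \<eta>: "continuous_map (topcone L q) euclideanreal \<eta>"
    "\<And>p t. p \<in> topspace L \<Longrightarrow> t \<in> {0..1} \<Longrightarrow> \<eta> (q (p, t)) = t"
    and \<beta>: "continuous_map (subtopology (topcone L q) {z \<in> topspace (topcone L q). \<eta> z \<in> {..<1}}) L \<beta>"
    "\<And>p t. p \<in> topspace L \<Longrightarrow> t \<in> {0..<1} \<Longrightarrow> \<beta> (q (p, t)) = p"
    by (rule cone_coordinates[OF q]) (rule that)
  have "continuous_map (subtopology Z A) (topcone L q) (\<lambda>x. q (g x, 0))"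
    by (rule continuous_map_into_cone[OF g]) auto
  then have "\<exists>h. continuous_map Z (topcone L q) h \<and> (\<forall>x\<in>A. h x = q (g x, 0))"
    using ae[unfolded abs_extensor_def, THEN spec[of _ A], THEN spec[of _ "\<lambda>x. q (g x, 0)"]] A by simp
  then obtain G where G: "continuous_map Z (topcone L q) G" "\<And>x. x \<in> A \<Longrightarrow> G x = q (g x, 0)"
    by blast
  have \<eta>G: "continuous_map Z euclideanreal (\<lambda>x. \<eta> (G x))"
    using continuous_map_compose[OF G(1) \<eta>(1)] by (simp add: o_def)
  have gA: "g x \<in> topspace L" if "x \<in> A" for x
    using continuous_map_image_subset_topspace[OF g] that closedin_subset[OF A] by auto
  define N where "N = {x \<in> topspace Z. \<eta> (G x) \<in> {..1/2}}"
  define T where "T = {x \<in> topspace Z. \<eta> (G x) \<in> {..<1/2}}"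
  show "\<exists>N T h. closedin Z N \<and> openin Z T \<and> A \<subseteq> T \<and> T \<subseteq> N \<and>
           continuous_map (subtopology Z N) L h \<and> (\<forall>x\<in>A. h x = g x)"
  proof (intro exI conjI ballI)
    show "closedin Z N" unfolding N_def by (rule closedin_continuous_map_preimage[OF \<eta>G]) auto
    show "openin Z T" unfolding T_def by (rule openin_continuous_map_preimage[OF \<eta>G]) auto
    show "A \<subseteq> T" using closedin_subset[OF A] \<eta>(2) gA G(2) by (auto simp: T_def)
    show "T \<subseteq> N" by (auto simp: T_def N_def)
    show "(\<beta> \<circ> G) x = g x" if "x \<in> A" for x
      using \<beta>(2)[OF gA[OF that], of 0] G(2)[OF that] by simp
    show "continuous_map (subtopology Z N) L (\<beta> \<circ> G)"
    proof (rule continuous_map_compose[OF _ \<beta>(1)])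
      have "continuous_map (subtopology Z N) (topcone L q) G" by (rule continuous_map_from_subtopology[OF G(1)])
      moreover have "G ` N \<subseteq> {z \<in> topspace (topcone L q). \<eta> z \<in> {..<1}}"
        using continuous_map_image_subset_topspace[OF G(1)] by (auto simp: N_def)
      ultimately show "continuous_map (subtopology Z N) (subtopology (topcone L q) {z \<in> topspace (topcone L q). \<eta> z \<in> {..<1}}) G"
        by (auto simp: continuous_map_in_subtopology)
    qed
  qed
qed

section \<open>Inheritance of absolute extensors\<close>

lemma abs_extensor_retract:
  assumes ae: "abs_extensor L Z" and i: "continuous_map M L i" and r: "continuous_map L M r"
    and ri: "\<And>x. x \<in> topspace M \<Longrightarrow> r (i x) = x"
  shows "abs_extensor M Z"
  unfolding abs_extensor_def
proof (intro allI impI, elim conjE)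
  fix A g assume A: "closedin Z A" and g: "continuous_map (subtopology Z A) M g"
  have "continuous_map (subtopology Z A) L (i \<circ> g)" by (rule continuous_map_compose[OF g i])
  then obtain h where h: "continuous_map Z L h" "\<forall>x\<in>A. h x = (i \<circ> g) x"
    using ae[unfolded abs_extensor_def, THEN spec[of _ A], THEN spec[of _ "i \<circ> g"]] A by blast
  have "g x \<in> topspace M" if "x \<in> A" for x
    using continuous_map_image_subset_topspace[OF g] that closedin_subset[OF A] by auto
  then have "\<forall>x\<in>A. (r \<circ> h) x = g x" using h(2) ri by simp
  moreover have "continuous_map Z M (r \<circ> h)" by (rule continuous_map_compose[OF h(1) r])
  ultimately show "\<exists>h. continuous_map Z M h \<and> (\<forall>x\<in>A. h x = g x)" by blast
qed

lemma abs_extensor_prod_unit_interval: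
  assumes ae: "abs_extensor L Z" and Z: "normal_space Z"
  shows "abs_extensor (prod_topology L unit_interval) Z"
  unfolding abs_extensor_def
proof (intro allI impI, elim conjE)
  fix A g assume A: "closedin Z A" and g: "continuous_map (subtopology Z A) (prod_topology L unit_interval) g"
  have g1: "continuous_map (subtopology Z A) L (fst \<circ> g)" 
    by (rule continuous_map_compose[OF g continuous_map_fst])
  have g2: "continuous_map (subtopology Z A) unit_interval (snd \<circ> g)" 
    by (rule continuous_map_compose[OF g continuous_map_snd])
  obtain h1 where h1: "continuous_map Z L h1" "\<forall>x\<in>A. h1 x = (fst \<circ> g) x"
    using ae[unfolded abs_extensor_def, THEN spec[of _ A], THEN spec[of _ "fst \<circ> g"]] A g1 by blast
  have "(snd \<circ> g) ` A \<subseteq> {0..1}"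
    using continuous_map_image_subset_topspace[OF g2] closedin_subset[OF A] by auto
  then obtain h2 where h2: "continuous_map Z euclideanreal h2" "\<And>x. x \<in> A \<Longrightarrow> h2 x = (snd \<circ> g) x"
      "h2 ` topspace Z \<subseteq> {0..1}"
    using Tietze_extension_closed_real_interval[OF Z A continuous_map_into_fulltopology[OF g2] _ zero_le_one]
    by metis
  have "continuous_map Z (prod_topology L unit_interval) (\<lambda>x. (h1 x, h2 x))"
    using h1 h2 by (intro continuous_map_pairedI) (auto simp: continuous_map_in_subtopology)
  then show "\<exists>h. continuous_map Z (prod_topology L unit_interval) h \<and> (\<forall>x\<in>A. h x = g x)"
    using h1 h2 by (intro exI[of _ "\<lambda>x. (h1 x, h2 x)"]) auto
qed

lemma abs_extensor_closed_embedding: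
  assumes ae: "abs_extensor L W" and i: "continuous_map Z W i" "closed_map Z W i"
    and r: "continuous_map W Z r" "\<And>x. x \<in> topspace Z \<Longrightarrow> r (i x) = x"
  shows "abs_extensor L Z"
  unfolding abs_extensor_def
proof (intro allI impI, elim conjE)
  fix A g assume A: "closedin Z A" and g: "continuous_map (subtopology Z A) L g"
  have iA: "closedin W (i ` A)" using i(2) A by (simp add: closed_map_def)
  have AZ: "A \<subseteq> topspace Z" using A closedin_subset by blast
  have "continuous_map (subtopology W (i ` A)) (subtopology Z A) r"
    using r AZ by (auto simp: continuous_map_in_subtopology intro: continuous_map_from_subtopology)
  then have "continuous_map (subtopology W (i ` A)) L (g \<circ> r)"
    by (rule continuous_map_compose[OF _ g])
  then obtain h where h: "continuous_map W L h" "\<forall>x\<in>i ` A. h x = (g \<circ> r) x"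
    using ae[unfolded abs_extensor_def, THEN spec[of _ "i ` A"], THEN spec[of _ "g \<circ> r"]] iA by blast
  have "\<forall>x\<in>A. (h \<circ> i) x = g x" using h(2) r(2) AZ by auto
  moreover have "continuous_map Z L (h \<circ> i)" by (rule continuous_map_compose[OF i(1) h(1)])
  ultimately show "\<exists>h. continuous_map Z L h \<and> (\<forall>x\<in>A. h x = g x)" by blast
qed

section \<open>Cones over suspensions\<close>

lemma quotient_map_lift:
  assumes "quotient_map X Y f" "continuous_map X Z h"
    and "\<And>x y. x \<in> topspace X \<Longrightarrow> y \<in> topspace X \<Longrightarrow> f x = f y \<Longrightarrow> h x = h y"
  shows "\<exists>g. continuous_map Y Z g \<and> (\<forall>x\<in>topspace X. g (f x) = h x)"
  by (rule quotient_map_lift_exists[OF assms]) auto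

lemma cone_functorial:
  assumes q: "cone_map L q" and q': "cone_map M q'" and f: "continuous_map L M f"
  obtains F where "continuous_map (topcone L q) (topcone M q') F"
    "\<And>p t. p \<in> topspace L \<Longrightarrow> t \<in> {0..1} \<Longrightarrow> F (q (p, t)) = q' (f p, t)"
proof -
  let ?P = "prod_topology L unit_interval"
  have 1: "continuous_map ?P M (\<lambda>x. f (fst x))"
    using continuous_map_compose[OF continuous_map_fst f] by (simp add: o_def)
  have 2: "continuous_map ?P euclideanreal snd"
    using continuous_map_snd by (rule continuous_map_into_fulltopology)
  have c: "continuous_map ?P (topcone M q') (\<lambda>x. q' (f (fst x), snd x))"
    by (rule continuous_map_into_cone[OF 1 2]) auto
  have fL: "f p \<in> topspace M" if "p \<in> topspace L" for p
    using continuous_map_image_subset_topspace[OF f] that by auto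
  have wd: "q' (f (fst x), snd x) = q' (f (fst y), snd y)"
    if "x \<in> topspace ?P" "y \<in> topspace ?P" "q x = q y" for x y
    using that cone_mapD[OF q, of "fst x" "fst y" "snd x" "snd y"] cone_mapD[OF q', of "f (fst x)" "f (fst y)" "snd x" "snd y"] fL
    by (cases x; cases y) auto
  have "\<exists>F. continuous_map (topcone L q) (topcone M q') F \<and> (\<forall>x\<in>topspace ?P. F (q x) = q' (f (fst x), snd x))"
    by (rule quotient_map_lift[OF quotient_map_cone c]) (rule wd)
  then obtain F where "continuous_map (topcone L q) (topcone M q') F"
     "\<forall>x\<in>topspace ?P. F (q x) = q' (f (fst x), snd x)" by blast
  then show thesis using that[of F] by auto
qed

text \<open>Although \<open>\<theta>\<close> may be discontinuous where \<open>v\<close> vanishes, the map is continuous there because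
  the suspension coordinate \<open>\<theta>\<close> ranges over a compact set (tube lemma).\<close>

lemma continuous_map_into_cone_suspension:
  assumes l: "continuous_map Z L l" and v: "continuous_map Z euclideanreal v" "\<And>z. z \<in> topspace Z \<Longrightarrow> v z \<in> {0..1}"
    and \<theta>: "continuous_map (subtopology Z {z \<in> topspace Z. v z \<noteq> 0}) euclideanreal \<theta>"
      "\<And>z. z \<in> topspace Z \<Longrightarrow> \<theta> z \<in> {0..1}"
    and q: "cone_map (suspension L) q"
  shows "continuous_map Z (topcone (suspension L) q) (\<lambda>z. q (susp_proj (l z, \<theta> z), 1 - v z))"
proof -
  let ?k = "\<lambda>z. q (susp_proj (l z, \<theta> z), 1 - v z)" and ?C = "topcone (suspension L) q"
  let ?V = "{z \<in> topspace Z. v z \<noteq> 0}"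
  let ?P = "prod_topology (prod_topology L unit_interval) unit_interval"
  have lZ: "l z \<in> topspace L" if "z \<in> topspace Z" for z
    using continuous_map_image_subset_topspace[OF l] that by auto
  have V: "openin Z ?V"
  proof -
    have "openin Z {z \<in> topspace Z. v z \<in> - {0}}" by (rule openin_continuous_map_preimage[OF v(1)]) auto
    then show ?thesis by simp
  qed
  have kV: "continuous_map (subtopology Z ?V) ?C ?k"
  proof (rule continuous_map_into_cone)
    show "continuous_map (subtopology Z ?V) (suspension L) (\<lambda>z. susp_proj (l z, \<theta> z))"
      using \<theta>(2) by (intro continuous_map_into_suspension \<theta>(1) continuous_map_from_subtopology l) auto
    show "continuous_map (subtopology Z ?V) euclideanreal (\<lambda>z. 1 - v z)"
      by (intro continuous_intros continuous_map_from_subtopology v)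
  qed (use v(2) in auto)
  have Qc: "continuous_map ?P ?C (\<lambda>x. q (susp_proj (fst x), snd x))"
  proof (rule continuous_map_into_cone)
    show "continuous_map ?P (suspension L) (\<lambda>x. susp_proj (fst x))"
      using continuous_map_compose[OF continuous_map_fst continuous_map_susp_proj] by (simp add: o_def)
    show "continuous_map ?P euclideanreal snd"
      using continuous_map_snd by (rule continuous_map_into_fulltopology)
  qed auto
  show ?thesis
    unfolding continuous_map_def
  proof (intro conjI allI impI)
    show "?k \<in> topspace Z \<rightarrow> topspace ?C"
    proof
      fix z assume z: "z \<in> topspace Z"
      have "((l z, \<theta> z), 1 - v z) \<in> topspace ?P" using lZ[OF z] \<theta>(2)[OF z] v(2)[OF z] by auto
      then show "?k z \<in> topspace ?C"
        using continuous_map_image_subset_topspace[OF Qc] by force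
    qed
    fix U assume U: "openin ?C U"
    show "openin Z {z \<in> topspace Z. ?k z \<in> U}"
    proof (subst openin_subopen, intro ballI)
      fix z0 assume z0: "z0 \<in> {z \<in> topspace Z. ?k z \<in> U}"
      show "\<exists>T. openin Z T \<and> z0 \<in> T \<and> T \<subseteq> {z \<in> topspace Z. ?k z \<in> U}"
      proof (cases "v z0 = 0")
        case False
        have "openin (subtopology Z ?V) {z \<in> topspace (subtopology Z ?V). ?k z \<in> U}"
          by (rule openin_continuous_map_preimage[OF kV U])
        then have "openin Z {z \<in> topspace (subtopology Z ?V). ?k z \<in> U}"
          using V by (rule openin_trans_full)
        then show ?thesis using z0 False by (intro exI[of _ "{z \<in> topspace (subtopology Z ?V). ?k z \<in> U}"]) auto
      next
        case True
        let ?W = "{x \<in> topspace ?P. q (susp_proj (fst x), snd x) \<in> U}"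
        have W: "openin ?P ?W" by (rule openin_continuous_map_preimage[OF Qc U])
        have l0: "l z0 \<in> topspace L" using lZ z0 by auto
        have c01: "compactin unit_interval {0..1}" by (simp add: compactin_subtopology)
        have c1: "compactin (prod_topology L unit_interval) ({l z0} \<times> {0..1})"
          using c01 l0 by (simp add: compactin_Times)
        have c2: "compactin unit_interval {1::real}" by simp
        \<comment> \<open>Where \<open>v\<close> vanishes the value is the apex, and every
          suspension coordinate gives this same apex.\<close>
        have sub: "({l z0} \<times> {0..1}) \<times> {1} \<subseteq> ?W"
        proof
          fix x assume x: "x \<in> ({l z0} \<times> {0..1::real}) \<times> {1::real}"
          then obtain t where t: "x = ((l z0, t), 1)" "t \<in> {0..1}" by auto
          have tp: "susp_proj (l z0, s) \<in> topspace (suspension L)" if "s \<in> {0..1}" for s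
            using l0 that unfolding topspace_suspension by blast
          have "q (susp_proj (l z0, t), 1) = q (susp_proj (l z0, \<theta> z0), 1)"
            using cone_mapD[OF q tp tp, of t "\<theta> z0" 1 1] t \<theta>(2)[of z0] z0 by auto
          then show "x \<in> ?W" using t l0 z0 True by auto
        qed
        \<comment> \<open>Two applications split off first the cone coordinate and then the
          coordinate in \<open>L\<close>, leaving the whole interval for the suspension coordinate;
          the resulting neighbourhood does not involve \<open>\<theta>\<close>.\<close>
        obtain U1 V1 where UV1: "openin (prod_topology L unit_interval) U1" "openin unit_interval V1"
          "{l z0} \<times> {0..1} \<subseteq> U1" "{1} \<subseteq> V1" "U1 \<times> V1 \<subseteq> ?W"
          by (rule Wallace_theorem_prod_topology[OF c1 c2 W sub]) (rule that)
        have c3: "compactin L {l z0}" using l0 by simp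
        obtain U2 V2 where UV2: "openin L U2" "openin unit_interval V2" "{l z0} \<subseteq> U2" "{0..1} \<subseteq> V2" "U2 \<times> V2 \<subseteq> U1"
          by (rule Wallace_theorem_prod_topology[OF c3 c01 UV1(1,3)]) (rule that)
        have v1: "continuous_map Z unit_interval (\<lambda>z. 1 - v z)"
          unfolding continuous_map_in_subtopology using v by (auto intro!: continuous_intros)
        show ?thesis
        proof (intro exI conjI)
          show "openin Z ({z \<in> topspace Z. l z \<in> U2} \<inter> {z \<in> topspace Z. 1 - v z \<in> V1})"
            by (intro openin_Int openin_continuous_map_preimage[OF l UV2(1)] openin_continuous_map_preimage[OF v1 UV1(2)])
          show "z0 \<in> {z \<in> topspace Z. l z \<in> U2} \<inter> {z \<in> topspace Z. 1 - v z \<in> V1}"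
            using z0 True UV1(4) UV2(3) by auto
          show "{z \<in> topspace Z. l z \<in> U2} \<inter> {z \<in> topspace Z. 1 - v z \<in> V1} \<subseteq> {z \<in> topspace Z. ?k z \<in> U}"
          proof
            fix z assume z: "z \<in> {z \<in> topspace Z. l z \<in> U2} \<inter> {z \<in> topspace Z. 1 - v z \<in> V1}"
            then have "((l z, \<theta> z), 1 - v z) \<in> ?W" using UV1(5) UV2(4,5) \<theta>(2)[of z] by blast
            then show "z \<in> {z \<in> topspace Z. ?k z \<in> U}" using z by simp
          qed
        qed
      qed
    qed
  qed
qed

text \<open>In the coordinates \<open>v = 1 - r\<close>, \<open>w = (2\<theta> - 1)v\<close> the cone over a suspension is parametrised by
  \<open>L\<close> and the triangle \<open>|w| \<le> v \<le> 1\<close>, with the \<open>L\<close>-coordinate collapsed over the two sides \<open>|w| = v\<close>.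
  This triangle is a retract of a square having these two sides on one edge.\<close>

lemma abs_extensor_cone_suspension:
  fixes L :: "'a susp_point topology"
  assumes q: "cone_map L q" and q': "cone_map (suspension L) q'"
    and ae: "abs_extensor (topcone L q) Z" and Z: "normal_space Z"
  shows "abs_extensor (topcone (suspension L) q') Z"
proof -
  let ?P = "prod_topology (prod_topology L unit_interval) unit_interval"
  let ?C = "topcone L q" and ?C' = "topcone (suspension L) q'"
  have lc: "locally_compact_space unit_interval" "Hausdorff_space unit_interval \<or> regular_space unit_interval"
    using locally_compact_unit_interval by auto
  have p1: "continuous_map ?P L (\<lambda>x. fst (fst x))"
    using continuous_map_compose[OF continuous_map_fst continuous_map_fst] by (simp add: o_def)
  have "continuous_map ?P unit_interval (\<lambda>x. snd (fst x))"
    using continuous_map_compose[OF continuous_map_fst continuous_map_snd] by (simp add: o_def)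
  then have p2: "continuous_map ?P euclideanreal (\<lambda>x. snd (fst x))" by (rule continuous_map_into_fulltopology)
  have p3: "continuous_map ?P euclideanreal snd"
    using continuous_map_snd by (rule continuous_map_into_fulltopology)
  define Q1 where "Q1 x = q' (susp_proj (fst x), snd x)" for x :: "('a susp_point \<times> real) \<times> real"
  define Q2 where "Q2 x = (q (fst x), snd x)" for x :: "('a susp_point \<times> real) \<times> real"
  \<comment> \<open>Both spaces are quotients of \<open>L\<close> times a square, because quotient
    maps survive multiplication by the interval; so maps between them can be written in
    coordinates.\<close>
  have Q1: "quotient_map ?P ?C' Q1"
    using quotient_map_compose[OF quotient_map_prod_left[OF lc quotient_map_susp_proj[of L]] quotient_map_cone[of "suspension L" q']]
    by (simp add: o_def Q1_def[abs_def] case_prod_unfold)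
  have Q2: "quotient_map ?P (prod_topology ?C unit_interval) Q2"
    using quotient_map_prod_left[OF lc quotient_map_cone[of L q]]
    by (simp add: o_def Q2_def[abs_def] case_prod_unfold)
  define W where "W x = (2 * snd (fst x) - 1) * (1 - snd x)" for x :: "('a susp_point \<times> real) \<times> real"
  \<comment> \<open>\<open>S\<close> is 1 minus \<open>v - |w|\<close>, so exactly the two sides
    land in the apex of the cone over \<open>L\<close>; \<open>(1 + W x) / 2\<close> moves
    \<open>w\<close> from \<open>[-1, 1]\<close> to \<open>[0, 1]\<close>.\<close>
  define S where "S x = 1 - ((1 - snd x) - \<bar>W x\<bar>)" for x
  define H where "H x = (q (fst (fst x), S x), (1 + W x) / 2)" for x
  have Wb: "\<bar>W x\<bar> \<le> 1 - snd x" if "x \<in> topspace ?P" for x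
  proof -
    have "\<bar>W x\<bar> = \<bar>2 * snd (fst x) - 1\<bar> * (1 - snd x)" using that by (auto simp: W_def abs_mult)
    also have "\<dots> \<le> 1 * (1 - snd x)" using that by (intro mult_right_mono) auto
    finally show ?thesis by simp
  qed
  have Sb: "S x \<in> {0..1}" if "x \<in> topspace ?P" for x
    using Wb[OF that] that by (auto simp: S_def)
  have Wc: "continuous_map ?P euclideanreal W" unfolding W_def by (intro continuous_intros p2 p3) auto
  have Sc: "continuous_map ?P euclideanreal S" unfolding S_def by (intro continuous_intros continuous_map_real_abs p3 Wc) auto
  have Hc: "continuous_map ?P (prod_topology ?C unit_interval) H"
    unfolding H_def
  proof (intro continuous_map_pairedI)
    show "continuous_map ?P ?C (\<lambda>x. q (fst (fst x), S x))"
      by (rule continuous_map_into_cone[OF p1 Sc Sb])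
    have "continuous_map ?P euclideanreal (\<lambda>x. (1 + W x) / 2)"
      by (intro continuous_map_real_divide continuous_intros Wc) auto
    moreover have "(1 + W x) / 2 \<in> {0..1}" if "x \<in> topspace ?P" for x
      using Wb[OF that] that by auto
    ultimately show "continuous_map ?P unit_interval (\<lambda>x. (1 + W x) / 2)"
      by (auto simp: continuous_map_in_subtopology)
  qed
  have sp: "susp_proj y \<in> topspace (suspension L)" if "y \<in> topspace L \<times> {0..1}" for y
    using that unfolding topspace_suspension by blast
  have Hwd: "H x = H y" if x: "x \<in> topspace ?P" and y: "y \<in> topspace ?P" and "Q1 x = Q1 y" for x y
  proof -
    obtain l \<theta> r where xe: "x = ((l, \<theta>), r)" by (metis surj_pair)
    obtain l2 \<theta>2 r2 where ye: "y = ((l2, \<theta>2), r2)" by (metis surj_pair)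
    have b: "l \<in> topspace L" "\<theta> \<in> {0..1}" "r \<in> {0..1}" "l2 \<in> topspace L" "\<theta>2 \<in> {0..1}" "r2 \<in> {0..1}"
      using x y xe ye by auto
    have "(susp_proj (l, \<theta>) = susp_proj (l2, \<theta>2) \<and> r = r2) \<or> (r = 1 \<and> r2 = 1)"
      using that(3) cone_mapD[OF q' sp sp, of "(l,\<theta>)" "(l2,\<theta>2)" r r2] b by (simp add: Q1_def xe ye)
    then consider "l = l2" "\<theta> = \<theta>2" "r = r2" | "\<theta> = \<theta>2" "\<theta> = 0 \<or> \<theta> = 1" "r = r2" | "r = 1" "r2 = 1"
      by (auto simp: susp_proj_def split: if_splits)
    then show ?thesis
    proof cases
      case 1
      then show ?thesis by (simp add: xe ye)
    next
      case 2
      then have "W x = W y" by (simp add: W_def xe ye)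
      moreover have "S x = 1" "S y = 1" using 2 b by (auto simp: S_def W_def xe ye)
      ultimately show ?thesis using cone_mapD[OF q b(1,4), of 1 1] by (simp add: H_def xe ye)
    next
      case 3
      then have "W x = 0" "W y = 0" "S x = 1" "S y = 1" by (auto simp: S_def W_def xe ye)
      then show ?thesis using cone_mapD[OF q b(1,4), of 1 1] by (simp add: H_def xe ye)
    qed
  qed
  obtain i where i: "continuous_map ?C' (prod_topology ?C unit_interval) i"
     "\<And>x. x \<in> topspace ?P \<Longrightarrow> i (Q1 x) = H x"
    using quotient_map_lift[OF Q1 Hc Hwd] by blast
  define w where "w x = 2 * snd x - 1" for x :: "('a susp_point \<times> real) \<times> real"
  \<comment> \<open>Solving the formula for \<open>S\<close> gives \<open>v = 1 - s + |w|\<close>;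
    the cut at 1 retracts the rest of the square to the triangle.\<close>
  define v where "v x = min 1 (1 - snd (fst x) + \<bar>w x\<bar>)" for x
  \<comment> \<open>Division by 0 yields 0, so \<open>\<theta>\<close> is 1/2 where \<open>v\<close>
    vanishes, a harmless value at the apex.\<close>
  define \<theta> where "\<theta> x = (w x / v x + 1) / 2" for x
  define J where "J x = q' (susp_proj (fst (fst x), \<theta> x), 1 - v x)" for x
  have wv: "\<bar>w x\<bar> \<le> v x" "v x \<in> {0..1}" if "x \<in> topspace ?P" for x
    using that by (auto simp: w_def v_def)
  have wc: "continuous_map ?P euclideanreal w" unfolding w_def by (intro continuous_intros p3) auto
  have vc: "continuous_map ?P euclideanreal v"
    unfolding v_def by (intro continuous_map_real_min continuous_intros continuous_map_real_abs p2 wc) auto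
  have \<theta>b: "\<theta> x \<in> {0..1}" if "x \<in> topspace ?P" for x
  proof -
    have "\<bar>w x / v x\<bar> \<le> 1" using wv[OF that] by (auto simp: divide_le_eq_1)
    then have "- 1 \<le> w x / v x" "w x / v x \<le> 1" unfolding abs_le_iff by linarith+
    then show ?thesis by (simp add: \<theta>_def)
  qed
  have Jc: "continuous_map ?P ?C' J"
    unfolding J_def
  proof (rule continuous_map_into_cone_suspension[OF p1 vc wv(2) _ \<theta>b q'])
    show "continuous_map (subtopology ?P {z \<in> topspace ?P. v z \<noteq> 0}) euclideanreal \<theta>"
      unfolding \<theta>_def
      by (intro continuous_map_real_divide continuous_intros continuous_map_from_subtopology wc vc) auto
  qed
  have Jwd: "J x = J y" if x: "x \<in> topspace ?P" and y: "y \<in> topspace ?P" and "Q2 x = Q2 y" for x y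
  proof -
    obtain l s u where xe: "x = ((l, s), u)" by (metis surj_pair)
    obtain l2 s2 u2 where ye: "y = ((l2, s2), u2)" by (metis surj_pair)
    have b: "l \<in> topspace L" "s \<in> {0..1}" "u \<in> {0..1}" "l2 \<in> topspace L" "s2 \<in> {0..1}" "u2 \<in> {0..1}"
      using x y xe ye by auto
    have u: "u = u2" and "(l = l2 \<and> s = s2) \<or> (s = 1 \<and> s2 = 1)"
      using that(3) cone_mapD[OF q b(1,4) b(2,5)] by (auto simp: Q2_def xe ye)
    then consider "x = y" | "s = 1" "s2 = 1" using u by (auto simp: xe ye)
    then show ?thesis
    proof cases
      case 2
      have wxy: "w x = w y" by (simp add: w_def xe ye u)
      then have vxy: "v x = v y" "v x = \<bar>w x\<bar>" using 2 b by (auto simp: v_def xe ye w_def)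
      then have \<theta>xy: "\<theta> x = \<theta> y" by (simp add: \<theta>_def wxy)
      show ?thesis
      proof (cases "v x = 0")
        case True
        have "q' (susp_proj (l, \<theta> x), 1) = q' (susp_proj (l2, \<theta> y), 1)"
          using cone_mapD[OF q' sp sp, of "(l, \<theta> x)" "(l2, \<theta> y)" 1 1] b \<theta>b[OF x] \<theta>b[OF y] by simp
        then show ?thesis using True vxy by (simp add: J_def xe ye)
      next
        case False
        \<comment> \<open>At \<open>s = 1\<close> the value \<open>v\<close> equals
          \<open>|w|\<close>, so \<open>\<theta>\<close> is at a pole and the coordinate in
          \<open>L\<close> is forgotten.\<close>
        then have "w x / v x = 1 \<or> w x / v x = -1" using vxy by (auto simp: field_simps abs_if split: if_splits)
        then have "\<theta> x = 1 \<or> \<theta> x = 0" by (auto simp: \<theta>_def)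
        then show ?thesis using \<theta>xy vxy by (auto simp: J_def xe ye)
      qed
    qed simp
  qed
  obtain r where r: "continuous_map (prod_topology ?C unit_interval) ?C' r"
     "\<And>x. x \<in> topspace ?P \<Longrightarrow> r (Q2 x) = J x"
    using quotient_map_lift[OF Q2 Jc Jwd] by blast
  have "r (i z) = z" if z: "z \<in> topspace ?C'" for z
  proof -
    obtain x where x: "x \<in> topspace ?P" "z = Q1 x"
      using Q1 z unfolding quotient_map_def by blast
    obtain l \<theta>0 r0 where xe: "x = ((l, \<theta>0), r0)" by (metis surj_pair)
    have b: "l \<in> topspace L" "\<theta>0 \<in> {0..1}" "r0 \<in> {0..1}" using x xe by auto
    define y where "y = ((l, S x), (1 + W x) / 2)"
    have y: "y \<in> topspace ?P" using b Sb[OF x(1)] Wb[OF x(1)] by (auto simp: y_def xe)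
    have "i z = Q2 y" using i(2)[OF x(1)] x(2) by (simp add: H_def Q2_def y_def xe)
    then have rz: "r (i z) = J y" using r(2)[OF y] by simp
    have wy: "w y = W x" by (simp add: w_def y_def field_simps)
    have vy: "v y = 1 - r0" using b Wb[OF x(1)] by (simp add: v_def wy) (simp add: y_def S_def xe)
    have "J y = q' (susp_proj (l, \<theta> y), r0)" by (simp add: J_def vy) (simp add: y_def)
    also have "\<dots> = q' (susp_proj (l, \<theta>0), r0)"
    proof (cases "r0 = 1")
      case True
      then show ?thesis
        using cone_mapD[OF q' sp sp, of "(l, \<theta> y)" "(l, \<theta>0)" 1 1] b \<theta>b[OF y] by simp
    next
      case False
      then have "\<theta> y = \<theta>0" by (simp add: \<theta>_def wy vy) (simp add: W_def xe)
      then show ?thesis by simp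
    qed
    finally show ?thesis using rz x(2) by (simp add: Q1_def xe)
  qed
  then show ?thesis
    by (rule abs_extensor_retract[OF abs_extensor_prod_unit_interval[OF ae Z] i(1) r(1)])
qed

lemma abs_extensor_cone_iterated_suspension:
  assumes q: "cone_map K q" and ae: "abs_extensor (topcone K q) Z" and Z: "normal_space Z"
  shows "abs_extensor (topcone (iterated_suspension m K) std_cone_map) Z"
proof (induction m)
  case 0
  let ?L = "iterated_suspension 0 K"
  obtain r where r: "homeomorphic_maps K ?L Base r"
    using homeomorphic_map_iterated_suspension_0 homeomorphic_map_maps by blast
  then have r1: "continuous_map ?L K r" "continuous_map K ?L Base"
     "\<And>z. z \<in> topspace ?L \<Longrightarrow> Base (r z) = z"
    by (auto simp: homeomorphic_maps_def)
  obtain F where F: "continuous_map (topcone ?L std_cone_map) (topcone K q) F"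
    "\<And>p t. p \<in> topspace ?L \<Longrightarrow> t \<in> {0..1} \<Longrightarrow> F (std_cone_map (p, t)) = q (r p, t)"
    by (rule cone_functorial[OF cone_map_std q r1(1)]) (rule that)
  obtain G where G: "continuous_map (topcone K q) (topcone ?L std_cone_map) G"
    "\<And>p t. p \<in> topspace K \<Longrightarrow> t \<in> {0..1} \<Longrightarrow> G (q (p, t)) = std_cone_map (Base p, t)"
    by (rule cone_functorial[OF q cone_map_std r1(2)]) (rule that)
  have "G (F z) = z" if z: "z \<in> topspace (topcone ?L std_cone_map)" for z
  proof -
    obtain p t where p: "z = std_cone_map (p, t)" "p \<in> topspace ?L" "t \<in> {0..1}"
      using z unfolding topspace_cone by blast
    have "r p \<in> topspace K" using continuous_map_image_subset_topspace[OF r1(1)] p(2) by blast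
    then show ?thesis using F(2)[OF p(2,3)] G(2)[of "r p" t] p r1(3)[OF p(2)] by simp
  qed
  then show ?case by (rule abs_extensor_retract[OF ae F(1) G(1)])
next
  case (Suc m)
  then show ?case
    using abs_extensor_cone_suspension[OF cone_map_std cone_map_std _ Z] by simp
qed

section \<open>Cones over CW-complexes\<close>

definition nrm :: "nat \<Rightarrow> (nat \<Rightarrow> real) \<Rightarrow> real" where
  "nrm n x = sqrt (\<Sum>i<n. (x i)\<^sup>2)"

lemma nrm_nonneg: "0 \<le> nrm n x"
  by (simp add: nrm_def sum_nonneg)

lemma nrm_scale: "0 \<le> c \<Longrightarrow> nrm n (\<lambda>i. c * x i) = c * nrm n x"
  by (simp add: nrm_def power_mult_distrib real_sqrt_mult flip: sum_distrib_left)

lemma nrm_cong: "(\<And>i. i < n \<Longrightarrow> x i = y i) \<Longrightarrow> nrm n x = nrm n y"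
  by (simp add: nrm_def)

lemma nrm_Suc: "nrm (Suc n) x = sqrt ((nrm n x)\<^sup>2 + (x n)\<^sup>2)"
  by (simp add: nrm_def sum_nonneg)

lemma abs_le_nrm: "i < n \<Longrightarrow> \<bar>x i\<bar> \<le> nrm n x"
  unfolding nrm_def by (rule real_le_rsqrt) (auto simp: intro!: member_le_sum)

lemma nrm_le_nrm_Suc: "nrm n x \<le> nrm (Suc n) x"
  by (simp add: nrm_def)

lemma topspace_ndisk: "topspace (ndisk n) = {x. (\<forall>i\<ge>n. x i = 0) \<and> nrm n x \<le> 1}"
  by (auto simp: ndisk_def topspace_Euclidean_space nrm_def)

lemma ndisk_interior_iff: "x \<in> ndisk_interior n \<longleftrightarrow> x \<in> topspace (ndisk n) \<and> nrm n x < 1"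
  by (auto simp: ndisk_interior_def nrm_def)

lemma ndisk_boundary_iff: "x \<in> ndisk_boundary n \<longleftrightarrow> x \<in> topspace (ndisk n) \<and> x \<notin> ndisk_interior n"
  by (auto simp: ndisk_boundary_def ndisk_interior_def ndisk_def)

lemma ndisk_eq: "ndisk n = subtopology (powertop_real UNIV) (topspace (ndisk n))"
proof -
  have "ndisk n = subtopology (powertop_real UNIV) ({x. \<forall>i\<ge>n. x i = 0} \<inter> {x. (\<Sum>i<n. (x i)\<^sup>2) \<le> 1})"
    by (simp add: ndisk_def Euclidean_space_def subtopology_subtopology)
  also have "{x. \<forall>i\<ge>n. x i = 0} \<inter> {x. (\<Sum>i<n. (x i)\<^sup>2) \<le> 1} = topspace (ndisk n)"
    by (auto simp: ndisk_def topspace_Euclidean_space)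
  finally show ?thesis .
qed

lemma continuous_map_ndisk_coordinate: "continuous_map (ndisk n) euclideanreal (\<lambda>x. x i)"
  by (subst ndisk_eq) (intro continuous_map_from_subtopology continuous_map_product_projection, simp)

lemma continuous_map_into_ndisk:
  assumes "\<And>i. continuous_map Z euclideanreal (\<lambda>z. f z i)" "\<And>z. z \<in> topspace Z \<Longrightarrow> f z \<in> topspace (ndisk n)"
  shows "continuous_map Z (ndisk n) f"
  by (subst ndisk_eq) (use assms in \<open>auto simp: continuous_map_in_subtopology continuous_map_componentwise_UNIV\<close>)

lemma Hausdorff_ndisk: "Hausdorff_space (ndisk n)"
  by (subst ndisk_eq) (intro Hausdorff_space_subtopology, simp add: Hausdorff_space_product_topology)

text \<open>The disk is closed in the product of the intervals \<open>[-1, 1]\<close>, which is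
  compact by Tychonoff's theorem.\<close>

lemma compact_ndisk: "compact_space (ndisk n)"
proof -
  let ?R = "powertop_real UNIV"
  have pr: "continuous_map ?R euclideanreal (\<lambda>x. x i)" for i :: nat
    by (rule continuous_map_product_projection) simp
  have c: "compactin ?R (PiE UNIV (\<lambda>_. {-1..1}))"
    by (simp add: compactin_PiE)
  have sub: "topspace (ndisk n) \<subseteq> PiE UNIV (\<lambda>_. {-1..1})"
  proof
    fix x assume x: "x \<in> topspace (ndisk n)"
    have "\<bar>x i\<bar> \<le> 1" for i
      using x abs_le_nrm[of i n x] by (cases "i < n") (auto simp: topspace_ndisk)
    then show "x \<in> PiE UNIV (\<lambda>_. {-1..1})" by (auto simp: abs_le_iff)
  qed
  have "closedin ?R (\<Inter>(insert {x \<in> topspace ?R. (\<Sum>i<n. (x i)\<^sup>2) \<le> 1} ((\<lambda>i. {x \<in> topspace ?R. x i = 0}) ` {n..})))"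
  proof (rule closedin_Inter)
    fix S assume "S \<in> insert {x \<in> topspace ?R. (\<Sum>i<n. (x i)\<^sup>2) \<le> 1} ((\<lambda>i. {x \<in> topspace ?R. x i = 0}) ` {n..})"
    then consider "S = {x \<in> topspace ?R. (\<Sum>i<n. (x i)\<^sup>2) \<le> 1}" | i where "S = {x \<in> topspace ?R. x i = 0}" by blast
    then show "closedin ?R S"
    proof cases
      case 1
      have "continuous_map ?R euclideanreal (\<lambda>x. \<Sum>i<n. (x i)\<^sup>2)"
        by (intro continuous_map_sum continuous_map_real_pow pr) simp
      then show ?thesis unfolding 1 by (rule closedin_le_continuous_maps) simp
    next
      case 2
      show ?thesis unfolding 2 by (rule closedin_eq_continuous_maps[OF pr]) simp
    qed
  qed simp
  also have "\<Inter>(insert {x \<in> topspace ?R. (\<Sum>i<n. (x i)\<^sup>2) \<le> 1} ((\<lambda>i. {x \<in> topspace ?R. x i = 0}) ` {n..}))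
      = topspace (ndisk n)"
    by (auto simp: ndisk_def topspace_Euclidean_space)
  finally have "compactin ?R (topspace (ndisk n))"
    by (rule closed_compactin[OF c sub])
  then show ?thesis by (subst ndisk_eq) (rule compact_space_subtopology)
qed

text \<open>A squeeze at the zeros of \<open>\<rho>\<close>, meant for rescalings along rays, whose
  formula divides by a quantity vanishing at the origin.\<close>

lemma continuous_map_dominated:
  assumes \<rho>: "continuous_map Z euclideanreal \<rho>" and F: "continuous_map (subtopology Z {z \<in> topspace Z. \<rho> z \<noteq> 0}) euclideanreal F"
    and le: "\<And>z. z \<in> topspace Z \<Longrightarrow> \<bar>F z\<bar> \<le> \<rho> z"
  shows "continuous_map Z euclideanreal F"
  unfolding continuous_map_def
proof (intro conjI allI impI)
  let ?V = "{z \<in> topspace Z. \<rho> z \<noteq> 0}"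
  have V: "openin Z ?V"
  proof -
    have "openin Z {z \<in> topspace Z. \<rho> z \<in> - {0}}" by (rule openin_continuous_map_preimage[OF \<rho>]) auto
    then show ?thesis by simp
  qed
  fix U :: "real set" assume U: "openin euclideanreal U"
  show "openin Z {z \<in> topspace Z. F z \<in> U}"
  proof (subst openin_subopen, intro ballI)
    fix z0 assume z0: "z0 \<in> {z \<in> topspace Z. F z \<in> U}"
    show "\<exists>T. openin Z T \<and> z0 \<in> T \<and> T \<subseteq> {z \<in> topspace Z. F z \<in> U}"
    proof (cases "\<rho> z0 = 0")
      case False
      have "openin (subtopology Z ?V) {z \<in> topspace (subtopology Z ?V). F z \<in> U}"
        by (rule openin_continuous_map_preimage[OF F U])
      then have "openin Z {z \<in> topspace (subtopology Z ?V). F z \<in> U}"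
        using V by (rule openin_trans_full)
      then show ?thesis using z0 False by (intro exI[of _ "{z \<in> topspace (subtopology Z ?V). F z \<in> U}"]) auto
    next
      case True
      then have "F z0 = 0" using le[of z0] z0 by simp
      then obtain e where e: "e > 0" "\<And>y. \<bar>y\<bar> < e \<Longrightarrow> y \<in> U"
        using U z0 by (auto simp: open_dist dist_real_def)
      have "openin Z {z \<in> topspace Z. \<rho> z \<in> {..<e}}"
        by (rule openin_continuous_map_preimage[OF \<rho>]) auto
      moreover have "z0 \<in> {z \<in> topspace Z. \<rho> z \<in> {..<e}}" using z0 True e by simp
      moreover have "{z \<in> topspace Z. \<rho> z \<in> {..<e}} \<subseteq> {z \<in> topspace Z. F z \<in> U}"
        using le e(2) by force
      ultimately show ?thesis by blast
    qed
  qed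
qed simp

text \<open>The disk of dimension \<open>n + 1\<close> and the cylinder over the disk of dimension \<open>n\<close> are the unit
  balls of the Euclidean norm and of the norm \<open>max (nrm n v) |v n|\<close>; the homeomorphism rescales
  along rays.\<close>

lemma ndisk_Suc_cylinder:
  obtains \<psi> \<zeta> where "homeomorphic_maps (ndisk (Suc n)) (prod_topology (ndisk n) unit_interval) \<psi> \<zeta>"
    "\<And>v. v \<in> topspace (ndisk (Suc n)) \<Longrightarrow>
      v \<in> ndisk_interior (Suc n) \<longleftrightarrow> \<psi> v \<in> ndisk_interior n \<times> {0<..<1}"
proof -
  let ?r = "nrm (Suc n)"
  let ?C = "prod_topology (ndisk n) unit_interval"
  define M where "M v = max (nrm n v) \<bar>v n\<bar>" for v
  \<comment> \<open>The factor exchanges the norms: \<open>M (\<sigma> v)\<close> is the Euclidean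
    norm of \<open>v\<close>. At the origin the quotient 0/0 is 0 and the origin is fixed.\<close>
  define \<sigma> where "\<sigma> v = (\<lambda>i. (?r v / M v) * v i)" for v
  define \<tau> where "\<tau> v = (\<lambda>i. (M v / ?r v) * v i)" for v
  define pr where "pr v = ((\<lambda>i. if i < n then v i else 0 :: real), (1 + v n) / 2)" for v
  define em where "em w = (\<lambda>i. if i < n then fst w i else if i = n then 2 * snd w - 1 else 0 :: real)"
    for w :: "(nat \<Rightarrow> real) \<times> real"
  have M0: "0 \<le> M v" for v using nrm_nonneg[of n v] by (simp add: M_def)
  have r0: "0 \<le> ?r v" for v by (rule nrm_nonneg)
  have Mr: "M v \<le> ?r v" for v
    using nrm_le_nrm_Suc[of n v] abs_le_nrm[of n "Suc n" v] by (simp add: M_def)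
  have rM: "M v = 0 \<longleftrightarrow> ?r v = 0" for v
  proof
    assume "M v = 0"
    then have "nrm n v = 0" "v n = 0" using nrm_nonneg[of n v] by (auto simp: M_def max_def split: if_splits)
    then show "?r v = 0" by (simp add: nrm_Suc)
  next
    assume "?r v = 0"
    then show "M v = 0" using Mr[of v] M0[of v] by linarith
  qed
  have rs: "?r (\<lambda>i. c * v i) = c * ?r v" "M (\<lambda>i. c * v i) = c * M v" if "0 \<le> c" for c v
    using that by (simp_all add: nrm_scale M_def abs_mult max_mult_distrib_left)
  have zero: "v = (\<lambda>i. 0)" if "\<forall>i\<ge>Suc n. v i = 0" "?r v = 0" for v
  proof
    fix i show "v i = 0" using that abs_le_nrm[of i "Suc n" v] by (cases "i < Suc n") auto
  qed
  have M\<sigma>: "M (\<sigma> v) = ?r v" for v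
    using rs(2)[of "?r v / M v" v] r0[of v] M0[of v] rM[of v] by (auto simp: \<sigma>_def)
  have r\<tau>: "?r (\<tau> v) = M v" for v
    using rs(1)[of "M v / ?r v" v] r0[of v] M0[of v] rM[of v] by (auto simp: \<tau>_def)
  have \<tau>\<sigma>: "\<tau> (\<sigma> v) = v" if "\<forall>i\<ge>Suc n. v i = 0" for v
  proof (cases "?r v = 0")
    case True
    then show ?thesis using zero[OF that] by (simp add: \<tau>_def \<sigma>_def)
  next
    case False
    have "?r (\<sigma> v) = ?r v / M v * ?r v"
      using rs(1)[of "?r v / M v" v] r0[of v] M0[of v] by (simp add: \<sigma>_def)
    then show ?thesis using False rM[of v] unfolding \<tau>_def M\<sigma> by (simp add: \<sigma>_def field_simps)
  qed
  have \<sigma>\<tau>: "\<sigma> (\<tau> v) = v" if "\<forall>i\<ge>Suc n. v i = 0" for v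
  proof (cases "?r v = 0")
    case True
    then show ?thesis using zero[OF that] by (simp add: \<tau>_def \<sigma>_def)
  next
    case False
    have "M (\<tau> v) = M v / ?r v * M v"
      using rs(2)[of "M v / ?r v" v] r0[of v] M0[of v] by (simp add: \<tau>_def)
    then show ?thesis using False rM[of v] unfolding \<sigma>_def r\<tau> by (simp add: \<tau>_def field_simps)
  qed
  have prem: "pr (em w) = w" if "\<forall>i\<ge>n. fst w i = 0" for w
    using that by (cases w) (auto simp: pr_def em_def fun_eq_iff)
  have empr: "em (pr v) = v" if "\<forall>i\<ge>Suc n. v i = 0" for v
    using that by (auto simp: pr_def em_def fun_eq_iff field_simps)
  have nrmpr: "nrm n (fst (pr v)) = nrm n v" for v
    by (rule nrm_cong) (simp add: pr_def)
  have sndpr: "(snd (pr v) \<in> {0..1} \<longleftrightarrow> \<bar>v n\<bar> \<le> 1)" "(snd (pr v) \<in> {0<..<1} \<longleftrightarrow> \<bar>v n\<bar> < 1)" for v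
    by (auto simp: pr_def abs_le_iff abs_less_iff)
  have pr1: "pr v \<in> topspace ?C \<longleftrightarrow> M v \<le> 1" for v
    using nrmpr[of v] sndpr(1)[of v] by (cases "pr v") (auto simp: topspace_ndisk M_def pr_def)
  have pr2: "pr v \<in> ndisk_interior n \<times> {0<..<1} \<longleftrightarrow> M v < 1" for v
    using nrmpr[of v] sndpr(2)[of v]
    by (cases "pr v") (auto simp: ndisk_interior_iff topspace_ndisk M_def pr_def)
  have top: "v \<in> topspace (ndisk (Suc n)) \<longleftrightarrow> (\<forall>i\<ge>Suc n. v i = 0) \<and> ?r v \<le> 1" for v
    by (simp add: topspace_ndisk)
  have \<sigma>0: "\<forall>i\<ge>Suc n. \<sigma> v i = 0" if "\<forall>i\<ge>Suc n. v i = 0" for v using that by (simp add: \<sigma>_def)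
  have em0: "\<forall>i\<ge>Suc n. em w i = 0" for w by (auto simp: em_def)
  have \<psi>top: "pr (\<sigma> v) \<in> topspace ?C" if "v \<in> topspace (ndisk (Suc n))" for v
    using that by (simp add: pr1 M\<sigma> top del: topspace_prod_topology)
  have wz: "\<forall>i\<ge>n. fst w i = 0" if "w \<in> topspace ?C" for w using that by (auto simp: topspace_ndisk)
  have \<zeta>top: "\<tau> (em w) \<in> topspace (ndisk (Suc n))" if "w \<in> topspace ?C" for w
  proof -
    have "M (em w) \<le> 1" using pr1[of "em w"] prem[OF wz[OF that]] that by simp
    moreover have "\<forall>i\<ge>Suc n. \<tau> (em w) i = 0" using em0[of w] by (simp add: \<tau>_def)
    ultimately show ?thesis unfolding top r\<tau> by blast
  qed
  have inv1: "\<tau> (em (pr (\<sigma> v))) = v" if "v \<in> topspace (ndisk (Suc n))" for v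
    using that empr[OF \<sigma>0] \<tau>\<sigma> by (simp add: top)
  have inv2: "pr (\<sigma> (\<tau> (em w))) = w" if "w \<in> topspace ?C" for w
    using \<sigma>\<tau>[OF em0] prem[OF wz[OF that]] by simp
  have rc: "continuous_map (ndisk (Suc n)) euclideanreal ?r"
  proof -
    have "continuous_map (ndisk (Suc n)) euclideanreal (\<lambda>x. \<Sum>i<Suc n. (x i)\<^sup>2)"
      by (intro continuous_map_sum continuous_map_real_pow continuous_map_ndisk_coordinate) simp
    moreover have "continuous_map euclideanreal euclideanreal sqrt"
      by (simp add: continuous_on_real_sqrt continuous_on_id)
    ultimately have "continuous_map (ndisk (Suc n)) euclideanreal (sqrt \<circ> (\<lambda>x. \<Sum>i<Suc n. (x i)\<^sup>2))"
      by (rule continuous_map_compose)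
    then show ?thesis by (simp add: nrm_def[abs_def] o_def)
  qed
  have nc: "continuous_map (ndisk (Suc n)) euclideanreal (nrm n)"
  proof -
    have "continuous_map (ndisk (Suc n)) euclideanreal (\<lambda>x. \<Sum>i<n. (x i)\<^sup>2)"
      by (intro continuous_map_sum continuous_map_real_pow continuous_map_ndisk_coordinate) simp
    moreover have "continuous_map euclideanreal euclideanreal sqrt"
      by (simp add: continuous_on_real_sqrt continuous_on_id)
    ultimately have "continuous_map (ndisk (Suc n)) euclideanreal (sqrt \<circ> (\<lambda>x. \<Sum>i<n. (x i)\<^sup>2))"
      by (rule continuous_map_compose)
    then show ?thesis by (simp add: nrm_def[abs_def] o_def)
  qed
  have Mc: "continuous_map (ndisk (Suc n)) euclideanreal M"
    unfolding M_def by (intro continuous_map_real_max continuous_map_real_abs nc continuous_map_ndisk_coordinate)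
  have \<sigma>c: "continuous_map (ndisk (Suc n)) euclideanreal (\<lambda>v. \<sigma> v i)" if i: "i \<le> n" for i
  proof (rule continuous_map_dominated[OF rc])
    show "continuous_map (subtopology (ndisk (Suc n)) {z \<in> topspace (ndisk (Suc n)). ?r z \<noteq> 0}) euclideanreal (\<lambda>v. \<sigma> v i)"
      unfolding \<sigma>_def
      by (intro continuous_map_real_mult continuous_map_real_divide continuous_map_from_subtopology rc Mc
          continuous_map_ndisk_coordinate) (auto simp: rM)
    show "\<bar>\<sigma> v i\<bar> \<le> ?r v" for v
    proof -
      have "\<bar>\<sigma> v i\<bar> \<le> M (\<sigma> v)"
        using abs_le_nrm[of i n "\<sigma> v"] i by (cases "i < n") (auto simp: M_def)
      then show ?thesis by (simp add: M\<sigma>)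
    qed
  qed
  have \<psi>c: "continuous_map (ndisk (Suc n)) ?C (\<lambda>v. pr (\<sigma> v))"
    unfolding pr_def
  proof (intro continuous_map_pairedI continuous_map_into_ndisk)
    show "continuous_map (ndisk (Suc n)) euclideanreal (\<lambda>v. (\<lambda>i. if i < n then \<sigma> v i else 0) i)" for i
      using \<sigma>c[of i] by (cases "i < n") auto
    show "(\<lambda>i. if i < n then \<sigma> z i else 0) \<in> topspace (ndisk n)" if "z \<in> topspace (ndisk (Suc n))" for z
      using \<psi>top[OF that] by (auto simp: pr_def)
    have "continuous_map (ndisk (Suc n)) euclideanreal (\<lambda>v. (1 + \<sigma> v n) / 2)"
      by (intro continuous_map_real_divide continuous_intros \<sigma>c) auto
    then show "continuous_map (ndisk (Suc n)) unit_interval (\<lambda>v. (1 + \<sigma> v n) / 2)"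
      using \<psi>top by (auto simp: continuous_map_in_subtopology pr_def simp del: topspace_prod_topology) (auto simp: topspace_prod_topology)
  qed
  \<comment> \<open>A continuous bijection from a compact space to a Hausdorff space has a
    continuous inverse, so no formula for the inverse has to be examined at the origin.\<close>
  have hm: "homeomorphic_map (ndisk (Suc n)) ?C (\<lambda>v. pr (\<sigma> v))"
  proof (rule continuous_imp_homeomorphic_map[OF \<psi>c compact_ndisk])
    show "Hausdorff_space ?C"
      using Hausdorff_ndisk locally_compact_unit_interval(2) by (simp add: Hausdorff_space_prod_topology)
    show "(\<lambda>v. pr (\<sigma> v)) ` topspace (ndisk (Suc n)) = topspace ?C"
    proof
      show "topspace ?C \<subseteq> (\<lambda>v. pr (\<sigma> v)) ` topspace (ndisk (Suc n))"
        using inv2 \<zeta>top by (metis image_eqI subsetI)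
    qed (use \<psi>top in blast)
    show "inj_on (\<lambda>v. pr (\<sigma> v)) (topspace (ndisk (Suc n)))"
      by (rule inj_onI) (metis inv1)
  qed
  then obtain \<zeta> where "homeomorphic_maps (ndisk (Suc n)) ?C (\<lambda>v. pr (\<sigma> v)) \<zeta>"
    using homeomorphic_map_maps by blast
  moreover have "v \<in> ndisk_interior (Suc n) \<longleftrightarrow> pr (\<sigma> v) \<in> ndisk_interior n \<times> {0<..<1}"
    if "v \<in> topspace (ndisk (Suc n))" for v
    unfolding pr2 M\<sigma> using that by (simp add: ndisk_interior_iff)
  ultimately show thesis by (rule that)
qed

section \<open>The cone as a contractible CW-complex\<close>

lemma embedding_map_left_inverse:
  assumes f: "continuous_map A C f" "f ` topspace A \<subseteq> V"
    and g: "continuous_map (subtopology C V) A g" "\<And>x. x \<in> topspace A \<Longrightarrow> g (f x) = x"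
  shows "embedding_map A C f"
proof -
  have "continuous_map A (subtopology C V) f"
    using f by (auto simp: continuous_map_in_subtopology)
  then have "section_map A (subtopology C V) f"
    unfolding section_map_def retraction_maps_def using g by blast
  then show ?thesis
    using section_imp_embedding_map embedding_map_in_subtopology by blast
qed

text \<open>Points at different heights are separated by \<open>\<eta>\<close>; distinct points at
  equal height lie below the apex, where \<open>\<beta>\<close> separates them.\<close>

lemma Hausdorff_topcone:
  assumes L: "Hausdorff_space L" and q: "cone_map L q"
  shows "Hausdorff_space (topcone L q)"
proof -
  let ?C = "topcone L q"
  obtain \<eta> \<beta> where \<eta>: "continuous_map ?C euclideanreal \<eta>"
    and \<beta>: "continuous_map (subtopology ?C {z \<in> topspace ?C. \<eta> z \<in> {..<1}}) L \<beta>"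
    and \<eta>q: "\<And>p t. p \<in> topspace L \<Longrightarrow> t \<in> {0..1} \<Longrightarrow> \<eta> (q (p, t)) = t"
    and \<beta>q: "\<And>p t. p \<in> topspace L \<Longrightarrow> t \<in> {0..<1} \<Longrightarrow> \<beta> (q (p, t)) = p"
    by (rule cone_coordinates[OF q]) (rule that)
  let ?V = "{z \<in> topspace ?C. \<eta> z \<in> {..<1}}"
  have V: "openin ?C ?V" by (rule openin_continuous_map_preimage[OF \<eta>]) auto
  show ?thesis
    unfolding Hausdorff_space_def
  proof (intro allI impI, elim conjE)
    fix x y assume x: "x \<in> topspace ?C" and y: "y \<in> topspace ?C" and ne: "x \<noteq> y"
    show "\<exists>U W. openin ?C U \<and> openin ?C W \<and> x \<in> U \<and> y \<in> W \<and> disjnt U W"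
    proof (cases "\<eta> x = \<eta> y")
      case False
      obtain U W where UW: "open U" "open W" "\<eta> x \<in> U" "\<eta> y \<in> W" "disjnt U W"
        using hausdorff[OF False] unfolding disjnt_def by blast
      have "openin ?C {z \<in> topspace ?C. \<eta> z \<in> U}" "openin ?C {z \<in> topspace ?C. \<eta> z \<in> W}"
        using UW by (auto intro!: openin_continuous_map_preimage[OF \<eta>])
      then show ?thesis
        using UW x y by (intro exI[of _ "{z \<in> topspace ?C. \<eta> z \<in> U}"] exI[of _ "{z \<in> topspace ?C. \<eta> z \<in> W}"])
          (auto simp: disjnt_iff)
    next
      case True
      obtain p t where p: "x = q (p, t)" "p \<in> topspace L" "t \<in> {0..1}" using x unfolding topspace_cone by blast
      obtain p' t' where p': "y = q (p', t')" "p' \<in> topspace L" "t' \<in> {0..1}" using y unfolding topspace_cone by blast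
      have t: "t = t'" using True \<eta>q p p' by simp
      have "t \<noteq> 1" "p \<noteq> p'" using ne cone_mapD[OF q p(2) p'(2) p(3) p'(3)] p(1) p'(1) t by auto
      then have t1: "t \<in> {0..<1}" using p(3) by auto
      obtain U W where UW: "openin L U" "openin L W" "p \<in> U" "p' \<in> W" "disjnt U W"
        using L \<open>p \<noteq> p'\<close> p(2) p'(2) unfolding Hausdorff_space_def by blast
      let ?U = "{z \<in> topspace (subtopology ?C ?V). \<beta> z \<in> U}"
      let ?W = "{z \<in> topspace (subtopology ?C ?V). \<beta> z \<in> W}"
      have "openin ?C ?U" "openin ?C ?W"
        using openin_trans_full[OF openin_continuous_map_preimage[OF \<beta> UW(1)] V]
          openin_trans_full[OF openin_continuous_map_preimage[OF \<beta> UW(2)] V] by simp_all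
      moreover have "x \<in> ?U" "y \<in> ?W"
        using x y p p' t t1 UW \<eta>q[OF p(2,3)] \<eta>q[OF p'(2,3)] \<beta>q[OF p(2) t1] \<beta>q[OF p'(2), of t'] by auto
      moreover have "disjnt ?U ?W" using UW(5) by (auto simp: disjnt_iff)
      ultimately show ?thesis by blast
    qed
  qed
qed

text \<open>The homotopy moves the height \<open>t\<close> linearly to 1, hence every point to the
  apex. It descends to the cone because the product of the interval with \<open>q\<close> is a
  quotient map.\<close>

lemma contractible_topcone:
  assumes q: "cone_map L q" and p0: "p0 \<in> topspace L"
  shows "contractible_space (topcone L q)"
proof -
  let ?C = "topcone L q" and ?P = "prod_topology unit_interval (prod_topology L unit_interval)"
  have qm: "quotient_map ?P (prod_topology unit_interval ?C) (\<lambda>x. (fst x, q (snd x)))"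
    using quotient_map_prod_right[OF locally_compact_unit_interval(1) disjI1[OF locally_compact_unit_interval(2)]
        quotient_map_cone[of L q]] by (simp add: case_prod_unfold)
  have 1: "continuous_map ?P L (\<lambda>x. fst (snd x))"
    using continuous_map_compose[OF continuous_map_snd continuous_map_fst] by (simp add: o_def)
  have "continuous_map ?P unit_interval (\<lambda>x. snd (snd x))"
    using continuous_map_compose[OF continuous_map_snd continuous_map_snd] by (simp add: o_def)
  then have 2: "continuous_map ?P euclideanreal (\<lambda>x. snd (snd x))"
    by (rule continuous_map_into_fulltopology)
  have 3: "continuous_map ?P euclideanreal fst"
    using continuous_map_fst by (rule continuous_map_into_fulltopology)
  define T where "T x = 1 - (1 - fst x) * (1 - snd (snd x))" for x :: "real \<times> 'a \<times> real"
  have Tb: "T x \<in> {0..1}" if "x \<in> topspace ?P" for x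
    using that mult_le_one[of "1 - fst x" "1 - snd (snd x)"] by (auto simp: T_def)
  have c: "continuous_map ?P ?C (\<lambda>x. q (fst (snd x), T x))"
  proof (rule continuous_map_into_cone[OF 1 _ Tb])
    show "continuous_map ?P euclideanreal T" unfolding T_def by (intro continuous_intros 2 3) auto
  qed
  have wd: "q (fst (snd x), T x) = q (fst (snd y), T y)"
    if x: "x \<in> topspace ?P" and y: "y \<in> topspace ?P" and eq: "(fst x, q (snd x)) = (fst y, q (snd y))" for x y
  proof -
    obtain s p t where xe: "x = (s, p, t)" by (metis surj_pair)
    obtain s' p' t' where ye: "y = (s', p', t')" by (metis surj_pair)
    have b: "p \<in> topspace L" "t \<in> {0..1}" "p' \<in> topspace L" "t' \<in> {0..1}" using x y xe ye by auto
    have s: "s = s'" and "(p = p' \<and> t = t') \<or> (t = 1 \<and> t' = 1)"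
      using eq cone_mapD[OF q b(1,3,2,4)] by (auto simp: xe ye)
    then show ?thesis
    proof (elim disjE)
      assume "t = 1 \<and> t' = 1"
      then show ?thesis using cone_mapD[OF q b(1,3), of 1 1] by (simp add: xe ye T_def)
    qed (simp add: xe ye T_def s)
  qed
  obtain H where H: "continuous_map (prod_topology unit_interval ?C) ?C H"
    "\<And>x. x \<in> topspace ?P \<Longrightarrow> H (fst x, q (snd x)) = q (fst (snd x), T x)"
    using quotient_map_lift[OF qm c wd] by blast
  have H0: "H (0, z) = z" "H (1, z) = q (p0, 1)" if z: "z \<in> topspace ?C" for z
  proof -
    obtain p t where p: "z = q (p, t)" "p \<in> topspace L" "t \<in> {0..1}" using z unfolding topspace_cone by blast
    show "H (0, z) = z" using H(2)[of "(0, p, t)"] p by (simp add: T_def)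
    show "H (1, z) = q (p0, 1)"
      using H(2)[of "(1, p, t)"] p cone_mapD[OF q p(2) p0, of 1 1] by (simp add: T_def)
  qed
  \<comment> \<open>\<open>homotopic_with\<close> prescribes the two ends at all values of the type,
    so \<open>H\<close> is redefined outside the cone.\<close>
  define H' where "H' x = (if snd x \<in> topspace ?C then H x else if fst x = 0 then snd x else q (p0, 1))" for x
  have "continuous_map (prod_topology unit_interval ?C) ?C H'"
    using H(1) by (rule continuous_map_eq) (auto simp: H'_def)
  moreover have "\<forall>x. H' (0, x) = id x" "\<forall>x. H' (1, x) = q (p0, 1)"
    using H0 by (auto simp: H'_def)
  ultimately have "homotopic_with (\<lambda>x. True) ?C ?C id (\<lambda>x. q (p0, 1))"
    unfolding homotopic_with_def by blast
  then show ?thesis unfolding contractible_space_def by blast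
qed

text \<open>The cells are the apex, the cells of \<open>K\<close> in the base, and one cell of
  dimension \<open>n + 1\<close> for each \<open>n\<close>-cell of \<open>K\<close>, the cylinder
  over a disk being itself a disk. The weak topology survives the product with the interval because
  the latter is locally compact.\<close>

lemma CW_complex_topcone:
  fixes q :: "'k \<times> real \<Rightarrow> 'c"
  assumes K: "CW_complex K" and q: "cone_map K q" and p0: "p0 \<in> topspace K"
  shows "CW_complex (topcone K q)"
proof -
  let ?C = "topcone K q"
  obtain E where E: "CW_structure K E" using K unfolding CW_complex_def by blast
  have K1: "Hausdorff_space K" using E by (simp add: CW_structure_def)
  have K2: "continuous_map (ndisk (fst c)) K (snd c)"
    and K3: "embedding_map (subtopology (ndisk (fst c)) (ndisk_interior (fst c))) K (snd c)" if "c \<in> E" for c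
    using E that by (auto simp: CW_structure_def)
  have K4: "disjnt (open_cell c) (open_cell d)" if "c \<in> E" "d \<in> E" "c \<noteq> d" for c d
    using E that by (auto simp: CW_structure_def pairwise_def)
  have K5: "(\<Union>c\<in>E. open_cell c) = topspace K" using E by (simp add: CW_structure_def)
  have K6: "\<exists>F\<subseteq>E. finite F \<and> (\<forall>d\<in>F. fst d < fst c) \<and> snd c ` ndisk_boundary (fst c) \<subseteq> (\<Union>d\<in>F. open_cell d)"
    if "c \<in> E" for c
  proof -
    have "\<forall>(n,\<phi>)\<in>E. \<exists>F\<subseteq>E. finite F \<and> (\<forall>d\<in>F. fst d < n) \<and> \<phi> ` ndisk_boundary n \<subseteq> (\<Union>d\<in>F. open_cell d)"
      using E by (simp add: CW_structure_def)
    then show ?thesis using that by (cases c) auto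
  qed
  have K7: "closedin K S" if "S \<subseteq> topspace K" "\<And>c. c \<in> E \<Longrightarrow> closedin K (S \<inter> closed_cell c)" for S
    using E that by (simp add: CW_structure_def)
  define P where "P n \<psi> \<zeta> \<longleftrightarrow> homeomorphic_maps (ndisk (Suc n)) (prod_topology (ndisk n) unit_interval) \<psi> \<zeta> \<and>
    (\<forall>v\<in>topspace (ndisk (Suc n)). v \<in> ndisk_interior (Suc n) \<longleftrightarrow> \<psi> v \<in> ndisk_interior n \<times> {0<..<1})"
    for n \<psi> \<zeta>
  have "\<exists>\<psi> \<zeta>. P n \<psi> \<zeta>" for n
  proof (rule ndisk_Suc_cylinder[of n])
    fix \<psi> \<zeta> assume "homeomorphic_maps (ndisk (Suc n)) (prod_topology (ndisk n) unit_interval) \<psi> \<zeta>"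
      "\<And>v. v \<in> topspace (ndisk (Suc n)) \<Longrightarrow>
        v \<in> ndisk_interior (Suc n) \<longleftrightarrow> \<psi> v \<in> ndisk_interior n \<times> {0<..<1}"
    then have "P n \<psi> \<zeta>" unfolding P_def by (intro conjI ballI)
    then show ?thesis by (intro exI)
  qed
  then obtain \<psi> \<zeta> where P: "\<And>n. P n (\<psi> n) (\<zeta> n)" by metis
  have \<psi>: "continuous_map (ndisk (Suc n)) (prod_topology (ndisk n) unit_interval) (\<psi> n)"
      "continuous_map (prod_topology (ndisk n) unit_interval) (ndisk (Suc n)) (\<zeta> n)"
      "\<And>v. v \<in> topspace (ndisk (Suc n)) \<Longrightarrow> \<zeta> n (\<psi> n v) = v"
      "\<And>w. w \<in> topspace (ndisk n) \<times> {0..1} \<Longrightarrow> \<psi> n (\<zeta> n w) = w"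
      "\<And>v. v \<in> topspace (ndisk (Suc n)) \<Longrightarrow> v \<in> ndisk_interior (Suc n) \<longleftrightarrow> \<psi> n v \<in> ndisk_interior n \<times> {0<..<1}" for n
    using P[of n] by (auto simp: P_def homeomorphic_maps_def)
  have \<psi>top: "\<psi> n v \<in> topspace (ndisk n) \<times> {0..1}" if "v \<in> topspace (ndisk (Suc n))" for n v
    using continuous_map_image_subset_topspace[OF \<psi>(1)[of n]] that by auto
  have \<zeta>top: "\<zeta> n w \<in> topspace (ndisk (Suc n))" if "w \<in> topspace (ndisk n) \<times> {0..1}" for n w
    using continuous_map_image_subset_topspace[OF \<psi>(2)[of n]] that by auto
  have int_top: "ndisk_interior n \<subseteq> topspace (ndisk n)" for n by (auto simp: ndisk_interior_def)
  have \<psi>im: "\<psi> n ` topspace (ndisk (Suc n)) = topspace (ndisk n) \<times> {0..1}" for n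
  proof
    show "\<psi> n ` topspace (ndisk (Suc n)) \<subseteq> topspace (ndisk n) \<times> {0..1}"
      by (rule image_subsetI) (rule \<psi>top)
    show "topspace (ndisk n) \<times> {0..1} \<subseteq> \<psi> n ` topspace (ndisk (Suc n))"
    proof
      fix w :: "(nat \<Rightarrow> real) \<times> real" assume w: "w \<in> topspace (ndisk n) \<times> {0..1}"
      show "w \<in> \<psi> n ` topspace (ndisk (Suc n))"
        using \<psi>(4)[OF w] \<zeta>top[OF w] image_eqI[of w "\<psi> n" "\<zeta> n w"] by simp
    qed
  qed
  have \<psi>int: "\<psi> n ` ndisk_interior (Suc n) = ndisk_interior n \<times> {0<..<1}" for n
  proof
    show "\<psi> n ` ndisk_interior (Suc n) \<subseteq> ndisk_interior n \<times> {0<..<1}"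
    proof (rule image_subsetI)
      fix v assume v: "v \<in> ndisk_interior (Suc n)"
      then have "v \<in> topspace (ndisk (Suc n))" using int_top[of "Suc n"] by blast
      from \<psi>(5)[OF this] v show "\<psi> n v \<in> ndisk_interior n \<times> {0<..<1}" by blast
    qed
    show "ndisk_interior n \<times> {0<..<1} \<subseteq> \<psi> n ` ndisk_interior (Suc n)"
    proof
      fix w assume w: "w \<in> ndisk_interior n \<times> {0<..<1::real}"
      have w': "w \<in> topspace (ndisk n) \<times> {0..1}" using w int_top[of n] by auto
      have "\<zeta> n w \<in> ndisk_interior (Suc n)" using \<psi>(5)[OF \<zeta>top[OF w']] \<psi>(4)[OF w'] w by simp
      then show "w \<in> \<psi> n ` ndisk_interior (Suc n)" using \<psi>(4)[OF w'] image_eqI[of w "\<psi> n" "\<zeta> n w"] by simp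
    qed
  qed
  obtain \<eta> \<beta> where \<eta>: "continuous_map ?C euclideanreal \<eta>"
    and \<beta>: "continuous_map (subtopology ?C {z \<in> topspace ?C. \<eta> z \<in> {..<1}}) K \<beta>"
    and \<eta>q: "\<And>p t. p \<in> topspace K \<Longrightarrow> t \<in> {0..1} \<Longrightarrow> \<eta> (q (p, t)) = t"
    and \<beta>q: "\<And>p t. p \<in> topspace K \<Longrightarrow> t \<in> {0..<1} \<Longrightarrow> \<beta> (q (p, t)) = p"
    by (rule cone_coordinates[OF q]) (rule that)
  have HC: "Hausdorff_space ?C" by (rule Hausdorff_topcone[OF K1 q])
  have cell_top: "closed_cell c \<subseteq> topspace K" if "c \<in> E" for c
    using continuous_map_image_subset_topspace[OF K2[OF that]] by (auto simp: closed_cell_def)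
  have oc: "open_cell c \<subseteq> closed_cell c" for c :: "'k cell"
    using int_top by (auto simp: open_cell_def closed_cell_def)
  have open_top: "open_cell c \<subseteq> topspace K" if "c \<in> E" for c
    using oc[of c] cell_top[OF that] by (rule subset_trans)
  \<comment> \<open>All points \<open>q (p, 1)\<close> are the apex; \<open>p0\<close> names
    it.\<close>
  define vert :: "'c cell" where "vert = (0, \<lambda>_. q (p0, 1))"
  define bs :: "'k cell \<Rightarrow> 'c cell" where "bs c = (fst c, \<lambda>x. q (snd c x, 0))" for c
  define cn :: "'k cell \<Rightarrow> 'c cell" where
    "cn c = (Suc (fst c), \<lambda>v. q (snd c (fst (\<psi> (fst c) v)), snd (\<psi> (fst c) v)))" for c
  define E' where "E' = insert vert (bs ` E \<union> cn ` E)"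
  have cells: "e = vert \<or> (\<exists>c\<in>E. e = bs c) \<or> (\<exists>c\<in>E. e = cn c)" if "e \<in> E'" for e
    using that unfolding E'_def by blast
  have zero_int: "(\<lambda>_. 0) \<in> ndisk_interior n" for n
    by (simp add: ndisk_interior_def ndisk_def topspace_Euclidean_space)
  have oc_vert: "open_cell vert = {q (p0, 1)}" using zero_int[of 0] by (auto simp: open_cell_def vert_def)
  have cc_vert: "closed_cell vert = {q (p0, 1)}"
    using zero_int[of 0] int_top[of 0] by (auto simp: closed_cell_def vert_def)
  have oc_bs: "open_cell (bs c) = (\<lambda>p. q (p, 0)) ` open_cell c" for c
    by (simp add: open_cell_def bs_def image_image)
  have cc_bs: "closed_cell (bs c) = (\<lambda>p. q (p, 0)) ` closed_cell c" for c
    by (simp add: closed_cell_def bs_def image_image)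
  have oc_cn: "open_cell (cn c) = q ` (open_cell c \<times> {0<..<1})" for c
  proof -
    have "open_cell (cn c) = (\<lambda>w. q (snd c (fst w), snd w)) ` (\<psi> (fst c) ` ndisk_interior (Suc (fst c)))"
      by (simp add: open_cell_def cn_def image_image)
    also have "\<dots> = q ` (open_cell c \<times> {0<..<1})"
      unfolding \<psi>int by (force simp: open_cell_def image_iff)
    finally show ?thesis .
  qed
  have cc_cn: "closed_cell (cn c) = q ` (closed_cell c \<times> {0..1})" for c
  proof -
    have "closed_cell (cn c) = (\<lambda>w. q (snd c (fst w), snd w)) ` (\<psi> (fst c) ` topspace (ndisk (Suc (fst c))))"
      by (simp add: closed_cell_def cn_def image_image)
    also have "\<dots> = q ` (closed_cell c \<times> {0..1})"
      unfolding \<psi>im by (force simp: closed_cell_def image_iff)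
    finally show ?thesis .
  qed
  have cont: "continuous_map (ndisk (fst e)) ?C (snd e)" if eE: "e \<in> E'" for e
  proof -
    consider "e = vert" | c where "c \<in> E" "e = bs c" | c where "c \<in> E" "e = cn c"
      using cells[OF eE] by blast
    then show ?thesis
    proof cases
      case 1
      have "q (p0, 1) \<in> topspace ?C" using p0 by (auto simp: topspace_cone)
      then show ?thesis by (simp add: 1 vert_def)
    next
      case 2
      have "continuous_map (ndisk (fst c)) ?C (\<lambda>x. q (snd c x, 0))"
        by (rule continuous_map_into_cone[OF K2[OF 2(1)]]) auto
      then show ?thesis by (simp add: 2 bs_def)
    next
      case 3
      let ?n = "fst c"
      have "continuous_map (ndisk (Suc ?n)) ?C (\<lambda>v. q (snd c (fst (\<psi> ?n v)), snd (\<psi> ?n v)))"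
      proof (rule continuous_map_into_cone)
        show "continuous_map (ndisk (Suc ?n)) K (\<lambda>v. snd c (fst (\<psi> ?n v)))"
          using continuous_map_compose[OF continuous_map_compose[OF \<psi>(1)[of ?n] continuous_map_fst] K2[OF 3(1)]]
          by (simp add: o_def)
        have "continuous_map (ndisk (Suc ?n)) unit_interval (\<lambda>v. snd (\<psi> ?n v))"
          using continuous_map_compose[OF \<psi>(1)[of ?n] continuous_map_snd] by (simp add: o_def)
        then show "continuous_map (ndisk (Suc ?n)) euclideanreal (\<lambda>v. snd (\<psi> ?n v))"
          by (rule continuous_map_into_fulltopology)
        show "snd (\<psi> ?n z) \<in> {0..1}" if "z \<in> topspace (ndisk (Suc ?n))" for z
          using \<psi>top[OF that] by (cases "\<psi> ?n z") auto
      qed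
      then show ?thesis by (simp add: 3 cn_def)
    qed
  qed
  have inverse: "\<exists>g. continuous_map (subtopology K (open_cell c)) (subtopology (ndisk (fst c)) (ndisk_interior (fst c))) g \<and>
      (\<forall>x\<in>ndisk_interior (fst c). g (snd c x) = x)" if c: "c \<in> E" for c
  proof -
    let ?I = "subtopology (ndisk (fst c)) (ndisk_interior (fst c))"
    have ti: "topspace ?I = ndisk_interior (fst c)" using int_top by auto
    have "homeomorphic_map ?I (subtopology K (open_cell c)) (snd c)"
      using K3[OF c] unfolding embedding_map_def ti open_cell_def .
    then obtain g where "homeomorphic_maps ?I (subtopology K (open_cell c)) (snd c) g"
      using homeomorphic_map_maps by blast
    then show ?thesis unfolding homeomorphic_maps_def ti by blast
  qed
  have emb: "embedding_map (subtopology (ndisk (fst e)) (ndisk_interior (fst e))) ?C (snd e)" if eE: "e \<in> E'" for e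
  proof -
    have ti: "topspace (subtopology (ndisk n) (ndisk_interior n)) = ndisk_interior n" for n using int_top by auto
    have ce: "continuous_map (subtopology (ndisk (fst e)) (ndisk_interior (fst e))) ?C (snd e)"
      by (rule continuous_map_from_subtopology[OF cont[OF eE]])
    consider "e = vert" | c where "c \<in> E" "e = bs c" | c where "c \<in> E" "e = cn c"
      using cells[OF eE] by blast
    then show ?thesis
    proof cases
      case 1
      show ?thesis
      proof (rule embedding_map_left_inverse[OF ce order_refl, of "\<lambda>_ _. 0"])
        have "x = (\<lambda>_. 0)" if "x \<in> topspace (ndisk 0)" for x
          using that by (auto simp: topspace_ndisk)
        then show "(\<lambda>_. 0) = x" if "x \<in> topspace (subtopology (ndisk (fst e)) (ndisk_interior (fst e)))" for x
          using that unfolding 1 vert_def by auto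
        show "continuous_map (subtopology ?C (snd e ` topspace (subtopology (ndisk (fst e)) (ndisk_interior (fst e)))))
           (subtopology (ndisk (fst e)) (ndisk_interior (fst e))) (\<lambda>_ _. 0)"
          using zero_int[of "fst e"] int_top[of "fst e"] unfolding ti by (auto simp: ti)
      qed
    next
      case 2
      obtain g where g: "continuous_map (subtopology K (open_cell c)) (subtopology (ndisk (fst c)) (ndisk_interior (fst c))) g"
        "\<forall>x\<in>ndisk_interior (fst c). g (snd c x) = x" using inverse[OF 2(1)] by blast
      let ?V = "{z \<in> topspace ?C. \<eta> z \<in> {..<1} \<and> \<beta> z \<in> open_cell c}"
      have b: "continuous_map (subtopology ?C ?V) (subtopology K (open_cell c)) \<beta>"
        using continuous_map_from_subtopology_mono[OF \<beta>, of ?V] by (auto simp: continuous_map_in_subtopology)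
      have fe: "fst e = fst c" "snd e = (\<lambda>x. q (snd c x, 0))" by (simp_all add: 2 bs_def)
      have pt: "snd c x \<in> topspace K" "snd c x \<in> open_cell c" if "x \<in> ndisk_interior (fst c)" for x
        using that open_top[OF 2(1)] by (auto simp: open_cell_def)
      show ?thesis
      proof (rule embedding_map_left_inverse[OF ce])
        show "snd e ` topspace (subtopology (ndisk (fst e)) (ndisk_interior (fst e))) \<subseteq> ?V"
          unfolding ti fe using pt \<eta>q \<beta>q by (auto simp: topspace_cone)
        show "continuous_map (subtopology ?C ?V) (subtopology (ndisk (fst e)) (ndisk_interior (fst e))) (g \<circ> \<beta>)"
          unfolding fe by (rule continuous_map_compose[OF b g(1)])
        show "(g \<circ> \<beta>) (snd e x) = x" if "x \<in> topspace (subtopology (ndisk (fst e)) (ndisk_interior (fst e)))" for x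
          using that pt[of x] \<beta>q[of "snd c x" 0] g(2) unfolding ti fe by simp
      qed
    next
      case 3
      let ?n = "fst c"
      obtain g where g: "continuous_map (subtopology K (open_cell c)) (subtopology (ndisk ?n) (ndisk_interior ?n)) g"
        "\<forall>x\<in>ndisk_interior ?n. g (snd c x) = x" using inverse[OF 3(1)] by blast
      \<comment> \<open>On this set height and base coordinate are both available; \<open>g\<close>
        inverts the characteristic map of \<open>c\<close> in the base coordinate, and
        \<open>\<zeta>\<close> returns from the cylinder to the disk.\<close>
      let ?V = "{z \<in> topspace ?C. \<eta> z \<in> {0<..<1} \<and> \<beta> z \<in> open_cell c}"
      have b: "continuous_map (subtopology ?C ?V) (subtopology K (open_cell c)) \<beta>"
        using continuous_map_from_subtopology_mono[OF \<beta>, of ?V] by (auto simp: continuous_map_in_subtopology)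
      have gb: "continuous_map (subtopology ?C ?V) (subtopology (ndisk ?n) (ndisk_interior ?n)) (g \<circ> \<beta>)"
        by (rule continuous_map_compose[OF b g(1)])
      have gb1: "continuous_map (subtopology ?C ?V) (ndisk ?n) (g \<circ> \<beta>)"
        by (rule continuous_map_into_fulltopology[OF gb])
      have gb2: "g (\<beta> z) \<in> ndisk_interior ?n" if "z \<in> ?V" for z
        using continuous_map_image_subset_topspace[OF gb] that unfolding ti by auto
      have h: "continuous_map (subtopology ?C ?V) unit_interval \<eta>"
        using continuous_map_from_subtopology[OF \<eta>, of ?V] by (auto simp: continuous_map_in_subtopology)
      have "continuous_map (subtopology ?C ?V) (prod_topology (ndisk ?n) unit_interval) (\<lambda>z. ((g \<circ> \<beta>) z, \<eta> z))"
        by (rule continuous_map_pairedI[OF gb1 h])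
      from continuous_map_compose[OF this \<psi>(2)]
      have inv: "continuous_map (subtopology ?C ?V) (ndisk (Suc ?n)) (\<lambda>z. \<zeta> ?n (g (\<beta> z), \<eta> z))"
        by (simp add: o_def)
      have fe: "fst e = Suc ?n" "snd e = (\<lambda>v. q (snd c (fst (\<psi> ?n v)), snd (\<psi> ?n v)))" by (simp_all add: 3 cn_def)
      have pt: "snd c x \<in> topspace K" "snd c x \<in> open_cell c" if "x \<in> ndisk_interior ?n" for x
        using that open_top[OF 3(1)] by (auto simp: open_cell_def)
      have vi: "fst (\<psi> ?n v) \<in> ndisk_interior ?n \<and> snd (\<psi> ?n v) \<in> {0<..<1}" if "v \<in> ndisk_interior (Suc ?n)" for v
        using \<psi>int[of ?n] that by (metis image_eqI mem_Times_iff)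
      show ?thesis
      proof (rule embedding_map_left_inverse[OF ce])
        show "snd e ` topspace (subtopology (ndisk (fst e)) (ndisk_interior (fst e))) \<subseteq> ?V"
        proof
          fix z assume "z \<in> snd e ` topspace (subtopology (ndisk (fst e)) (ndisk_interior (fst e)))"
          then obtain v where v: "v \<in> ndisk_interior (Suc ?n)" "z = q (snd c (fst (\<psi> ?n v)), snd (\<psi> ?n v))"
            unfolding ti fe by blast
          then show "z \<in> ?V"
            using vi[OF v(1)] pt[of "fst (\<psi> ?n v)"] \<eta>q[of "snd c (fst (\<psi> ?n v))" "snd (\<psi> ?n v)"]
              \<beta>q[of "snd c (fst (\<psi> ?n v))" "snd (\<psi> ?n v)"] by (auto simp: topspace_cone)
        qed
        have "\<zeta> ?n (g (\<beta> z), \<eta> z) \<in> ndisk_interior (Suc ?n)" if z: "z \<in> ?V" for z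
        proof -
          have w: "(g (\<beta> z), \<eta> z) \<in> topspace (ndisk ?n) \<times> {0..1}" using gb2[OF z] z int_top by auto
          show ?thesis using \<psi>(5)[OF \<zeta>top[OF w]] \<psi>(4)[OF w] gb2[OF z] z by simp
        qed
        then show "continuous_map (subtopology ?C ?V) (subtopology (ndisk (fst e)) (ndisk_interior (fst e)))
            (\<lambda>z. \<zeta> ?n (g (\<beta> z), \<eta> z))"
          using inv unfolding fe by (auto simp: continuous_map_in_subtopology)
        show "\<zeta> ?n (g (\<beta> (snd e v)), \<eta> (snd e v)) = v"
          if "v \<in> topspace (subtopology (ndisk (fst e)) (ndisk_interior (fst e)))" for v
        proof -
          have v: "v \<in> ndisk_interior (Suc ?n)" using that unfolding ti fe by simp
          have "\<beta> (snd e v) = snd c (fst (\<psi> ?n v))" "\<eta> (snd e v) = snd (\<psi> ?n v)"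
            using vi[OF v] pt[of "fst (\<psi> ?n v)"] \<eta>q \<beta>q unfolding fe by auto
          then show ?thesis using g(2) vi[OF v] \<psi>(3)[of v ?n] v int_top by auto
        qed
      qed
    qed
  qed
  have oq: "\<eta> z = 0" if "z \<in> open_cell (bs c)" "c \<in> E" for z c
    using that \<eta>q open_top[OF that(2)] by (auto simp: oc_bs)
  have oq1: "\<eta> z \<in> {0<..<1}" if "z \<in> open_cell (cn c)" "c \<in> E" for z c
    using that \<eta>q open_top[OF that(2)] by (auto simp: oc_cn subset_iff)
  have oqv: "\<eta> z = 1" if "z \<in> open_cell vert" for z
    using that \<eta>q[OF p0, of 1] by (simp add: oc_vert)
  have obs: "\<beta> z \<in> open_cell c" if "z \<in> open_cell (bs c)" "c \<in> E" for z c
    using that \<beta>q open_top[OF that(2)] by (auto simp: oc_bs subset_iff)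
  have obs1: "\<beta> z \<in> open_cell c" if "z \<in> open_cell (cn c)" "c \<in> E" for z c
    using that \<beta>q open_top[OF that(2)] by (auto simp: oc_cn subset_iff)
  have disj: "disjnt (open_cell e) (open_cell e')" if e: "e \<in> E'" "e' \<in> E'" "e \<noteq> e'" for e e'
  proof (rule ccontr)
    assume "\<not> ?thesis"
    then obtain z where z: "z \<in> open_cell e" "z \<in> open_cell e'" by (auto simp: disjnt_iff)
    have eqc: "c = c'" if "c \<in> E" "c' \<in> E" "\<beta> z \<in> open_cell c" "\<beta> z \<in> open_cell c'" for c c'
      using K4[of c c'] that by (auto simp: disjnt_iff)
    from cells[OF e(1)] show False
    proof (elim disjE bexE)
      assume v: "e = vert"
      from cells[OF e(2)] show False
      proof (elim disjE bexE)
        fix c assume "c \<in> E" "e' = bs c"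
        then show False using oqv[of z] oq[of z c] z v by simp
      next
        fix c assume "c \<in> E" "e' = cn c"
        then show False using oqv[of z] oq1[of z c] z v by simp
      qed (use v e(3) in simp)
    next
      fix c assume c: "c \<in> E" "e = bs c"
      from cells[OF e(2)] show False
      proof (elim disjE bexE)
        assume "e' = vert"
        then show False using oqv[of z] oq[of z c] z c by simp
      next
        fix c' assume c': "c' \<in> E" "e' = bs c'"
        then show False using eqc[of c c'] obs[of z c] obs[of z c'] z c e(3) by simp
      next
        fix c' assume "c' \<in> E" "e' = cn c'"
        then show False using oq[of z c] oq1[of z c'] z c by simp
      qed
    next
      fix c assume c: "c \<in> E" "e = cn c"
      from cells[OF e(2)] show False
      proof (elim disjE bexE)
        assume "e' = vert"
        then show False using oqv[of z] oq1[of z c] z c by simp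
      next
        fix c' assume "c' \<in> E" "e' = bs c'"
        then show False using oq[of z c'] oq1[of z c] z c by simp
      next
        fix c' assume c': "c' \<in> E" "e' = cn c'"
        then show False using eqc[of c c'] obs1[of z c] obs1[of z c'] z c e(3) by simp
      qed
    qed
  qed
  have covers: "(\<Union>e\<in>E'. open_cell e) = topspace ?C"
  proof
    show "(\<Union>e\<in>E'. open_cell e) \<subseteq> topspace ?C"
    proof (rule UN_least)
      fix e assume e: "e \<in> E'"
      show "open_cell e \<subseteq> topspace ?C"
        unfolding open_cell_def
        using image_mono[OF int_top] continuous_map_image_subset_topspace[OF cont[OF e]] by (rule subset_trans)
    qed
    show "topspace ?C \<subseteq> (\<Union>e\<in>E'. open_cell e)"
    proof
      fix z assume "z \<in> topspace ?C"
      then obtain p t where p: "z = q (p, t)" "p \<in> topspace K" "t \<in> {0..1}" unfolding topspace_cone by blast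
      then obtain c where c: "c \<in> E" "p \<in> open_cell c" using K5 by blast
      consider "t = 0" | "t = 1" | "t \<in> {0<..<1}" using p(3) by force
      then show "z \<in> (\<Union>e\<in>E'. open_cell e)"
      proof cases
        case 1
        then have "z \<in> open_cell (bs c)" using p c by (auto simp: oc_bs)
        then show ?thesis using c by (auto simp: E'_def)
      next
        case 2
        then have "z = q (p0, 1)" using p cone_mapD[OF q p(2) p0, of 1 1] by simp
        then show ?thesis by (auto simp: E'_def oc_vert)
      next
        case 3
        then have "z \<in> open_cell (cn c)" using p c by (auto simp: oc_cn)
        then show ?thesis using c by (auto simp: E'_def)
      qed
    qed
  qed
  have bdry: "\<exists>F\<subseteq>E'. finite F \<and> (\<forall>d\<in>F. fst d < fst e) \<and> snd e ` ndisk_boundary (fst e) \<subseteq> (\<Union>d\<in>F. open_cell d)"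
    if eE: "e \<in> E'" for e
  proof -
    consider "e = vert" | c where "c \<in> E" "e = bs c" | c where "c \<in> E" "e = cn c"
      using cells[OF eE] by blast
    then show ?thesis
    proof cases
      case 1
      have "ndisk_boundary 0 = {}" by (auto simp: ndisk_boundary_def)
      then show ?thesis using 1 by (intro exI[of _ "{}"]) (simp add: vert_def)
    next
      case 2
      obtain F where F: "F \<subseteq> E" "finite F" "\<forall>d\<in>F. fst d < fst c" "snd c ` ndisk_boundary (fst c) \<subseteq> (\<Union>d\<in>F. open_cell d)"
        using K6[OF 2(1)] by blast
      have "snd e ` ndisk_boundary (fst e) \<subseteq> (\<Union>d\<in>bs ` F. open_cell d)"
        using F(4) by (fastforce simp: 2 bs_def oc_bs[unfolded bs_def] image_subset_iff)
      moreover have "bs ` F \<subseteq> E'" using F(1) by (auto simp: E'_def)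
      moreover have "\<forall>d\<in>bs ` F. fst d < fst e" using F(3) by (simp add: 2 bs_def)
      ultimately show ?thesis using F(2) by blast
    next
      case 3
      let ?n = "fst c"
      obtain F where F: "F \<subseteq> E" "finite F" "\<forall>d\<in>F. fst d < fst c" "snd c ` ndisk_boundary (fst c) \<subseteq> (\<Union>d\<in>F. open_cell d)"
        using K6[OF 3(1)] by blast
      \<comment> \<open>The top of the cylinder goes to the apex, the bottom to the base copies of
        \<open>c\<close> and of the cells in \<open>F\<close>, and the side at heights strictly
        between 0 and 1 to the cone cells over \<open>F\<close>.\<close>
      define F' where "F' = {vert, bs c} \<union> bs ` F \<union> cn ` F"
      have "snd e ` ndisk_boundary (fst e) \<subseteq> (\<Union>d\<in>F'. open_cell d)"
      proof
        fix z assume "z \<in> snd e ` ndisk_boundary (fst e)"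
        then obtain v where v: "v \<in> ndisk_boundary (Suc ?n)" "z = q (snd c (fst (\<psi> ?n v)), snd (\<psi> ?n v))"
          by (auto simp: 3 cn_def)
        define x where "x = fst (\<psi> ?n v)"
        define t where "t = snd (\<psi> ?n v)"
        have xt: "\<psi> ?n v = (x, t)" by (simp add: x_def t_def)
        have vb: "v \<in> topspace (ndisk (Suc ?n))" "v \<notin> ndisk_interior (Suc ?n)"
          using v(1) by (auto simp: ndisk_boundary_iff)
        have x: "x \<in> topspace (ndisk ?n)" "t \<in> {0..1}" using \<psi>top[OF vb(1)] xt by auto
        have ni: "\<not> (x \<in> ndisk_interior ?n \<and> t \<in> {0<..<1})" using \<psi>(5)[OF vb(1)] vb(2) xt by auto
        have z: "z = q (snd c x, t)" using v(2) by (simp add: x_def t_def)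
        have cx: "snd c x \<in> topspace K"
          using cell_top[OF 3(1)] x(1) by (auto simp: closed_cell_def)
        consider "t = 1" | "t = 0" "x \<in> ndisk_interior ?n" | "x \<in> ndisk_boundary ?n" "t = 0"
          | "x \<in> ndisk_boundary ?n" "t \<in> {0<..<1}"
          using x ni by (force simp: ndisk_boundary_iff)
        then show "z \<in> (\<Union>d\<in>F'. open_cell d)"
        proof cases
          case 1
          then have "z \<in> open_cell vert" using z cone_mapD[OF q cx p0, of 1 1] by (simp add: oc_vert)
          then show ?thesis by (auto simp: F'_def)
        next
          case 2
          then have "z \<in> open_cell (bs c)" unfolding z oc_bs by (auto simp: open_cell_def)
          then show ?thesis by (auto simp: F'_def)
        next
          case 3
          then obtain d where d: "d \<in> F" "snd c x \<in> open_cell d" using F(4) by blast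
          then have "z \<in> open_cell (bs d)" unfolding z oc_bs using 3 by auto
          then show ?thesis using d by (auto simp: F'_def)
        next
          case 4
          then obtain d where d: "d \<in> F" "snd c x \<in> open_cell d" using F(4) by blast
          then have "z \<in> open_cell (cn d)" unfolding z oc_cn using 4 by auto
          then show ?thesis using d by (auto simp: F'_def)
        qed
      qed
      moreover have "F' \<subseteq> E'" using F(1) 3(1) by (auto simp: F'_def E'_def)
      moreover have "\<forall>d\<in>F'. fst d < fst e" using F(3) by (auto simp: F'_def 3 bs_def cn_def vert_def)
      moreover have "finite F'" using F(2) by (simp add: F'_def)
      ultimately show ?thesis by blast
    qed
  qed
  have cc_closed: "closedin ?C (closed_cell e)" if "e \<in> E'" for e
  proof -
    have "compactin ?C (snd e ` topspace (ndisk (fst e)))"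
      using compact_ndisk by (intro image_compactin[OF _ cont[OF that]]) (simp add: compact_space_def)
    then show ?thesis using compactin_imp_closedin[OF HC] by (simp add: closed_cell_def)
  qed
  have K_cc: "closedin K (closed_cell c)" "compactin K (closed_cell c)" if "c \<in> E" for c
  proof -
    show "compactin K (closed_cell c)"
      unfolding closed_cell_def using compact_ndisk by (intro image_compactin[OF _ K2[OF that]]) (simp add: compact_space_def)
    then show "closedin K (closed_cell c)" by (rule compactin_imp_closedin[OF K1])
  qed
  let ?P = "prod_topology K unit_interval"
  \<comment> \<open>It suffices that a subset of \<open>K \<times> [0, 1]\<close> is closed if its
    trace over every closed cell of \<open>K\<close> is; the quotient map carries this to the
    cone.\<close>
  have weak: "closedin ?C S" if S: "S \<subseteq> topspace ?C" "\<And>e. e \<in> E' \<Longrightarrow> closedin ?C (S \<inter> closed_cell e)" for S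
  proof -
    define T where "T = {x \<in> topspace ?P. q x \<in> S}"
    have Tc: "closedin ?P (T \<inter> (closed_cell c \<times> {0..1}))" if c: "c \<in> E" for c
    proof -
      have "cn c \<in> E'" using c by (simp add: E'_def)
      then have "closedin ?P {x \<in> topspace ?P. q x \<in> S \<inter> closed_cell (cn c)}"
        by (intro closedin_continuous_map_preimage[OF continuous_map_cone] S(2))
      moreover have "closedin ?P (closed_cell c \<times> {0..1})"
        using K_cc(1)[OF c] by (simp add: closedin_prod_Times_iff)
      ultimately have "closedin ?P ({x \<in> topspace ?P. q x \<in> S \<inter> closed_cell (cn c)} \<inter> (closed_cell c \<times> {0..1}))"
        by (rule closedin_Int)
      moreover have "{x \<in> topspace ?P. q x \<in> S \<inter> closed_cell (cn c)} \<inter> (closed_cell c \<times> {0..1}) = T \<inter> (closed_cell c \<times> {0..1})"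
        by (auto simp: T_def cc_cn)
      ultimately show ?thesis by simp
    qed
    have "openin ?P (topspace ?P - T)"
    proof (subst openin_subopen, intro ballI)
      fix x assume x: "x \<in> topspace ?P - T"
      obtain k t where xe: "x = (k, t)" by (cases x)
      have k: "k \<in> topspace K" and t: "t \<in> {0..1}" using x xe by auto
      obtain c where c: "c \<in> E" "k \<in> open_cell c" using k K5 by blast
      have kc: "k \<in> closed_cell c" using c(2) oc by blast
      have emb_k: "continuous_map unit_interval ?P (\<lambda>s. (k, s))"
        using k by (intro continuous_map_pairedI) auto
      have "closedin unit_interval {s \<in> topspace unit_interval. (k, s) \<in> T \<inter> (closed_cell c \<times> {0..1})}"
        by (rule closedin_continuous_map_preimage[OF emb_k Tc[OF c(1)]])
      then have "openin unit_interval (topspace unit_interval - {s \<in> topspace unit_interval. (k, s) \<in> T \<inter> (closed_cell c \<times> {0..1})})"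
        by blast
      moreover have "t \<in> topspace unit_interval - {s \<in> topspace unit_interval. (k, s) \<in> T \<inter> (closed_cell c \<times> {0..1})}"
        using x xe t by auto
      moreover have "neighbourhood_base_of (compactin unit_interval) unit_interval"
        using locally_compact_unit_interval locally_compact_space_neighbourhood_base by blast
      ultimately obtain U J where UJ: "openin unit_interval U" "compactin unit_interval J" "t \<in> U" "U \<subseteq> J"
        "J \<subseteq> topspace unit_interval - {s \<in> topspace unit_interval. (k, s) \<in> T \<inter> (closed_cell c \<times> {0..1})}"
        unfolding neighbourhood_base_of by meson
      have J01: "J \<subseteq> {0..1}" using UJ(5) by auto
      \<comment> \<open>\<open>J\<close> is a compact neighbourhood of \<open>t\<close> with
        \<open>{k} \<times> J\<close> disjoint from \<open>T\<close>. Over a closed cell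
        \<open>B\<close> is the projection of a compact set, so \<open>B\<close> is closed in
        \<open>K\<close>, and its complement times \<open>U\<close> is the required box.\<close>
      define B where "B = {k' \<in> topspace K. \<exists>s\<in>J. (k', s) \<in> T}"
      have "closedin K B"
      proof (rule K7)
        show "B \<subseteq> topspace K" by (auto simp: B_def)
        fix d assume d: "d \<in> E"
        have "compactin ?P (closed_cell d \<times> J)" using K_cc(2)[OF d] UJ(2) by (simp add: compactin_Times)
        then have "compactin ?P ((T \<inter> (closed_cell d \<times> {0..1})) \<inter> (closed_cell d \<times> J))"
          using closed_Int_compactin[OF Tc[OF d]] by blast
        then have "compactin K (fst ` ((T \<inter> (closed_cell d \<times> {0..1})) \<inter> (closed_cell d \<times> J)))"
          by (rule image_compactin) (rule continuous_map_fst)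
        moreover have "fst ` ((T \<inter> (closed_cell d \<times> {0..1})) \<inter> (closed_cell d \<times> J)) = B \<inter> closed_cell d"
          using J01 cell_top[OF d] by (force simp: B_def image_iff)
        ultimately show "closedin K (B \<inter> closed_cell d)"
          using compactin_imp_closedin[OF K1] by metis
      qed
      then have "openin ?P ((topspace K - B) \<times> U)"
        using UJ(1) by (simp add: openin_prod_Times_iff openin_diff)
      moreover have "x \<in> (topspace K - B) \<times> U"
        using k kc UJ(3,5) J01 by (auto simp: xe B_def)
      moreover have "(topspace K - B) \<times> U \<subseteq> topspace ?P - T"
        using UJ(4) J01 by (auto simp: B_def)
      ultimately show "\<exists>W. openin ?P W \<and> x \<in> W \<and> W \<subseteq> topspace ?P - T" by blast
    qed
    then have "closedin ?P T" by (auto simp: closedin_def T_def)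
    then show ?thesis
      using quotient_map_cone[of K q] S(1) unfolding quotient_map_closedin T_def by blast
  qed
  have "CW_structure ?C E'"
    unfolding CW_structure_def
  proof (intro conjI allI impI)
    show "\<forall>(n, \<phi>)\<in>E'. continuous_map (ndisk n) ?C \<phi> \<and> embedding_map (subtopology (ndisk n) (ndisk_interior n)) ?C \<phi>"
      using cont emb by auto
    show "pairwise (\<lambda>c d. disjnt (open_cell c) (open_cell d)) E'" using disj by (auto simp: pairwise_def)
    show "\<forall>(n, \<phi>)\<in>E'. \<exists>F\<subseteq>E'. finite F \<and> (\<forall>d\<in>F. fst d < n) \<and> \<phi> ` ndisk_boundary n \<subseteq> (\<Union>d\<in>F. open_cell d)"
      using bdry by fastforce
    show "closedin ?C S \<longleftrightarrow> (\<forall>c\<in>E'. closedin ?C (S \<inter> closed_cell c))" if "S \<subseteq> topspace ?C" for S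
      using weak[OF that] cc_closed closedin_Int by blast
  qed (use HC covers in auto)
  then show ?thesis unfolding CW_complex_def by blast
qed

section \<open>Return from the product with the cube\<close>

lemma paracompact_space_factor:
  assumes P: "paracompact_space (prod_topology X Z)" and z: "z \<in> topspace Z" and X: "Hausdorff_space X"
  shows "paracompact_space X"
  unfolding paracompact_space_def
proof (intro conjI allI impI)
  show "Hausdorff_space X" by fact
  fix \<U> assume \<U>: "open_cover X \<U>"
  have emb: "continuous_map X (prod_topology X Z) (\<lambda>x. (x, z))"
    using z by (intro continuous_map_pairedI) auto
  have "open_cover (prod_topology X Z) ((\<lambda>U. U \<times> topspace Z) ` \<U>)"
    using \<U> by (auto simp: open_cover_def openin_prod_Times_iff)
  then obtain \<V> where \<V>: "open_cover (prod_topology X Z) \<V>" "refines \<V> ((\<lambda>U. U \<times> topspace Z) ` \<U>)"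
      "locally_finite_in (prod_topology X Z) \<V>"
    using P[unfolded paracompact_space_def, THEN conjunct2, THEN spec[of _ "(\<lambda>U. U \<times> topspace Z) ` \<U>"]]
    by blast
  define sl where "sl V = {x \<in> topspace X. (x, z) \<in> V}" for V
  have sl: "openin X (sl V)" if "openin (prod_topology X Z) V" for V
    unfolding sl_def by (rule openin_continuous_map_preimage[OF emb that])
  show "\<exists>\<V>. open_cover X \<V> \<and> refines \<V> \<U> \<and> locally_finite_in X \<V>"
  proof (intro exI[of _ "sl ` \<V>"] conjI)
    show "open_cover X (sl ` \<V>)"
      unfolding open_cover_def
    proof (intro conjI ballI equalityI subsetI)
      show "openin X S" if "S \<in> sl ` \<V>" for S
        using that \<V>(1) sl unfolding open_cover_def by blast
      fix x assume x: "x \<in> topspace X"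
      then have "(x, z) \<in> \<Union>\<V>" using \<V>(1) z by (simp add: open_cover_def)
      then show "x \<in> \<Union>(sl ` \<V>)" using x by (auto simp: sl_def)
    qed (auto simp: sl_def)
    show "refines (sl ` \<V>) \<U>"
      unfolding refines_def
    proof
      fix S assume "S \<in> sl ` \<V>"
      then obtain V where V: "V \<in> \<V>" "S = sl V" by blast
      then obtain U where "U \<in> \<U>" "V \<subseteq> U \<times> topspace Z" using \<V>(2) unfolding refines_def by blast
      then show "\<exists>U\<in>\<U>. S \<subseteq> U" using V(2) by (auto simp: sl_def)
    qed
    show "locally_finite_in X (sl ` \<V>)"
      unfolding locally_finite_in_def
    proof (intro conjI ballI)
      show "\<Union>(sl ` \<V>) \<subseteq> topspace X" by (auto simp: sl_def)
      fix x assume x: "x \<in> topspace X"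
      then have "(x, z) \<in> topspace (prod_topology X Z)" using z by simp
      then obtain N where N: "openin (prod_topology X Z) N" "(x, z) \<in> N" "finite {V \<in> \<V>. V \<inter> N \<noteq> {}}"
        using \<V>(3) unfolding locally_finite_in_def by blast
      have "{S \<in> sl ` \<V>. S \<inter> sl N \<noteq> {}} \<subseteq> sl ` {V \<in> \<V>. V \<inter> N \<noteq> {}}"
        by (auto simp: sl_def)
      then have "finite {S \<in> sl ` \<V>. S \<inter> sl N \<noteq> {}}"
        by (rule finite_subset) (rule finite_imageI[OF N(3)])
      moreover have "x \<in> sl N" using x N(2) by (simp add: sl_def)
      ultimately show "\<exists>N. openin X N \<and> x \<in> N \<and> finite {S \<in> sl ` \<V>. S \<inter> N \<noteq> {}}"
        using sl[OF N(1)] by blast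
    qed
  qed
qed

theorem corollary2p7:
  fixes m :: nat
    and X :: "'x topology" and Y :: "'y topology" and K :: "'k topology"
    and f :: "'x \<Rightarrow> 'y"
  assumes "completely_regular_space X" and "Hausdorff_space X"
    and "completely_regular_space Y" and "Hausdorff_space Y"
    and "paracompact_space (prod_topology X (cube m))"
    and "cw_space TYPE(('x \<times> 'k \<times> real) set) (prod_topology X (cube m))"
    and "CW_complex K"
    and "continuous_map X Y f" and "closed_map X Y f" and "f ` topspace X = topspace Y"
    and "covering_dim_le Y m"
    and "\<And>y. y \<in> topspace Y \<Longrightarrow> edim_le (subtopology X {x \<in> topspace X. f x = y}) K"
  shows "edim_le X (iterated_suspension m K)"
proof (cases "topspace K = {}")
  case True
  \<comment> \<open>The cone construction uses a point of \<open>K\<close>, so empty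
    \<open>K\<close> is treated apart: extending the empty map over a fibre of a point of
    \<open>X\<close> would produce a point of \<open>K\<close>.\<close>
  have "topspace X = {}"
  proof (rule ccontr)
    assume "topspace X \<noteq> {}"
    then obtain x where x: "x \<in> topspace X" by blast
    let ?F = "subtopology X {x' \<in> topspace X. f x' = f x}"
    have "f x \<in> topspace Y" using x assms(10) by blast
    then have F: "abs_extensor K ?F" by (rule assms(12))
    have "continuous_map (subtopology ?F {}) K (\<lambda>_. undefined)"
      by (simp add: continuous_map_on_empty)
    then have "\<exists>h. continuous_map ?F K h \<and> (\<forall>x\<in>{}. h x = undefined)"
      using F[unfolded abs_extensor_def, THEN spec[of _ "{}"], THEN spec[of _ "\<lambda>_. undefined"]] by simp
    then obtain h where "continuous_map ?F K h" by blast
    then have "h x \<in> topspace K" using continuous_map_image_subset_topspace[of ?F K h] x by auto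
    then show False using True by simp
  qed
  then have "continuous_map X (iterated_suspension m K) g" for g
    by (simp add: continuous_map_def)
  then show ?thesis unfolding abs_extensor_def by blast
next
  case False
  then obtain p0 where p0: "p0 \<in> topspace K" by blast
  let ?W = "prod_topology X (cube m)"
  define z where "z = (\<lambda>i\<in>{..<m}. 0::real)"
  have z: "z \<in> topspace (cube m)" by (auto simp: z_def cube_def)
  have Hc: "Hausdorff_space (cube m)"
    unfolding cube_def Hausdorff_space_product_topology using locally_compact_unit_interval(2) by blast
  have zc: "closedin (cube m) {z}" using z Hc by (simp add: closedin_Hausdorff_sing_eq)
  \<comment> \<open>\<open>X\<close> is the closed slice at the corner \<open>z\<close>, and the
    first projection retracts the product to it; this transfers extension properties from the
    product to \<open>X\<close>.\<close>
  have i: "continuous_map X ?W (\<lambda>x. (x, z))" using z by (intro continuous_map_pairedI) auto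
  have ic: "closed_map X ?W (\<lambda>x. (x, z))"
    unfolding closed_map_def
  proof (intro allI impI)
    fix S assume "closedin X S"
    then have "closedin ?W (S \<times> {z})" using zc by (simp add: closedin_prod_Times_iff)
    moreover have "(\<lambda>x. (x, z)) ` S = S \<times> {z}" by auto
    ultimately show "closedin ?W ((\<lambda>x. (x, z)) ` S)" by simp
  qed
  have shX: "closed_shrinkable X"
    using regular_paracompact_imp_closed_shrinkable paracompact_space_factor[OF assms(5) z assms(2)]
      completely_regular_imp_regular_space[OF assms(1)] by blast
  have shY: "closed_shrinkable Y"
    by (rule closed_shrinkable_closed_map_image[OF shX assms(8,9,10)])
  have nX: "normal_space X" by (rule closed_shrinkable_imp_normal[OF shX])
  txt \<open>A copy of the cone on the type for which \<^const>\<open>cw_space\<close> tests complexes.\<close>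
  define q :: "'k \<times> real \<Rightarrow> ('x \<times> 'k \<times> real) set" where
    "q = (\<lambda>(p, t). {(undefined, if t = 1 then undefined else p, t)})"
  have q: "cone_map K q" by (auto simp: cone_map_def q_def)
  have "CW_complex (topcone K q) \<and> topspace (topcone K q) \<noteq> {} \<and> contractible_space (topcone K q)"
    using CW_complex_topcone[OF assms(7) q p0] contractible_topcone[OF q p0] False
    by (simp add: topspace_cone)
  then have "abs_extensor (topcone K q) ?W"
    using assms(6)[unfolded cw_space_def, THEN conjunct2, THEN spec[of _ "topcone K q"]] by blast
  then have coneX: "abs_extensor (topcone K q) X"
    by (rule abs_extensor_closed_embedding[OF _ i ic continuous_map_fst]) simp
  have ane: "abs_nbhd_extensor (iterated_suspension j K) X" for j
    by (rule abs_nbhd_extensor_if_cone[OF cone_map_std abs_extensor_cone_iterated_suspension[OF q coneX nX]])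
  show ?thesis
    unfolding abs_extensor_def
  proof (intro allI impI, elim conjE)
    fix A g assume A: "closedin X A" and g: "continuous_map (subtopology X A) (iterated_suspension m K) g"
    obtain A0 g0 u where A0: "closedin X A0" "continuous_map (subtopology X A0) K g0"
      and u: "\<forall>i<m. continuous_map X euclideanreal (u i)" and red: "reduces_extension X K m A g A0 g0 u"
      using iterated_suspension_extension_criterion[OF nX False ane A g] by blast
    interpret fibre_extension X Y K f m A0 g0 u
    proof
      show "t1_space Y" by (rule Hausdorff_imp_t1_space[OF assms(4)])
      show "regular_space Y" by (rule completely_regular_imp_regular_space[OF assms(3)])
      show "abs_nbhd_extensor K X" by (rule abs_nbhd_extensor_if_cone[OF q coneX])
    qed (use shY assms(8,9,11,12) A0 u in auto)
    obtain w h where w: "\<And>i. i < m \<Longrightarrow> continuous_map X euclideanreal (w i)"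
      "\<And>i x. i < m \<Longrightarrow> x \<in> topspace X \<Longrightarrow> w i x \<in> {1/3..2/3}"
      and h: "continuous_map (subtopology X {x \<in> topspace X. \<forall>i<m. u i x = w i x}) K h"
      "\<And>x. x \<in> A0 \<Longrightarrow> (\<forall>i<m. u i x = w i x) \<Longrightarrow> h x = g0 x"
      by (rule extension_on_levels) (rule that)
    obtain G where G: "continuous_map (subtopology X (topspace X)) (iterated_suspension m K) G"
      "\<And>x. x \<in> A \<inter> topspace X \<Longrightarrow> G x = g x"
      by (rule reduces_extensionE[OF red closedin_topspace w h]) (auto intro: that)
    then show "\<exists>h. continuous_map X (iterated_suspension m K) h \<and> (\<forall>x\<in>A. h x = g x)"
      using closedin_subset[OF A] by (intro exI[of _ G]) auto
  qed
qed

end
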